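(* Let $0<p,q\le\infty$, $0<s<1$, and let $\Omega\subset\mathbb{R}^n$ be a bounded Lipschitz domain with a resolution of unity $\{\varphi_j\}_{j=0}^N$ and Lipschitz diffeomorphisms $\psi^{(j)}$, $j=1,\dots,N$, as in the context. Then $$\|\varphi_0f|\mathbf{B}^s_{p,q}(\mathbb{R}^n)\|+\sum_{j=1}^N\|(\varphi_jf)\circ(\psi^{(j)})^{-1}|\mathbf{B}^s_{p,q}(\mathbb{R}^n_+)\|$$ is an equivalent quasi-norm in $\mathbf{B}^s_{p,q}(\Omega)$.
   Context: Notation: $\mathbb{N}_0=\{0,1,2,\dots\}$, $\mathbb{R}^n_+=\{x\in\mathbb{R}^n:x_n>0\}$. For $j\in\mathbb{N}_0$, $m\in\mathbb{Z}^n$, $Q_{j,m}$ is the cube in $\mathbb{R}^n$ with sides parallel to the axes, centre $2^{-j}m$, side length $2^{-j+1}$; $dQ_{j,m}$ is the concentric cube with side length $d$ times as large. $[s]$ is the integer part of $s$. Besov spaces on domains. Let $\Omega\subset\mathbb{R}^n$ be a domain ($\Omega=\mathbb{R}^n$ and $\Omega=\mathbb{R}^n_+$ allowed), $s>0$, $0<p,q\le\infty$. For complex $\lambda=\{\lambda_{j,m}\}$ put $\|\lambda|b^s_{p,q}(\Omega)\|=\big(\sum_{j=0}^\infty2^{j(s-n/p)q}(\sum_{m:\,Q_{j,m}\cap\Omega\ne\emptyset}|\lambda_{j,m}|^p)^{q/p}\big)^{1/q}$ (usual modification for $\infty$). Fix $d>1$ and $K\in\mathbb{N}_0$, $K\ge1+[s]$.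 A $K$-atom located at $Q_{j,m}$ is a $C^K$ function $a:\mathbb{R}^n\to\mathbb{C}$ with $\operatorname{supp}a\subset dQ_{j,m}$ and $|D^\alpha a|\le2^{|\alpha|j}$ for $|\alpha|\le K$. $\mathbf{B}^s_{p,q}(\Omega)$ is the set of $f\in L_p(\Omega)$ with $f=\sum_{j}\sum_{m:\,Q_{j,m}\cap\Omega\neq\emptyset}\lambda_{j,m}a_{j,m}$ (convergence in $L_p(\Omega)$), $a_{j,m}$ $K$-atoms located at $Q_{j,m}$, $\|\lambda|b^s_{p,q}(\Omega)\|<\infty$; its quasi-norm is the infimum of $\|\lambda|b^s_{p,q}(\Omega)\|$ over all such representations. It is independent of $d,K$ up to equivalence, and equals the space of restrictions to $\Omega$ of elements of $\mathbf{B}^s_{p,q}(\mathbb{R}^n)$ with the quotient quasi-norm. Lipschitz domains. A Lipschitz diffeomorphism is a one-to-one map $\Phi$ of $\mathbb{R}^n$ onto itself with Lipschitz components and $|\Phi(x)-\Phi(y)|\sim|x-y|$ for $|x-y|\le1$. A bounded domain $\Omega\subset\mathbb{R}^n$ is a Lipschitz domain if its boundary $\Gamma=\partial\Omega$ is covered by finitely many open balls $K_1,\dots,K_N$, $K_j\cap\Gamma\ne\emptyset$, and there are Lipschitz diffeomorphisms $\psi^{(j)}$ (of $\mathbb{R}^n$ onto itself) with $\psi^{(j)}(K_j\cap\Omega)\subset\mathbb{R}^n_+$ and $\psi^{(j)}(K_j\cap\Gamma)\subset\mathbb{R}^{n-1}$ (identified with $\mathbb{R}^{n-1}\times\{0\}$).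 Let $K_0$ be an inner domain, $\overline{K_0}\subset\Omega$, $\Omega\subset K_0\cup\bigcup_{j=1}^NK_j$, and let $\{\varphi_j\}_{j=0}^N$ be smooth non-negative functions with $\operatorname{supp}\varphi_j\subset K_j$ and $\sum_{j=0}^N\varphi_j=1$ on $\overline\Omega$. In the claim, $\varphi_0f$ is extended by zero to $\mathbb{R}^n$, and $(\varphi_jf)\circ(\psi^{(j)})^{-1}$, defined on $\psi^{(j)}(K_j\cap\Omega)$, is extended by zero to $\mathbb{R}^n_+$. *)

theory Defs
  imports "HOL-Analysis.Analysis" "HOL-Probability.Essential_Supremum"
begin

section \<open>Lebesgue quasi-norms\<close>

text \<open>
  Exponents range over \<open>{0<..\<infinity>}\<close> and are elements of \<^typ>\<open>ennreal\<close>; quasi-norms take values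
  in \<^typ>\<open>ennreal\<close>, with \<open>\<infinity>\<close> for functions outside the space.
\<close>

definition enn_powr :: "ennreal \<Rightarrow> real \<Rightarrow> ennreal" where
  "enn_powr x r = (if x = \<infinity> then \<infinity> else ennreal (enn2real x powr r))"

text \<open>
  Taking \<open>M\<close> to be a counting measure gives the sequence quasi-norms \<open>\<ell>\<^sub>p\<close>, including the
  supremum for \<open>p = \<infinity>\<close>.
\<close>

definition Lp_qnorm :: "ennreal \<Rightarrow> 'a measure \<Rightarrow> ('a \<Rightarrow> ennreal) \<Rightarrow> ennreal" where
  "Lp_qnorm p M g =
     (if p = \<infinity> then esssup M g
      else enn_powr (\<integral>\<^sup>+ x. enn_powr (g x) (enn2real p) \<partial>M) (1 / enn2real p))"

definition Lp_space :: "ennreal \<Rightarrow> 'a measure \<Rightarrow> ('a \<Rightarrow> complex) set" where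
  "Lp_space p M =
     {f \<in> borel_measurable M. Lp_qnorm p M (\<lambda>x. ennreal (cmod (f x))) < \<infinity>}"

section \<open>Functions of class \<open>C\<^sup>K\<close>\<close>

definition partial_deriv ::
    "'n \<Rightarrow> (real^'n \<Rightarrow> 'b::real_normed_vector) \<Rightarrow> real^'n \<Rightarrow> 'b" where
  "partial_deriv i f x = vector_derivative (\<lambda>t. f (x + t *\<^sub>R axis i 1)) (at 0)"

text \<open>
  A derivative \<open>D\<^sup>\<alpha>\<close> is given by the list of coordinates in which one differentiates, so that
  \<open>|\<alpha>|\<close> is the length of the list. For functions of class \<open>C\<^sup>K\<close> the order of the list is
  irrelevant up to length \<open>K\<close>.
\<close>

definition iter_partial ::
    "'n list \<Rightarrow> (real^'n \<Rightarrow> 'b::real_normed_vector) \<Rightarrow> real^'n \<Rightarrow> 'b" where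
  "iter_partial \<alpha> f = foldr partial_deriv \<alpha> f"

definition class_C :: "nat \<Rightarrow> (real^'n \<Rightarrow> 'b::real_normed_vector) \<Rightarrow> bool" where
  "class_C K f \<longleftrightarrow>
     (\<forall>\<alpha>. length \<alpha> \<le> K \<longrightarrow> continuous_on UNIV (iter_partial \<alpha> f)) \<and>
     (\<forall>\<alpha> i x. length \<alpha> < K \<longrightarrow>
        (\<lambda>t. iter_partial \<alpha> f (x + t *\<^sub>R axis i 1)) differentiable (at 0))"

definition smooth :: "(real^'n \<Rightarrow> 'b::real_normed_vector) \<Rightarrow> bool" where
  "smooth f \<longleftrightarrow> (\<forall>K. class_C K f)"

definition supp :: "('a::topological_space \<Rightarrow> 'b::zero) \<Rightarrow> 'a set" where
  "supp f = closure {x. f x \<noteq> 0}"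

section \<open>Besov spaces via atoms\<close>

text \<open>
  \<open>dcube d j m\<close> is the closed cube \<open>dQ\<^bsub>j,m\<^esub>\<close>: half its side length is \<open>d 2\<^bsup>-j\<^esup>\<close>. For open
  \<open>\<Omega>\<close> the closed and the open cube \<open>Q\<^bsub>j,m\<^esub>\<close> meet \<open>\<Omega>\<close> for the same indices.
\<close>

definition dcube :: "real \<Rightarrow> nat \<Rightarrow> int^'n \<Rightarrow> (real^'n) set" where
  "dcube d j m = {x. \<forall>i. \<bar>x $ i - real_of_int (m $ i) / 2 ^ j\<bar> \<le> d / 2 ^ j}"

definition cube_indices :: "(real^'n) set \<Rightarrow> nat \<Rightarrow> (int^'n) set" where
  "cube_indices \<Omega> j = {m. dcube 1 j m \<inter> \<Omega> \<noteq> {}}"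

definition is_atom ::
    "real \<Rightarrow> nat \<Rightarrow> nat \<Rightarrow> int^'n \<Rightarrow> (real^'n \<Rightarrow> complex) \<Rightarrow> bool" where
  "is_atom d K j m a \<longleftrightarrow>
     class_C K a \<and> supp a \<subseteq> dcube d j m \<and>
     (\<forall>\<alpha> x. length \<alpha> \<le> K \<longrightarrow> cmod (iter_partial \<alpha> a x) \<le> 2 ^ (length \<alpha> * j))"

text \<open>
  For \<open>p = \<infinity>\<close> the term \<open>n/p\<close> is \<open>0\<close>, since \<open>enn2real \<infinity> = 0\<close> and \<open>x / 0 = 0\<close>.
\<close>

definition b_qnorm ::
    "real \<Rightarrow> ennreal \<Rightarrow> ennreal \<Rightarrow> (real^'n) set \<Rightarrow>
     (nat \<Rightarrow> int^'n \<Rightarrow> complex) \<Rightarrow> ennreal" where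
  "b_qnorm s p q \<Omega> lam =
     Lp_qnorm q (count_space UNIV)
       (\<lambda>j. ennreal (2 powr (real j * (s - real CARD('n) / enn2real p))) *
            Lp_qnorm p (count_space (cube_indices \<Omega> j)) (\<lambda>m. ennreal (cmod (lam j m))))"

text \<open>
  At every point only finitely many atoms of a given level \<open>j\<close> are non-zero, so the inner
  sum below is a finite sum at every \<open>x\<close>. The outer sum over \<open>j\<close> converges in \<open>L\<^sub>p(\<Omega>)\<close>.
\<close>

definition atomic_rep ::
    "real \<Rightarrow> nat \<Rightarrow> ennreal \<Rightarrow> (real^'n) set \<Rightarrow> (real^'n \<Rightarrow> complex) \<Rightarrow>
     (nat \<Rightarrow> int^'n \<Rightarrow> complex) \<Rightarrow> (nat \<Rightarrow> int^'n \<Rightarrow> real^'n \<Rightarrow> complex) \<Rightarrow> bool" where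
  "atomic_rep d K p \<Omega> f lam a \<longleftrightarrow>
     (\<forall>j. \<forall>m\<in>cube_indices \<Omega> j. is_atom d K j m (a j m)) \<and>
     (\<lambda>J. Lp_qnorm p (lebesgue_on \<Omega>)
        (\<lambda>x. ennreal (cmod (f x -
           (\<Sum>j<J. \<Sum>\<^sub>\<infinity>m\<in>cube_indices \<Omega> j. lam j m * a j m x))))) \<longlonglongrightarrow> 0"

text \<open>Functions are total; only their values almost everywhere on \<open>\<Omega>\<close> matter.\<close>

definition besov_space ::
    "real \<Rightarrow> nat \<Rightarrow> real \<Rightarrow> ennreal \<Rightarrow> ennreal \<Rightarrow> (real^'n) set \<Rightarrow>
     (real^'n \<Rightarrow> complex) set" where
  "besov_space d K s p q \<Omega> =
     {f \<in> Lp_space p (lebesgue_on \<Omega>).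
        \<exists>lam a. atomic_rep d K p \<Omega> f lam a \<and> b_qnorm s p q \<Omega> lam < \<infinity>}"

definition besov_qnorm ::
    "real \<Rightarrow> nat \<Rightarrow> real \<Rightarrow> ennreal \<Rightarrow> ennreal \<Rightarrow> (real^'n) set \<Rightarrow>
     (real^'n \<Rightarrow> complex) \<Rightarrow> ennreal" where
  "besov_qnorm d K s p q \<Omega> f =
     Inf {b_qnorm s p q \<Omega> lam | lam a. atomic_rep d K p \<Omega> f lam a}"

section \<open>Equivalent quasi-norms on spaces of functions modulo null sets\<close>

definition quasi_norm_on ::
    "'a measure \<Rightarrow> ('a \<Rightarrow> complex) set \<Rightarrow> (('a \<Rightarrow> complex) \<Rightarrow> ennreal) \<Rightarrow> bool" where
  "quasi_norm_on M V N \<longleftrightarrow>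
     (\<forall>f\<in>V. N f < \<infinity>) \<and>
     (\<forall>f\<in>V. \<forall>g\<in>V. (AE x in M. f x = g x) \<longrightarrow> N f = N g) \<and>
     (\<forall>f\<in>V. N f = 0 \<longleftrightarrow> (AE x in M. f x = 0)) \<and>
     (\<forall>f\<in>V. \<forall>c. N (\<lambda>x. c * f x) = ennreal (cmod c) * N f) \<and>
     (\<exists>C::real. \<forall>f\<in>V. \<forall>g\<in>V. N (\<lambda>x. f x + g x) \<le> ennreal C * (N f + N g))"

definition equivalent_quasi_norm_on ::
    "'a measure \<Rightarrow> ('a \<Rightarrow> complex) set \<Rightarrow> (('a \<Rightarrow> complex) \<Rightarrow> ennreal) \<Rightarrow>
     (('a \<Rightarrow> complex) \<Rightarrow> ennreal) \<Rightarrow> bool" where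
  "equivalent_quasi_norm_on M V N N' \<longleftrightarrow>
     quasi_norm_on M V N' \<and>
     (\<exists>c C :: real. 0 < c \<and> 0 < C \<and>
        (\<forall>f\<in>V. ennreal c * N f \<le> N' f \<and> N' f \<le> ennreal C * N f))"

section \<open>Lipschitz domains\<close>

definition is_domain :: "'a::topological_space set \<Rightarrow> bool" where
  "is_domain \<Omega> \<longleftrightarrow> open \<Omega> \<and> connected \<Omega> \<and> \<Omega> \<noteq> {}"

text \<open>
  The index type of \<^typ>\<open>real^'n\<close> carries no order, so an arbitrary coordinate \<open>l\<close> plays the role
  of the last coordinate.
\<close>

definition half_space :: "'n \<Rightarrow> (real^'n) set" where
  "half_space l = {x. x $ l > 0}"

definition boundary_plane :: "'n \<Rightarrow> (real^'n) set" where
  "boundary_plane l = {x. x $ l = 0}"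

definition lipschitz_diffeo :: "(real^'n \<Rightarrow> real^'n) \<Rightarrow> bool" where
  "lipschitz_diffeo \<Phi> \<longleftrightarrow>
     bij \<Phi> \<and>
     (\<forall>i. \<exists>L. L-lipschitz_on UNIV (\<lambda>x. \<Phi> x $ i)) \<and>
     (\<exists>c C. 0 < c \<and> 0 < C \<and>
        (\<forall>x y. norm (x - y) \<le> 1 \<longrightarrow>
           c * norm (x - y) \<le> norm (\<Phi> x - \<Phi> y) \<and>
           norm (\<Phi> x - \<Phi> y) \<le> C * norm (x - y)))"

definition lipschitz_charts ::
    "'n \<Rightarrow> (real^'n) set \<Rightarrow> nat \<Rightarrow> (nat \<Rightarrow> (real^'n) set) \<Rightarrow>
     (nat \<Rightarrow> real^'n \<Rightarrow> real^'n) \<Rightarrow> bool" where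
  "lipschitz_charts l \<Omega> N B \<psi> \<longleftrightarrow>
     frontier \<Omega> \<subseteq> (\<Union>j\<in>{1..N}. B j) \<and>
     (\<forall>j\<in>{1..N}.
        (\<exists>c r. r > 0 \<and> B j = ball c r) \<and>
        B j \<inter> frontier \<Omega> \<noteq> {} \<and>
        lipschitz_diffeo (\<psi> j) \<and>
        \<psi> j ` (B j \<inter> \<Omega>) \<subseteq> half_space l \<and>
        \<psi> j ` (B j \<inter> frontier \<Omega>) \<subseteq> boundary_plane l)"

definition lipschitz_domain :: "'n \<Rightarrow> (real^'n) set \<Rightarrow> bool" where
  "lipschitz_domain l \<Omega> \<longleftrightarrow>
     is_domain \<Omega> \<and> bounded \<Omega> \<and> (\<exists>N B \<psi>. lipschitz_charts l \<Omega> N B \<psi>)"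

text \<open>\<open>B 0\<close> is the inner domain, \<open>B 1, \<dots>, B N\<close> are the balls of the charts.\<close>

definition resolution_of_unity ::
    "(real^'n) set \<Rightarrow> nat \<Rightarrow> (nat \<Rightarrow> (real^'n) set) \<Rightarrow> (nat \<Rightarrow> real^'n \<Rightarrow> real) \<Rightarrow> bool" where
  "resolution_of_unity \<Omega> N B \<phi> \<longleftrightarrow>
     is_domain (B 0) \<and> closure (B 0) \<subseteq> \<Omega> \<and>
     \<Omega> \<subseteq> B 0 \<union> (\<Union>j\<in>{1..N}. B j) \<and>
     (\<forall>j\<le>N. smooth (\<phi> j) \<and> (\<forall>x. 0 \<le> \<phi> j x) \<and> supp (\<phi> j) \<subseteq> B j) \<and>
     (\<forall>x\<in>closure \<Omega>. (\<Sum>j\<le>N. \<phi> j x) = 1)"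

definition inner_part ::
    "(real^'n) set \<Rightarrow> (real^'n \<Rightarrow> real) \<Rightarrow> (real^'n \<Rightarrow> complex) \<Rightarrow> real^'n \<Rightarrow> complex" where
  "inner_part \<Omega> \<phi> f x = (if x \<in> \<Omega> then of_real (\<phi> x) * f x else 0)"

definition boundary_part ::
    "(real^'n) set \<Rightarrow> (real^'n) set \<Rightarrow> (real^'n \<Rightarrow> real^'n) \<Rightarrow> (real^'n \<Rightarrow> real) \<Rightarrow>
     (real^'n \<Rightarrow> complex) \<Rightarrow> real^'n \<Rightarrow> complex" where
  "boundary_part \<Omega> U \<psi> \<phi> f y =
     (if y \<in> \<psi> ` (U \<inter> \<Omega>) then of_real (\<phi> (inv \<psi> y)) * f (inv \<psi> y) else 0)"

end

theory Submission
  imports Defs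
begin

text \<open>
  Since \<open>0 < s < 1\<close>, smooth atoms can be replaced by pieces that are only Lipschitz at scale
  \<open>2\<^bsup>-j\<^esup>\<close>. Such pieces survive the three operations by which \<open>f\<close> and its localized parts are
  obtained from each other, namely multiplication with a Lipschitz function, bi-Lipschitz changes
  of variables and extension by zero, whereas smooth atoms do not survive composition with a
  Lipschitz map. So the proof compares the Besov quasi-norm with an intermediate quasi-norm
  \<open>lip_qnorm\<close>, defined by representations \<open>f = \<Sum> u\<^sub>j\<close> almost everywhere in which
  \<open>u\<^sub>j\<close> and its Lipschitz constant are controlled by coefficients attached to the cubes
  \<open>Q\<^bsub>j,m\<^esub>\<close>.

  That atomic representations are of this kind (\<open>lip_qnorm_le_besov_qnorm\<close>) follows from the mean value
  theorem and from the fact that convergence in \<open>L\<^sub>p\<close> can be exchanged for convergence almost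
  everywhere: as \<open>s > 0\<close>, the levels decay geometrically in \<open>L\<^sub>p\<close> (\<open>cover_sum_tail\<close>).

  The converse (\<open>lip_rep_imp_atomic_rep\<close>) is the core. The partial sums are approximated by
  quasi-interpolants built from a smooth partition of unity at scale \<open>2\<^bsup>-k\<^esup>\<close>, with sample points
  in \<open>\<Omega>\<close>, and the telescoping differences are sums of smooth atoms. A Lipschitz piece of level
  \<open>j\<close> contributes to level \<open>k \<ge> j\<close> with the factor \<open>2\<^bsup>-(k-j)\<^esup>\<close>, which beats the growth
  \<open>2\<^bsup>(k-j)s\<^esup>\<close> of the weights because \<open>s < 1\<close> (\<open>b_qnorm_multiscale\<close>). All estimates take place at points of
  \<open>\<Omega>\<close>, so that \<open>\<Omega>\<close>, the half-space and the whole space are treated alike.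

  The range \<open>0 < p, q \<le> \<infinity>\<close> is covered uniformly by two tools that replace Minkowski's inequality:
  a triangle inequality for geometrically weighted series (\<open>Lp_qnorm_geometric\<close>) and
  a Schur test for incidence relations between cubes and points (\<open>Lp_qnorm_Schur\<close>).

  It remains to see that the localizations are operations of the kind above
  (\<open>lip_qnorm_transform\<close>). The point that needs care is that the function \<open>\<phi>\<^sub>j \<circ> (\<psi>\<^sup>j)\<^sup>-\<^sup>1\<close>, extended by zero
  from the image of \<open>B\<^sub>j \<inter> \<Omega>\<close> to the half-space, is Lipschitz there (\<open>chart_separation\<close>).
\<close>


section \<open>Powers of extended nonnegative reals\<close>

lemma enn_powr_0 [simp]: "enn_powr 0 r = 0"
  by (simp add: enn_powr_def)

lemma enn_powr_top [simp]: "enn_powr top r = top"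
  by (simp add: enn_powr_def)

lemma enn_powr_ennreal: "0 \<le> x \<Longrightarrow> enn_powr (ennreal x) r = ennreal (x powr r)"
  by (simp add: enn_powr_def)

lemma enn_powr_1_right [simp]: "enn_powr x 1 = x"
  by (cases x) (auto simp: enn_powr_ennreal)

lemma enn_powr_mono:
  assumes "x \<le> y" "0 \<le> r"
  shows "enn_powr x r \<le> enn_powr y r"
proof (cases y)
  case (real b)
  then obtain a where "x = ennreal a" "0 \<le> a"
    using assms by (cases x) (auto simp: top_unique)
  with real assms show ?thesis
    by (auto simp: enn_powr_ennreal ennreal_le_iff intro!: ennreal_leI powr_mono2)
qed (auto)

lemma enn_powr_mult:
  assumes "0 < r"
  shows "enn_powr (x * y) r = enn_powr x r * enn_powr y r"
proof (cases x; cases y)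
  fix a b assume "0 \<le> a" "x = ennreal a" "0 \<le> b" "y = ennreal b"
  then show ?thesis
    by (simp add: enn_powr_ennreal powr_mult flip: ennreal_mult)
next
  fix a assume "0 \<le> a" "x = ennreal a" "y = top"
  then show ?thesis
    using assms by (cases "a = 0") (auto simp: enn_powr_ennreal ennreal_mult_top)
next
  fix a assume "x = top" "0 \<le> a" "y = ennreal a"
  then show ?thesis
    using assms by (cases "a = 0") (auto simp: enn_powr_ennreal ennreal_top_mult)
qed auto

lemma enn_powr_powr: "enn_powr (enn_powr x r) r' = enn_powr x (r * r')"
  by (cases x) (auto simp: enn_powr_ennreal powr_powr)

lemma enn_powr_inverse: "0 < r \<Longrightarrow> enn_powr (enn_powr x r) (1 / r) = x"
  "0 < r \<Longrightarrow> enn_powr (enn_powr x (1 / r)) r = x"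
  by (simp_all add: enn_powr_powr)

lemma enn_powr_eq_0_iff [simp]: "enn_powr x r = 0 \<longleftrightarrow> x = 0"
  by (cases x) (auto simp: enn_powr_ennreal)

lemma enn_powr_less_top_iff [simp]: "enn_powr x r < top \<longleftrightarrow> x < top"
  by (cases x) (auto simp: enn_powr_ennreal)

lemma enn_powr_measurable [measurable]: "(\<lambda>x. enn_powr x r) \<in> borel_measurable borel"
  unfolding enn_powr_def by measurable

text \<open>
  Each term of a series is at most the \<open>P\<close>-th root of the series of \<open>P\<close>-th powers. Hence
  a geometrically weighted series is controlled by that root, for every \<open>P > 0\<close>; this is what
  replaces Minkowski's inequality, which fails for \<open>P < 1\<close>.
\<close>

lemma enn_powr_weighted_suminf_le:
  fixes y :: "nat \<Rightarrow> ennreal"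
  assumes "0 < P" "0 \<le> t" "t < 1"
  shows "enn_powr (\<Sum>j. ennreal (t ^ j) * y j) P
           \<le> enn_powr (ennreal (1 / (1 - t))) P * (\<Sum>j. enn_powr (y j) P)"
proof -
  define S where "S = (\<Sum>j. enn_powr (y j) P)"
  have "y j \<le> enn_powr S (1 / P)" for j
  proof -
    have "enn_powr (y j) P \<le> S"
      unfolding S_def using sum_le_suminf[of "\<lambda>j. enn_powr (y j) P" "{j}"] by simp
    then have "enn_powr (enn_powr (y j) P) (1 / P) \<le> enn_powr S (1 / P)"
      using assms by (intro enn_powr_mono) auto
    then show ?thesis
      using assms by (simp add: enn_powr_inverse)
  qed
  then have "(\<Sum>j. ennreal (t ^ j) * y j) \<le> (\<Sum>j. ennreal (t ^ j) * enn_powr S (1 / P))"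
    by (intro suminf_le mult_left_mono) auto
  also have "\<dots> = (\<Sum>j. ennreal (t ^ j)) * enn_powr S (1 / P)"
    by (rule ennreal_suminf_multc)
  also have "(\<Sum>j. ennreal (t ^ j)) = ennreal (1 / (1 - t))"
    using assms geometric_sums[of t] by (intro suminf_ennreal_eq) auto
  finally have "enn_powr (\<Sum>j. ennreal (t ^ j) * y j) P
      \<le> enn_powr (ennreal (1 / (1 - t)) * enn_powr S (1 / P)) P"
    using assms by (intro enn_powr_mono) auto
  also have "\<dots> = enn_powr (ennreal (1 / (1 - t))) P * S"
    using assms by (simp add: enn_powr_mult enn_powr_inverse)
  finally show ?thesis
    by (simp add: S_def)
qed

lemma enn_powr_sum_le:
  fixes y :: "'i \<Rightarrow> ennreal"
  assumes "0 < P" "finite A" "card A \<le> k"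
  shows "enn_powr (\<Sum>i\<in>A. y i) P \<le> enn_powr (of_nat k) P * (\<Sum>i\<in>A. enn_powr (y i) P)"
proof -
  define S where "S = (\<Sum>i\<in>A. enn_powr (y i) P)"
  have "y i \<le> enn_powr S (1 / P)" if "i \<in> A" for i
  proof -
    have "enn_powr (y i) P \<le> S"
      unfolding S_def using that assms by (intro member_le_sum) auto
    then have "enn_powr (enn_powr (y i) P) (1 / P) \<le> enn_powr S (1 / P)"
      using assms by (intro enn_powr_mono) auto
    then show ?thesis
      using assms by (simp add: enn_powr_inverse)
  qed
  then have "(\<Sum>i\<in>A. y i) \<le> of_nat (card A) * enn_powr S (1 / P)"
    by (rule sum_bounded_above)
  also have "\<dots> \<le> of_nat k * enn_powr S (1 / P)"
    using assms by (intro mult_right_mono) auto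
  finally have "enn_powr (\<Sum>i\<in>A. y i) P \<le> enn_powr (of_nat k * enn_powr S (1 / P)) P"
    using assms by (intro enn_powr_mono) auto
  also have "\<dots> = enn_powr (of_nat k) P * S"
    using assms by (simp add: enn_powr_mult enn_powr_inverse)
  finally show ?thesis
    by (simp add: S_def)
qed

section \<open>Lebesgue quasi-norms\<close>

lemma exponent_cases:
  fixes p :: ennreal
  assumes "0 < p"
  obtains "p = \<infinity>" | "p \<noteq> \<infinity>" "0 < enn2real p"
  using assms by (cases p) (auto simp: ennreal_less_zero_iff)

lemma Lp_qnorm_mono_AE:
  assumes "0 < p" "AE x in M. g x \<le> h x" "g \<in> borel_measurable M"
  shows "Lp_qnorm p M g \<le> Lp_qnorm p M h"
  using assms(1)
proof (cases rule: exponent_cases)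
  case 1
  then show ?thesis
    using assms esssup_AE_mono by (auto simp: Lp_qnorm_def)
next
  case 2
  have "(\<integral>\<^sup>+ x. enn_powr (g x) (enn2real p) \<partial>M) \<le> (\<integral>\<^sup>+ x. enn_powr (h x) (enn2real p) \<partial>M)"
    using assms(2) 2 by (intro nn_integral_mono_AE) (auto elim!: eventually_mono intro!: enn_powr_mono)
  then show ?thesis
    using 2 by (auto simp: Lp_qnorm_def intro!: enn_powr_mono)
qed

lemma Lp_qnorm_count_space_mono:
  assumes "0 < p" "\<And>x. x \<in> I \<Longrightarrow> g x \<le> h x"
  shows "Lp_qnorm p (count_space I) g \<le> Lp_qnorm p (count_space I) h"
  using assms by (intro Lp_qnorm_mono_AE) (auto simp: AE_count_space)

lemma Lp_qnorm_cmult: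
  assumes "0 < p" and [measurable]: "g \<in> borel_measurable M"
  shows "Lp_qnorm p M (\<lambda>x. c * g x) \<le> c * Lp_qnorm p M g"
  using assms(1)
proof (cases rule: exponent_cases)
  case 1
  have "AE x in M. c * g x \<le> c * esssup M g"
    using esssup_AE[of g M] by eventually_elim (auto intro: mult_left_mono)
  with 1 show ?thesis
    by (auto simp: Lp_qnorm_def intro!: esssup_I)
next
  case 2
  then show ?thesis
    by (simp add: Lp_qnorm_def enn_powr_mult nn_integral_cmult enn_powr_inverse)
qed

lemma Lp_qnorm_point_le:
  assumes "0 < p" "i \<in> I"
  shows "g i \<le> Lp_qnorm p (count_space I) g"
  using assms(1)
proof (cases rule: exponent_cases)
  case 1
  then show ?thesis
    using esssup_AE[of g "count_space I"] assms(2) by (auto simp: Lp_qnorm_def AE_count_space)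
next
  case 2
  define P where "P = enn2real p"
  have "enn_powr (g i) P = (\<integral>\<^sup>+ x. enn_powr (g x) P * indicator {i} x \<partial>count_space I)"
    using assms(2) by (subst nn_integral_indicator_singleton) auto
  also have "\<dots> \<le> (\<integral>\<^sup>+ x. enn_powr (g x) P \<partial>count_space I)"
    by (intro nn_integral_mono) (auto simp: indicator_def)
  finally have "enn_powr (enn_powr (g i) P) (1 / P) \<le> Lp_qnorm p (count_space I) g"
    using 2 by (auto simp: Lp_qnorm_def P_def intro!: enn_powr_mono)
  then show ?thesis
    using 2 by (simp add: P_def enn_powr_inverse)
qed

lemma Lp_qnorm_finite_AE:
  assumes "0 < p" "g \<in> borel_measurable M" "Lp_qnorm p M g < \<infinity>"
  shows "AE x in M. g x < \<infinity>"
  using assms(1)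
proof (cases rule: exponent_cases)
  case 1
  with assms esssup_AE[of g M] show ?thesis
    by (auto simp: Lp_qnorm_def elim!: eventually_mono)
next
  case 2
  have [measurable]: "g \<in> borel_measurable M" by fact
  have "(\<integral>\<^sup>+ x. enn_powr (g x) (enn2real p) \<partial>M) \<noteq> \<infinity>"
    using assms 2 by (auto simp: Lp_qnorm_def)
  then have "AE x in M. enn_powr (g x) (enn2real p) \<noteq> \<infinity>"
    by (intro nn_integral_noteq_infinite) auto
  then show ?thesis
    by eventually_elim (auto simp: less_top[symmetric])
qed

lemma Lp_qnorm_eq_0_AE:
  assumes "0 < p" "g \<in> borel_measurable M" "Lp_qnorm p M g = 0"
  shows "AE x in M. g x = 0"
  using assms(1)
proof (cases rule: exponent_cases)
  case 1
  with assms esssup_AE[of g M] show ?thesis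
    by (auto simp: Lp_qnorm_def elim!: eventually_mono)
next
  case 2
  have [measurable]: "g \<in> borel_measurable M" by fact
  have "(\<integral>\<^sup>+ x. enn_powr (g x) (enn2real p) \<partial>M) = 0"
    using assms 2 by (auto simp: Lp_qnorm_def)
  then have "AE x in M. enn_powr (g x) (enn2real p) = 0"
    by (subst (asm) nn_integral_0_iff_AE) auto
  then show ?thesis
    by simp
qed

lemma Lp_qnorm_zero:
  assumes "0 < p"
  shows "Lp_qnorm p M (\<lambda>x. 0) = 0"
proof -
  have "esssup M (\<lambda>x. 0::ennreal) \<le> 0"
    by (intro esssup_I) auto
  then show ?thesis
    by (simp add: Lp_qnorm_def)
qed

text \<open>
  The weight \<open>r\<^sup>j\<close> is split into two equal factors. One of them is spent on
  \<open>enn_powr_weighted_suminf_le\<close>, the other makes the series of the \<open>p\<close>-th powers of the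
  quasi-norms converge.
\<close>

lemma Lp_qnorm_geometric:
  assumes "0 < p" "0 \<le> r" "r < 1"
  obtains C :: real where "0 < C"
    "\<And>(M :: 'a measure) g D. (\<And>j::nat. g j \<in> borel_measurable M) \<Longrightarrow> (\<And>j. Lp_qnorm p M (g j) \<le> D) \<Longrightarrow>
       Lp_qnorm p M (\<lambda>x. \<Sum>j. ennreal (r ^ j) * g j x) \<le> ennreal C * D"
  using assms(1)
proof (cases rule: exponent_cases)
  case 1
  have "Lp_qnorm p M (\<lambda>x. \<Sum>j. ennreal (r ^ j) * g j x) \<le> ennreal (1 / (1 - r)) * D"
    if [measurable]: "\<And>j::nat. g j \<in> borel_measurable M" and D: "\<And>j. Lp_qnorm p M (g j) \<le> D"
    for M :: "'a measure" and g D
  proof -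
    have "AE x in M. g j x \<le> D" for j
      using esssup_AE[of "g j" M] D[of j] 1 by (auto simp: Lp_qnorm_def elim!: eventually_mono)
    then have "AE x in M. \<forall>j. g j x \<le> D"
      by (simp add: AE_all_countable)
    then have "AE x in M. (\<Sum>j. ennreal (r ^ j) * g j x) \<le> ennreal (1 / (1 - r)) * D"
    proof eventually_elim
      case (elim x)
      have "(\<Sum>j. ennreal (r ^ j) * g j x) \<le> (\<Sum>j. ennreal (r ^ j) * D)"
        using elim by (intro suminf_le mult_left_mono) auto
      also have "\<dots> = (\<Sum>j. ennreal (r ^ j)) * D"
        by (rule ennreal_suminf_multc)
      also have "(\<Sum>j. ennreal (r ^ j)) = ennreal (1 / (1 - r))"
        using assms geometric_sums[of r] by (intro suminf_ennreal_eq) auto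
      finally show ?case .
    qed
    then show ?thesis
      using 1 by (auto simp: Lp_qnorm_def intro!: esssup_I)
  qed
  then show ?thesis
    using assms by (intro that[of "1 / (1 - r)"]) auto
next
  case 2
  define P where "P = enn2real p"
  define t where "t = sqrt r"
  have P: "0 < P" using 2 by (simp add: P_def)
  have t: "0 \<le> t" "t < 1" "r = t * t"
    using assms by (auto simp: t_def)
  have tP: "0 \<le> t powr P" "t powr P < 1"
  proof -
    show "t powr P < 1"
      using t P powr_less_mono2[of P t 1] by simp
  qed auto
  define C where "C = 1 / (1 - t) * (1 / (1 - t powr P)) powr (1 / P)"
  have C: "0 < C"
    using t tP by (simp add: C_def)
  have "Lp_qnorm p M (\<lambda>x. \<Sum>j. ennreal (r ^ j) * g j x) \<le> ennreal C * D"
    if [measurable]: "\<And>j::nat. g j \<in> borel_measurable M" and D: "\<And>j. Lp_qnorm p M (g j) \<le> D"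
    for M :: "'a measure" and g D
  proof -
    have gD: "(\<integral>\<^sup>+ x. enn_powr (g j x) P \<partial>M) \<le> enn_powr D P" for j
    proof -
      have "enn_powr (enn_powr (\<integral>\<^sup>+ x. enn_powr (g j x) P \<partial>M) (1 / P)) P \<le> enn_powr D P"
        using D[of j] 2 by (intro enn_powr_mono) (auto simp: Lp_qnorm_def P_def)
      then show ?thesis
        using P by (simp add: enn_powr_inverse)
    qed
    have pt: "enn_powr (\<Sum>j. ennreal (r ^ j) * g j x) P
        \<le> enn_powr (ennreal (1 / (1 - t))) P * (\<Sum>j. ennreal ((t powr P) ^ j) * enn_powr (g j x) P)" for x
    proof -
      have "ennreal (r ^ j) * g j x = ennreal (t ^ j) * (ennreal (t ^ j) * g j x)" for j
        using t by (simp add: power_mult_distrib ennreal_mult mult.assoc)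
      moreover have "enn_powr (ennreal (t ^ j) * g j x) P = ennreal ((t powr P) ^ j) * enn_powr (g j x) P" for j
      proof -
        have "(t ^ j) powr P = (t powr P) ^ j"
          using t by (induction j) (auto simp: powr_mult)
        then show ?thesis
          using P t by (simp add: enn_powr_mult enn_powr_ennreal)
      qed
      ultimately show ?thesis
        using enn_powr_weighted_suminf_le[OF P t(1,2), of "\<lambda>j. ennreal (t ^ j) * g j x"] by simp
    qed
    have "(\<integral>\<^sup>+ x. enn_powr (\<Sum>j. ennreal (r ^ j) * g j x) P \<partial>M)
        \<le> (\<integral>\<^sup>+ x. enn_powr (ennreal (1 / (1 - t))) P * (\<Sum>j. ennreal ((t powr P) ^ j) * enn_powr (g j x) P) \<partial>M)"
      by (intro nn_integral_mono pt)
    also have "\<dots> = enn_powr (ennreal (1 / (1 - t))) P *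
        (\<Sum>j. ennreal ((t powr P) ^ j) * (\<integral>\<^sup>+ x. enn_powr (g j x) P \<partial>M))"
      by (simp add: nn_integral_cmult nn_integral_suminf)
    also have "\<dots> \<le> enn_powr (ennreal (1 / (1 - t))) P * (\<Sum>j. ennreal ((t powr P) ^ j) * enn_powr D P)"
      by (intro mult_left_mono suminf_le gD) auto
    also have "(\<Sum>j. ennreal ((t powr P) ^ j) * enn_powr D P) = ennreal (1 / (1 - t powr P)) * enn_powr D P"
    proof -
      have "(\<Sum>j. ennreal ((t powr P) ^ j)) = ennreal (1 / (1 - t powr P))"
        using tP geometric_sums[of "t powr P"] by (intro suminf_ennreal_eq) auto
      then show ?thesis
        by simp
    qed
    finally have "Lp_qnorm p M (\<lambda>x. \<Sum>j. ennreal (r ^ j) * g j x)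
        \<le> enn_powr (enn_powr (ennreal (1 / (1 - t))) P * (ennreal (1 / (1 - t powr P)) * enn_powr D P)) (1 / P)"
      using 2 P by (auto simp: Lp_qnorm_def P_def intro!: enn_powr_mono)
    also have "\<dots> = ennreal C * D"
    proof -
      have "enn_powr (ennreal (1 / (1 - t powr P))) (1 / P) = ennreal ((1 / (1 - t powr P)) powr (1 / P))"
        using tP by (intro enn_powr_ennreal) auto
      moreover have "ennreal C = ennreal (1 / (1 - t)) * ennreal ((1 / (1 - t powr P)) powr (1 / P))"
        unfolding C_def using t by (intro ennreal_mult) auto
      ultimately show ?thesis
        using P by (simp add: enn_powr_mult enn_powr_inverse mult.assoc)
    qed
    finally show ?thesis .
  qed
  then show ?thesis
    using C that by blast
qed

text \<open>
  The sum of two functions is a geometrically weighted series with two non-zero terms.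
\<close>

lemma Lp_qnorm_add:
  assumes "0 < p"
  obtains C :: real where "0 < C"
    "\<And>(M :: 'a measure) g h. g \<in> borel_measurable M \<Longrightarrow> h \<in> borel_measurable M \<Longrightarrow>
       Lp_qnorm p M (\<lambda>x. g x + h x) \<le> ennreal C * (Lp_qnorm p M g + Lp_qnorm p M h)"
proof -
  obtain C :: real where C: "0 < C"
    "\<And>(M :: 'a measure) g D. (\<And>j::nat. g j \<in> borel_measurable M) \<Longrightarrow> (\<And>j. Lp_qnorm p M (g j) \<le> D) \<Longrightarrow>
       Lp_qnorm p M (\<lambda>x. \<Sum>j. ennreal ((1 / 2) ^ j) * g j x) \<le> ennreal C * D"
    using Lp_qnorm_geometric[OF assms, of "1 / 2"] by auto
  show ?thesis
  proof (rule that[of "C * 2"])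
    show "0 < C * 2" using C by simp
    fix M :: "'a measure" and g h :: "'a \<Rightarrow> ennreal"
    assume [measurable]: "g \<in> borel_measurable M" "h \<in> borel_measurable M"
    define G where "G j x = (if j = 0 then g x else if j = (1::nat) then 2 * h x else 0)" for j x
    have Gm: "G j \<in> borel_measurable M" for j
      unfolding G_def by measurable
    define D where "D = 2 * (Lp_qnorm p M g + Lp_qnorm p M h)"
    have D: "Lp_qnorm p M (G j) \<le> D" for j
    proof -
      consider "j = 0" | "j = 1" | "j > 1" by linarith
      then show ?thesis
      proof cases
        case 1
        have "Lp_qnorm p M g \<le> Lp_qnorm p M g + (Lp_qnorm p M g + 2 * Lp_qnorm p M h)"
          by (rule order_trans[OF _ add_increasing2]) auto
        then show ?thesis
          using 1 by (simp add: G_def[abs_def] D_def distrib_left mult_2 add.assoc)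
      next
        case 2
        then have "Lp_qnorm p M (G j) \<le> 2 * Lp_qnorm p M h"
          using Lp_qnorm_cmult[OF assms, of h M 2] by (simp add: G_def[abs_def])
        also have "\<dots> \<le> D"
          by (auto simp: D_def intro!: mult_left_mono)
        finally show ?thesis .
      next
        case 3
        then show ?thesis
          by (simp add: G_def[abs_def] Lp_qnorm_zero[OF assms])
      qed
    qed
    have "(\<Sum>j. ennreal ((1 / 2) ^ j) * G j x) = g x + h x" for x
    proof -
      have "(\<Sum>j. ennreal ((1 / 2) ^ j) * G j x) = (\<Sum>j\<in>{0, 1}. ennreal ((1 / 2) ^ j) * G j x)"
        by (intro suminf_finite) (auto simp: G_def)
      also have "\<dots> = g x + ennreal (1 / 2) * (2 * h x)"
        by (simp add: G_def)
      also have "ennreal (1 / 2) * (2 * h x) = h x"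
      proof -
        have "ennreal (1 / 2) * ennreal 2 = ennreal (1 / 2 * 2)"
          by (rule ennreal_mult[symmetric]) auto
        then have "ennreal (1 / 2) * 2 = 1"
          unfolding ennreal_numeral by simp
        then show ?thesis
          by (metis mult.assoc mult_1)
      qed
      finally show ?thesis .
    qed
    then show "Lp_qnorm p M (\<lambda>x. g x + h x) \<le> ennreal (C * 2) * (Lp_qnorm p M g + Lp_qnorm p M h)"
      using C(2)[of G M D] Gm D C(1) by (simp add: D_def ennreal_mult mult.assoc)
  qed
qed

text \<open>
  A Schur test with kernel \<open>0\<close> or \<open>1\<close>. It carries out every change of index between
  cubes below: \<open>R x\<close> collects the boundedly many cubes whose coefficients are felt at \<open>x\<close>.
\<close>

lemma Lp_qnorm_Schur:
  fixes lam :: "'i \<Rightarrow> ennreal" and R :: "'a \<Rightarrow> 'i set"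
  assumes "0 < p" "countable I"
    and R: "\<And>x. x \<in> space M \<Longrightarrow> finite (R x) \<and> R x \<subseteq> I \<and> card (R x) \<le> k"
    and meas: "\<And>m. m \<in> I \<Longrightarrow> {x \<in> space M. m \<in> R x} \<in> sets M"
    and B: "\<And>m. m \<in> I \<Longrightarrow> emeasure M {x \<in> space M. m \<in> R x} \<le> ennreal b" and "0 < b"
  shows "(\<lambda>x. \<Sum>m\<in>R x. lam m) \<in> borel_measurable M"
    and "Lp_qnorm p M (\<lambda>x. \<Sum>m\<in>R x. lam m)
           \<le> ennreal (real k * b powr (1 / enn2real p)) * Lp_qnorm p (count_space I) lam"
proof -
  have ind: "(indicator {x \<in> space M. m \<in> R x} :: 'a \<Rightarrow> ennreal) \<in> borel_measurable M" if "m \<in> I" for m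
    using meas[OF that] by (rule borel_measurable_indicator)
  have sum_eq: "(\<Sum>m\<in>R x. w m) = (\<integral>\<^sup>+ m. w m * indicator {x \<in> space M. m \<in> R x} x \<partial>count_space I)"
    if "x \<in> space M" for x and w :: "'i \<Rightarrow> ennreal"
  proof -
    have "(\<integral>\<^sup>+ m. w m * indicator {x \<in> space M. m \<in> R x} x \<partial>count_space I)
        = (\<Sum>m\<in>R x. w m * indicator {x \<in> space M. m \<in> R x} x)"
      using R[OF that] by (intro nn_integral_count_space') auto
    also have "\<dots> = (\<Sum>m\<in>R x. w m)"
      using that by (intro sum.cong) auto
    finally show ?thesis by simp
  qed
  have meas_sum: "(\<lambda>x. \<Sum>m\<in>R x. w m) \<in> borel_measurable M" for w :: "'i \<Rightarrow> ennreal"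
  proof -
    have "(\<lambda>x. \<integral>\<^sup>+ m. w m * indicator {x \<in> space M. m \<in> R x} x \<partial>count_space I) \<in> borel_measurable M"
    proof (rule sigma_finite_measure.borel_measurable_nn_integral[OF
          sigma_finite_measure_count_space_countable[OF assms(2)]])
      have "(\<lambda>(m, x). w m * indicator {x \<in> space M. m \<in> R x} x) \<in> borel_measurable (count_space I \<Otimes>\<^sub>M M)"
        using ind by (intro measurable_pair_measure_countable1[OF assms(2)]) auto
      then show "(\<lambda>(x, m). w m * indicator {x \<in> space M. m \<in> R x} x) \<in> borel_measurable (M \<Otimes>\<^sub>M count_space I)"
        by (subst measurable_pair_swap_iff) (simp add: case_prod_unfold)
    qed
    then show ?thesis
      by (rule measurable_cong[THEN iffD1, rotated]) (simp add: sum_eq)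
  qed
  then show "(\<lambda>x. \<Sum>m\<in>R x. lam m) \<in> borel_measurable M" .
  show "Lp_qnorm p M (\<lambda>x. \<Sum>m\<in>R x. lam m)
           \<le> ennreal (real k * b powr (1 / enn2real p)) * Lp_qnorm p (count_space I) lam"
    using assms(1)
  proof (cases rule: exponent_cases)
    case 1
    define S where "S = esssup (count_space I) lam"
    have "lam m \<le> S" if "m \<in> I" for m
      using esssup_AE[of lam "count_space I"] that by (auto simp: S_def AE_count_space)
    then have "(\<Sum>m\<in>R x. lam m) \<le> of_nat k * S" if "x \<in> space M" for x
      using R[OF that] sum_bounded_above[of "R x" lam S]
      by (intro order_trans[OF sum_bounded_above[of "R x" lam S]] mult_right_mono) auto
    then have "esssup M (\<lambda>x. \<Sum>m\<in>R x. lam m) \<le> of_nat k * S"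
      by (intro esssup_I meas_sum) auto
    then show ?thesis
      using 1 \<open>0 < b\<close> by (simp add: Lp_qnorm_def S_def ennreal_of_nat_eq_real_of_nat)
  next
    case 2
    define P where "P = enn2real p"
    have P: "0 < P" using 2 by (simp add: P_def)
    have "(\<integral>\<^sup>+ x. enn_powr (\<Sum>m\<in>R x. lam m) P \<partial>M)
        \<le> (\<integral>\<^sup>+ x. enn_powr (of_nat k) P * (\<Sum>m\<in>R x. enn_powr (lam m) P) \<partial>M)"
      using R P by (intro nn_integral_mono enn_powr_sum_le) auto
    also have "\<dots> = enn_powr (of_nat k) P * (\<integral>\<^sup>+ x. (\<Sum>m\<in>R x. enn_powr (lam m) P) \<partial>M)"
      by (intro nn_integral_cmult meas_sum)
    also have "(\<integral>\<^sup>+ x. (\<Sum>m\<in>R x. enn_powr (lam m) P) \<partial>M)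
        = (\<integral>\<^sup>+ x. \<integral>\<^sup>+ m. enn_powr (lam m) P * indicator {x \<in> space M. m \<in> R x} x \<partial>count_space I \<partial>M)"
      by (intro nn_integral_cong sum_eq)
    also have "\<dots> = (\<integral>\<^sup>+ m. \<integral>\<^sup>+ x. enn_powr (lam m) P * indicator {x \<in> space M. m \<in> R x} x \<partial>M \<partial>count_space I)"
      using assms(2) ind by (intro nn_integral_count_space_nn_integral) auto
    also have "\<dots> \<le> (\<integral>\<^sup>+ m. enn_powr (lam m) P * ennreal b \<partial>count_space I)"
      using B meas by (intro nn_integral_mono) (auto simp: nn_integral_cmult_indicator intro!: mult_left_mono)
    also have "\<dots> = (\<integral>\<^sup>+ m. enn_powr (lam m) P \<partial>count_space I) * ennreal b"
      by (intro nn_integral_multc) auto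
    finally have "(\<integral>\<^sup>+ x. enn_powr (\<Sum>m\<in>R x. lam m) P \<partial>M)
        \<le> enn_powr (of_nat k) P * ((\<integral>\<^sup>+ m. enn_powr (lam m) P \<partial>count_space I) * ennreal b)"
      by (simp add: mult_left_mono)
    then have "Lp_qnorm p M (\<lambda>x. \<Sum>m\<in>R x. lam m)
        \<le> enn_powr (enn_powr (of_nat k) P * ((\<integral>\<^sup>+ m. enn_powr (lam m) P \<partial>count_space I) * ennreal b)) (1 / P)"
      using 2 P by (auto simp: Lp_qnorm_def P_def intro!: enn_powr_mono)
    also have "\<dots> = of_nat k * (Lp_qnorm p (count_space I) lam * ennreal (b powr (1 / P)))"
      using P 2 \<open>0 < b\<close> by (simp add: enn_powr_mult enn_powr_inverse enn_powr_ennreal Lp_qnorm_def P_def)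
    also have "\<dots> = ennreal (real k * b powr (1 / P)) * Lp_qnorm p (count_space I) lam"
      by (simp add: ennreal_mult ennreal_of_nat_eq_real_of_nat ac_simps)
    finally show ?thesis
      by (simp add: P_def)
  qed
qed

section \<open>Dyadic cubes\<close>

lemma card_int_interval:
  fixes c r :: real
  assumes "0 \<le> r"
  shows "finite {z::int. \<bar>real_of_int z - c\<bar> \<le> r}"
    and "real (card {z::int. \<bar>real_of_int z - c\<bar> \<le> r}) \<le> 2 * r + 1"
proof -
  have eq: "{z::int. \<bar>real_of_int z - c\<bar> \<le> r} = {\<lceil>c - r\<rceil>..\<lfloor>c + r\<rfloor>}"
    by (auto simp: abs_le_iff le_floor_iff ceiling_le_iff)
  show "finite {z::int. \<bar>real_of_int z - c\<bar> \<le> r}"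
    unfolding eq by simp
  show "real (card {z::int. \<bar>real_of_int z - c\<bar> \<le> r}) \<le> 2 * r + 1"
    unfolding eq using assms by (auto simp: of_nat_nat) linarith
qed

lemma card_int_box:
  fixes c :: "'n::finite \<Rightarrow> real" and r :: real
  assumes "0 \<le> r"
  shows "finite {m::int^'n. \<forall>i. \<bar>real_of_int (m $ i) - c i\<bar> \<le> r}"
    and "real (card {m::int^'n. \<forall>i. \<bar>real_of_int (m $ i) - c i\<bar> \<le> r}) \<le> (2 * r + 1) ^ CARD('n)"
proof -
  define B where "B i = {z::int. \<bar>real_of_int z - c i\<bar> \<le> r}" for i
  have inj: "inj_on (\<lambda>m. \<lambda>i. m $ i) {m::int^'n. \<forall>i. m $ i \<in> B i}"
    by (auto simp: inj_on_def vec_eq_iff fun_eq_iff)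
  have img: "(\<lambda>m. \<lambda>i. m $ i) ` {m::int^'n. \<forall>i. m $ i \<in> B i} \<subseteq> PiE UNIV B"
    by (auto simp: PiE_UNIV_domain)
  have finB: "finite (B i)" for i
    unfolding B_def by (rule card_int_interval[OF assms])
  then have fin: "finite (PiE UNIV B)"
    by (intro finite_PiE) auto
  have eq: "{m::int^'n. \<forall>i. \<bar>real_of_int (m $ i) - c i\<bar> \<le> r} = {m::int^'n. \<forall>i. m $ i \<in> B i}"
    by (simp add: B_def)
  show "finite {m::int^'n. \<forall>i. \<bar>real_of_int (m $ i) - c i\<bar> \<le> r}"
    unfolding eq using inj_on_finite[OF inj img fin] .
  have "card {m::int^'n. \<forall>i. m $ i \<in> B i} \<le> card (PiE UNIV B)"
    by (rule card_inj_on_le[OF inj img fin])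
  also have "\<dots> = (\<Prod>i\<in>UNIV. card (B i))"
    by (simp add: card_PiE)
  finally have "real (card {m::int^'n. \<forall>i. m $ i \<in> B i}) \<le> (\<Prod>i\<in>UNIV. real (card (B i)))"
    unfolding of_nat_prod[symmetric] of_nat_le_iff .
  also have "\<dots> \<le> (\<Prod>i\<in>(UNIV::'n set). 2 * r + 1)"
    unfolding B_def by (intro prod_mono conjI card_int_interval[OF assms]) auto
  also have "\<dots> = (2 * r + 1) ^ CARD('n)"
    by simp
  finally show "real (card {m::int^'n. \<forall>i. \<bar>real_of_int (m $ i) - c i\<bar> \<le> r}) \<le> (2 * r + 1) ^ CARD('n)"
    unfolding eq .
qed

definition cubes_at :: "nat \<Rightarrow> real^'n \<Rightarrow> (int^'n) set" where
  "cubes_at j x = {m. x \<in> dcube 1 j m}"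

definition cover_sum :: "(int^'n \<Rightarrow> real) \<Rightarrow> nat \<Rightarrow> real^'n \<Rightarrow> real" where
  "cover_sum c j x = (\<Sum>m\<in>cubes_at j x. c m)"

lemma dcube_scaled: "x \<in> dcube d j m \<longleftrightarrow> (\<forall>i. \<bar>real_of_int (m $ i) - 2 ^ j * x $ i\<bar> \<le> d)"
proof -
  have "\<bar>x $ i - real_of_int (m $ i) / 2 ^ j\<bar> \<le> d / 2 ^ j \<longleftrightarrow> \<bar>real_of_int (m $ i) - 2 ^ j * x $ i\<bar> \<le> d" for i
  proof -
    have "\<bar>x $ i - real_of_int (m $ i) / 2 ^ j\<bar> = \<bar>real_of_int (m $ i) - 2 ^ j * x $ i\<bar> / 2 ^ j"
    proof -
      have "x $ i - real_of_int (m $ i) / 2 ^ j = - (real_of_int (m $ i) - 2 ^ j * x $ i) / 2 ^ j"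
        by (simp add: field_simps)
      then show ?thesis
        by (simp add: abs_divide)
    qed
    then show ?thesis
      by (simp add: divide_le_cancel)
  qed
  then show ?thesis
    by (simp add: dcube_def)
qed

lemma card_cubes_at:
  fixes x :: "real^'n::finite"
  shows "finite (cubes_at j x)" and "card (cubes_at j x) \<le> 3 ^ CARD('n)"
proof -
  have eq: "cubes_at j x = {m. \<forall>i. \<bar>real_of_int (m $ i) - 2 ^ j * x $ i\<bar> \<le> 1}"
    by (simp add: cubes_at_def dcube_scaled)
  show "finite (cubes_at j x)"
    unfolding eq by (rule card_int_box) simp
  have "real (card (cubes_at j x)) \<le> (2 * 1 + 1) ^ CARD('n)"
    unfolding eq by (rule card_int_box) simp
  then have "real (card (cubes_at j x)) \<le> real (3 ^ CARD('n))"
    by simp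
  then show "card (cubes_at j x) \<le> 3 ^ CARD('n)"
    by (simp only: of_nat_le_iff)
qed

lemma cover_sum_nonneg: "(\<And>m. 0 \<le> c m) \<Longrightarrow> 0 \<le> cover_sum c j x"
  by (simp add: cover_sum_def sum_nonneg)

lemma cubes_at_nonempty:
  fixes x :: "real^'n::finite"
  obtains m where "m \<in> cubes_at j x"
proof
  have "\<bar>real_of_int \<lfloor>y\<rfloor> - y\<bar> \<le> 1" for y
    using floor_correct[of y] by linarith
  then show "(\<chi> i. \<lfloor>2 ^ j * x $ i\<rfloor>) \<in> cubes_at j x"
    by (simp add: cubes_at_def dcube_scaled)
qed

lemma cube_indices_UNIV [simp]: "cube_indices UNIV j = (UNIV :: (int^'n::finite) set)"
proof -
  have "(\<chi> i. real_of_int (m $ i) / 2 ^ j) \<in> dcube 1 j m" for m :: "int^'n"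
    by (simp add: dcube_def)
  then show ?thesis
    by (auto simp: cube_indices_def)
qed

lemma cubes_at_subset: "x \<in> \<Omega> \<Longrightarrow> cubes_at j x \<subseteq> cube_indices \<Omega> j"
  by (auto simp: cubes_at_def cube_indices_def)

lemma dcube_eq_cbox:
  "dcube d j m = cbox (\<chi> i. real_of_int (m $ i) / 2 ^ j - d / 2 ^ j) (\<chi> i. real_of_int (m $ i) / 2 ^ j + d / 2 ^ j)"
proof -
  have "\<bar>y - a\<bar> \<le> b \<longleftrightarrow> a - b \<le> y \<and> y \<le> a + b" for y a b :: real
    by linarith
  then show ?thesis
    by (auto simp: dcube_def mem_box_cart)
qed

lemma emeasure_dcube:
  fixes m :: "int^'n::finite"
  shows "emeasure lebesgue (dcube 1 j m) = ennreal ((2 / 2 ^ j) ^ CARD('n))"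
proof -
  define a b :: "real^'n"
    where "a = (\<chi> i. real_of_int (m $ i) / 2 ^ j - 1 / 2 ^ j)"
      and "b = (\<chi> i. real_of_int (m $ i) / 2 ^ j + 1 / 2 ^ j)"
  have ba: "(b - a) \<bullet> e = 2 / 2 ^ j" if "e \<in> Basis" for e
    using that by (auto simp: a_def b_def Basis_vec_def inner_axis field_simps)
  have "emeasure lborel (cbox a b) = ennreal (\<Prod>e\<in>Basis. (b - a) \<bullet> e)"
  proof (intro emeasure_lborel_cbox)
    fix e :: "real^'n" assume "e \<in> Basis"
    then have "0 \<le> (b - a) \<bullet> e"
      by (simp add: ba)
    then show "a \<bullet> e \<le> b \<bullet> e"
      by (simp add: inner_diff_left)
  qed
  also have "(\<Prod>e\<in>Basis. (b - a) \<bullet> e) = (2 / 2 ^ j) ^ CARD('n)"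
    using ba by simp
  finally show ?thesis
    by (simp add: dcube_eq_cbox a_def b_def)
qed

section \<open>Coefficient quasi-norms\<close>

definition coef_qnorm :: "real \<Rightarrow> ennreal \<Rightarrow> ennreal \<Rightarrow> (nat \<Rightarrow> int^'n \<Rightarrow> real) \<Rightarrow> ennreal" where
  "coef_qnorm s p q lam = b_qnorm s p q UNIV (\<lambda>j m. complex_of_real (lam j m))"

lemma b_qnorm_level_mono:
  fixes mu lam :: "nat \<Rightarrow> int^'n::finite \<Rightarrow> complex"
  assumes "0 < p" "0 < q"
    and "\<And>j. Lp_qnorm p (count_space (cube_indices \<Omega>' j)) (\<lambda>m. ennreal (cmod (mu j m)))
           \<le> c * Lp_qnorm p (count_space (cube_indices \<Omega> j)) (\<lambda>m. ennreal (cmod (lam j m)))"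
  shows "b_qnorm s p q \<Omega>' mu \<le> c * b_qnorm s p q \<Omega> lam"
proof -
  have "b_qnorm s p q \<Omega>' mu \<le> Lp_qnorm q (count_space UNIV)
       (\<lambda>j. c * (ennreal (2 powr (real j * (s - real CARD('n) / enn2real p))) *
            Lp_qnorm p (count_space (cube_indices \<Omega> j)) (\<lambda>m. ennreal (cmod (lam j m)))))"
    unfolding b_qnorm_def
  proof (intro Lp_qnorm_count_space_mono[OF assms(2)])
    fix j
    show "ennreal (2 powr (real j * (s - real CARD('n) / enn2real p))) *
         Lp_qnorm p (count_space (cube_indices \<Omega>' j)) (\<lambda>m. ennreal (cmod (mu j m)))
         \<le> c * (ennreal (2 powr (real j * (s - real CARD('n) / enn2real p))) *
            Lp_qnorm p (count_space (cube_indices \<Omega> j)) (\<lambda>m. ennreal (cmod (lam j m))))"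
      using mult_left_mono[OF assms(3)[of j], of "ennreal (2 powr (real j * (s - real CARD('n) / enn2real p)))"]
      by (simp add: ac_simps)
  qed
  also have "\<dots> \<le> c * b_qnorm s p q \<Omega> lam"
    unfolding b_qnorm_def using assms(2) by (intro Lp_qnorm_cmult) auto
  finally show ?thesis .
qed

text \<open>
  Passages between two families of cubes of equal levels are instances of this lemma: the
  extension of coefficients by zero, the enlargement of supports and the change of variables.
\<close>

lemma b_qnorm_Schur:
  fixes mu lam :: "nat \<Rightarrow> int^'n::finite \<Rightarrow> complex" and R :: "nat \<Rightarrow> int^'n \<Rightarrow> (int^'n) set"
  assumes "0 < p" "0 < q" "0 \<le> c"
    and R: "\<And>j m. m \<in> cube_indices \<Omega>' j \<Longrightarrow> finite (R j m) \<and> R j m \<subseteq> cube_indices \<Omega> j \<and> card (R j m) \<le> k"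
    and T: "\<And>j m. m \<in> cube_indices \<Omega> j \<Longrightarrow>
       finite {m' \<in> cube_indices \<Omega>' j. m \<in> R j m'} \<and> card {m' \<in> cube_indices \<Omega>' j. m \<in> R j m'} \<le> b"
    and "0 < b"
    and mu: "\<And>j m. m \<in> cube_indices \<Omega>' j \<Longrightarrow> cmod (mu j m) \<le> c * (\<Sum>m'\<in>R j m. cmod (lam j m'))"
  shows "b_qnorm s p q \<Omega>' mu \<le> ennreal (c * (real k * real b powr (1 / enn2real p))) * b_qnorm s p q \<Omega> lam"
proof (rule b_qnorm_level_mono[OF assms(1,2)])
  fix j
  let ?I' = "cube_indices \<Omega>' j" and ?I = "cube_indices \<Omega> j"
  have "Lp_qnorm p (count_space ?I') (\<lambda>m. ennreal (cmod (mu j m)))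
     \<le> Lp_qnorm p (count_space ?I') (\<lambda>m. ennreal c * (\<Sum>m'\<in>R j m. ennreal (cmod (lam j m'))))"
    using mu assms(3) by (intro Lp_qnorm_count_space_mono[OF assms(1)])
      (auto simp: sum_nonneg simp flip: ennreal_mult intro!: ennreal_leI)
  also have "\<dots> \<le> ennreal c * Lp_qnorm p (count_space ?I') (\<lambda>m. \<Sum>m'\<in>R j m. ennreal (cmod (lam j m')))"
    using assms(1) by (intro Lp_qnorm_cmult) auto
  also have "\<dots> \<le> ennreal c * (ennreal (real k * real b powr (1 / enn2real p)) *
      Lp_qnorm p (count_space ?I) (\<lambda>m. ennreal (cmod (lam j m))))"
  proof (intro mult_left_mono Lp_qnorm_Schur(2)[OF assms(1)])
    fix m assume m: "m \<in> ?I"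
    show "{x \<in> space (count_space ?I'). m \<in> R j x} \<in> sets (count_space ?I')"
      by auto
    have "emeasure (count_space ?I') {x \<in> space (count_space ?I'). m \<in> R j x} = of_nat (card {m' \<in> ?I'. m \<in> R j m'})"
      using T[OF m] by (subst emeasure_count_space) auto
    also have "\<dots> \<le> ennreal (real b)"
      using T[OF m] by (simp add: ennreal_of_nat_eq_real_of_nat)
    finally show "emeasure (count_space ?I') {x \<in> space (count_space ?I'). m \<in> R j x} \<le> ennreal (real b)" .
  qed (use R \<open>0 < b\<close> in auto)
  also have "\<dots> = ennreal (c * (real k * real b powr (1 / enn2real p))) *
      Lp_qnorm p (count_space ?I) (\<lambda>m. ennreal (cmod (lam j m)))"
    using assms(3) by (simp add: ennreal_mult mult.assoc)
  finally show "Lp_qnorm p (count_space ?I') (\<lambda>m. ennreal (cmod (mu j m)))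
     \<le> ennreal (c * (real k * real b powr (1 / enn2real p))) *
      Lp_qnorm p (count_space ?I) (\<lambda>m. ennreal (cmod (lam j m)))" .
qed

text \<open>
  Cubes of level \<open>j\<close> have volume \<open>2\<^bsup>-jn\<^esup>\<close> up to a constant, so that the \<open>L\<^sub>p\<close> quasi-norm
  of level \<open>j\<close> is at most a constant times \<open>2\<^bsup>-js\<^esup>\<close> times the coefficient quasi-norm. Half of
  this decay is needed for the summation over \<open>j\<close>, the other half makes the tail small.
\<close>

lemma cover_sum_tail:
  assumes "0 < p" "0 < q" "0 < s"
  obtains C :: real where "0 < C"
    "\<And>(\<Omega> :: (real^'n::finite) set) lam J. \<Omega> \<in> sets lebesgue \<Longrightarrow> (\<And>j m. 0 \<le> lam j m) \<Longrightarrow>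
      Lp_qnorm p (lebesgue_on \<Omega>) (\<lambda>x. \<Sum>j. if J \<le> j then ennreal (cover_sum (lam j) j x) else 0)
        \<le> ennreal (C * 2 powr (- (real J * s / 2))) * coef_qnorm s p q lam"
    "\<And>(\<Omega> :: (real^'n::finite) set) lam j. \<Omega> \<in> sets lebesgue \<Longrightarrow> (\<And>j m. 0 \<le> lam j m) \<Longrightarrow>
      (\<lambda>x. ennreal (cover_sum (lam j) j x)) \<in> borel_measurable (lebesgue_on \<Omega>)"
proof -
  define \<theta> where "\<theta> = 1 / enn2real p"
  define n where "n = real CARD('n)"
  define r where "r = 2 powr (- (s / 2))"
  have r: "0 \<le> r" "r < 1"
    using assms(3) powr_less_mono[of "- (s / 2)" 0 2] by (auto simp: r_def)
  have rj: "r ^ j = 2 powr (- (real j * s / 2))" for j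
    by (simp add: r_def powr_realpow[symmetric] powr_powr algebra_simps)
  obtain C0 where C0: "0 < C0"
    "\<And>(M :: (real^'n) measure) g D. (\<And>j::nat. g j \<in> borel_measurable M) \<Longrightarrow> (\<And>j. Lp_qnorm p M (g j) \<le> D) \<Longrightarrow>
       Lp_qnorm p M (\<lambda>x. \<Sum>j. ennreal (r ^ j) * g j x) \<le> ennreal C0 * D"
    using Lp_qnorm_geometric[OF assms(1) r] by blast
  define C1 where "C1 = 3 ^ CARD('n) * 2 powr (n * \<theta>)"
  have C1: "0 < C1" by (simp add: C1_def)
  have cov: "(\<lambda>x. ennreal (cover_sum (lam j) j x)) \<in> borel_measurable (lebesgue_on \<Omega>)"
    "Lp_qnorm p (lebesgue_on \<Omega>) (\<lambda>x. ennreal (cover_sum (lam j) j x))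
        \<le> ennreal (C1 * 2 powr (- (real j * s))) * coef_qnorm s p q lam"
    if \<Omega>: "\<Omega> \<in> sets lebesgue" and lam: "\<And>j m. 0 \<le> lam j m" for \<Omega> :: "(real^'n) set" and lam j
  proof -
    let ?b = "(2 / 2 ^ j) ^ CARD('n) :: real"
    have eq: "ennreal (cover_sum (lam j) j x) = (\<Sum>m\<in>cubes_at j x. ennreal (lam j m))" for x
      using lam by (simp add: cover_sum_def sum_ennreal)
    have fc: "finite (cubes_at j x) \<and> cubes_at j x \<subseteq> UNIV \<and> card (cubes_at j x) \<le> 3 ^ CARD('n)" for x :: "real^'n"
      using card_cubes_at by auto
    have sp: "space (lebesgue_on \<Omega>) = \<Omega>"
      by simp
    have st: "{x \<in> space (lebesgue_on \<Omega>). m \<in> cubes_at j x} = \<Omega> \<inter> dcube 1 j m" for m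
      by (auto simp: cubes_at_def)
    have dm: "dcube 1 j m \<in> sets lebesgue" for m :: "int^'n"
      by (simp add: dcube_eq_cbox)
    have me: "{x \<in> space (lebesgue_on \<Omega>). m \<in> cubes_at j x} \<in> sets (lebesgue_on \<Omega>)" for m
      unfolding st using \<Omega> dm by (simp add: sets_restrict_space_iff)
    have em: "emeasure (lebesgue_on \<Omega>) {x \<in> space (lebesgue_on \<Omega>). m \<in> cubes_at j x} \<le> ennreal ?b" for m
    proof -
      have "emeasure (lebesgue_on \<Omega>) (\<Omega> \<inter> dcube 1 j m) = emeasure lebesgue (\<Omega> \<inter> dcube 1 j m)"
        using \<Omega> by (intro emeasure_restrict_space) auto
      also have "\<dots> \<le> emeasure lebesgue (dcube 1 j m)"
        using dm by (intro emeasure_mono) auto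
      finally show ?thesis
        unfolding st by (simp add: emeasure_dcube)
    qed
    have b0: "0 < ?b" by simp
    note S = Lp_qnorm_Schur[where R = "cubes_at j" and I = UNIV and lam = "\<lambda>m. ennreal (lam j m)",
        OF assms(1) countableI_type fc me em b0]
    show "(\<lambda>x. ennreal (cover_sum (lam j) j x)) \<in> borel_measurable (lebesgue_on \<Omega>)"
      unfolding eq by (rule S(1))
    define L where "L = Lp_qnorm p (count_space (UNIV :: (int^'n) set)) (\<lambda>m. ennreal (lam j m))"
    have "ennreal (2 powr (real j * (s - n / enn2real p))) * L \<le> coef_qnorm s p q lam"
      unfolding coef_qnorm_def b_qnorm_def L_def n_def
      using lam Lp_qnorm_point_le[OF assms(2), of j UNIV
        "\<lambda>j. ennreal (2 powr (real j * (s - real CARD('n) / enn2real p))) *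
            Lp_qnorm p (count_space (cube_indices UNIV j)) (\<lambda>m. ennreal (cmod (complex_of_real (lam j m))))"]
      by simp
    then have Lb: "ennreal (C1 * 2 powr (- (real j * s))) * (ennreal (2 powr (real j * (s - n * \<theta>))) * L)
        \<le> ennreal (C1 * 2 powr (- (real j * s))) * coef_qnorm s p q lam"
      by (intro mult_left_mono) (auto simp: \<theta>_def)
    have "Lp_qnorm p (lebesgue_on \<Omega>) (\<lambda>x. ennreal (cover_sum (lam j) j x))
        \<le> ennreal (real (3 ^ CARD('n)) * ?b powr \<theta>) * L"
      unfolding eq L_def \<theta>_def by (rule S(2))
    also have "ennreal (real (3 ^ CARD('n)) * ?b powr \<theta>) * L
        = ennreal (C1 * 2 powr (- (real j * s))) * (ennreal (2 powr (real j * (s - n * \<theta>))) * L)"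
    proof -
      have "?b = 2 powr (n * (1 - real j))"
        by (simp add: n_def powr_realpow[symmetric] powr_diff powr_powr algebra_simps power_divide)
      then have "?b powr \<theta> = 2 powr (n * \<theta> - real j * (n * \<theta>))"
        by (simp add: powr_powr algebra_simps)
      also have "\<dots> = 2 powr (n * \<theta>) * (2 powr (- (real j * s)) * 2 powr (real j * (s - n * \<theta>)))"
        by (simp add: powr_add[symmetric] algebra_simps)
      finally have "real (3 ^ CARD('n)) * ?b powr \<theta> = (C1 * 2 powr (- (real j * s))) * 2 powr (real j * (s - n * \<theta>))"
        by (simp add: C1_def mult.assoc)
      then show ?thesis
        using C1 by (simp add: ennreal_mult mult.assoc)
    qed
    finally show "Lp_qnorm p (lebesgue_on \<Omega>) (\<lambda>x. ennreal (cover_sum (lam j) j x))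
        \<le> ennreal (C1 * 2 powr (- (real j * s))) * coef_qnorm s p q lam"
      using Lb by simp
  qed
  show ?thesis
  proof (rule that[of "C0 * C1"])
    show "0 < C0 * C1" using C0 C1 by simp
    show "(\<lambda>x. ennreal (cover_sum (lam j) j x)) \<in> borel_measurable (lebesgue_on \<Omega>)"
      if "\<Omega> \<in> sets lebesgue" "\<And>j m. 0 \<le> lam j m" for \<Omega> :: "(real^'n) set" and lam j
      using cov(1)[OF that] .
    show "Lp_qnorm p (lebesgue_on \<Omega>) (\<lambda>x. \<Sum>j. if J \<le> j then ennreal (cover_sum (lam j) j x) else 0)
        \<le> ennreal (C0 * C1 * 2 powr (- (real J * s / 2))) * coef_qnorm s p q lam"
      if \<Omega>: "\<Omega> \<in> sets lebesgue" and lam: "\<And>j m. 0 \<le> lam j m" for \<Omega> :: "(real^'n) set" and lam J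
    proof -
      define g where "g j x = (if J \<le> j then ennreal (2 powr (real j * s / 2)) * ennreal (cover_sum (lam j) j x) else 0)" for j x
      note [measurable] = cov(1)[OF \<Omega> lam]
      have gm: "g j \<in> borel_measurable (lebesgue_on \<Omega>)" for j
        unfolding g_def[abs_def] by measurable
      have eq: "(if J \<le> j then ennreal (cover_sum (lam j) j x) else 0) = ennreal (r ^ j) * g j x" for j x
      proof -
        have "ennreal (r ^ j) * ennreal (2 powr (real j * s / 2)) = 1"
          unfolding rj by (simp add: powr_add[symmetric] flip: ennreal_mult)
        then show ?thesis
          by (simp add: g_def flip: mult.assoc)
      qed
      have "Lp_qnorm p (lebesgue_on \<Omega>) (g j) \<le> ennreal (C1 * 2 powr (- (real J * s / 2))) * coef_qnorm s p q lam" for j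
      proof (cases "J \<le> j")
        case True
        have "Lp_qnorm p (lebesgue_on \<Omega>) (g j)
          \<le> ennreal (2 powr (real j * s / 2)) * Lp_qnorm p (lebesgue_on \<Omega>) (\<lambda>x. ennreal (cover_sum (lam j) j x))"
          using Lp_qnorm_cmult[OF assms(1), of "\<lambda>x. ennreal (cover_sum (lam j) j x)" "lebesgue_on \<Omega>"] True
          by (simp add: g_def[abs_def])
        also have "\<dots> \<le> ennreal (2 powr (real j * s / 2)) *
            (ennreal (C1 * 2 powr (- (real j * s))) * coef_qnorm s p q lam)"
          using cov(2)[OF \<Omega> lam] by (intro mult_left_mono) auto
        also have "\<dots> = ennreal (C1 * 2 powr (- (real j * s / 2))) * coef_qnorm s p q lam"
        proof -
          have "2 powr (real j * s / 2) * (C1 * 2 powr (- (real j * s))) = C1 * 2 powr (- (real j * s / 2))"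
          proof -
            have "2 powr (real j * s / 2) * 2 powr (- (real j * s)) = 2 powr (- (real j * s / 2))"
              by (simp add: mult.commute flip: powr_add)
            then show ?thesis
              by (metis mult.left_commute)
          qed
          then show ?thesis
            using C1 by (metis ennreal_mult' mult.assoc powr_ge_zero)
        qed
        also have "\<dots> \<le> ennreal (C1 * 2 powr (- (real J * s / 2))) * coef_qnorm s p q lam"
          using True C1 assms(3) by (intro mult_right_mono ennreal_leI mult_left_mono powr_mono) auto
        finally show ?thesis .
      next
        case False
        then show ?thesis
          by (simp add: g_def[abs_def] Lp_qnorm_zero[OF assms(1)])
      qed
      from C0(2)[OF gm this] show ?thesis
        unfolding eq using C0(1) C1 by (simp add: ennreal_mult mult.assoc)
    qed
  qed
qed

text \<open>
  The radius \<open>5\<close> leaves room for sample points that lie only near \<open>Q\<^bsub>k,l\<^esub>\<close>. For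
  \<open>j \<le> k\<close> boundedly many cubes of level \<open>j\<close> are near a given cube of level \<open>k\<close>, whereas
  a cube of level \<open>j\<close> is near about \<open>2\<^bsup>(k-j)n\<^esup>\<close> cubes of level \<open>k\<close>.
\<close>

definition near_cubes :: "nat \<Rightarrow> nat \<Rightarrow> int^'n \<Rightarrow> (int^'n) set" where
  "near_cubes j k l = {m. \<forall>i. \<bar>real_of_int (m $ i) / 2 ^ j - real_of_int (l $ i) / 2 ^ k\<bar> \<le> 5 / 2 ^ j}"

lemma card_near_cubes:
  fixes l m :: "int^'n::finite"
  assumes "j \<le> k"
  shows "finite (near_cubes j k l)" "card (near_cubes j k l) \<le> 11 ^ CARD('n)"
    and "finite {l. m \<in> near_cubes j k l}"
    and "real (card {l. m \<in> near_cubes j k l}) \<le> (11 * 2 ^ (k - j)) ^ CARD('n)"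
proof -
  have e: "\<bar>a / 2 ^ j - b / 2 ^ k\<bar> \<le> 5 / 2 ^ j \<longleftrightarrow> \<bar>a - b / 2 ^ (k - j)\<bar> \<le> 5" for a b :: real
  proof -
    have "a / 2 ^ j - b / 2 ^ k = (a - b / 2 ^ (k - j)) / 2 ^ j"
      using assms by (simp add: diff_divide_distrib flip: power_add)
    then show ?thesis
      by (simp add: abs_divide divide_le_cancel)
  qed
  have e': "\<bar>a / 2 ^ j - b / 2 ^ k\<bar> \<le> 5 / 2 ^ j \<longleftrightarrow> \<bar>b - a * 2 ^ (k - j)\<bar> \<le> 5 * 2 ^ (k - j)" for a b :: real
  proof -
    have "\<bar>a - b / 2 ^ (k - j)\<bar> = \<bar>b - a * 2 ^ (k - j)\<bar> / 2 ^ (k - j)"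
    proof -
      have "a - b / 2 ^ (k - j) = - (b - a * 2 ^ (k - j)) / 2 ^ (k - j)"
        by (simp add: field_simps)
      then show ?thesis
        by (simp add: abs_divide)
    qed
    then show ?thesis
      unfolding e by (simp add: divide_le_eq)
  qed
  have eq: "near_cubes j k l = {m. \<forall>i. \<bar>real_of_int (m $ i) - real_of_int (l $ i) / 2 ^ (k - j)\<bar> \<le> 5}"
    by (simp add: near_cubes_def e)
  have eq': "{l. m \<in> near_cubes j k l} = {l. \<forall>i. \<bar>real_of_int (l $ i) - real_of_int (m $ i) * 2 ^ (k - j)\<bar> \<le> 5 * 2 ^ (k - j)}"
    by (simp add: near_cubes_def e')
  show "finite (near_cubes j k l)"
    unfolding eq by (rule card_int_box) simp
  have "real (card (near_cubes j k l)) \<le> (2 * 5 + 1) ^ CARD('n)"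
    unfolding eq by (rule card_int_box) simp
  then have "real (card (near_cubes j k l)) \<le> real (11 ^ CARD('n))"
    by simp
  then show "card (near_cubes j k l) \<le> 11 ^ CARD('n)"
    by (simp only: of_nat_le_iff)
  show "finite {l. m \<in> near_cubes j k l}"
    unfolding eq' by (rule card_int_box) simp
  have "real (card {l. m \<in> near_cubes j k l}) \<le> (2 * (5 * 2 ^ (k - j)) + 1) ^ CARD('n)"
    unfolding eq' by (rule card_int_box) simp
  also have "\<dots> \<le> (11 * 2 ^ (k - j)) ^ CARD('n)"
    by (intro power_mono) auto
  finally show "real (card {l. m \<in> near_cubes j k l}) \<le> (11 * 2 ^ (k - j)) ^ CARD('n)" .
qed

text \<open>
  The place where \<open>s < 1\<close> enters. A coefficient of level \<open>j\<close> acts on level \<open>k \<ge> j\<close>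
  with the Lipschitz gain \<open>2\<^bsup>-(k-j)\<^esup>\<close>; the weights and the number of fine cubes cost
  \<open>2\<^bsup>(k-j)s\<^esup>\<close> together, so that a geometric series with ratio \<open>2\<^bsup>s-1\<^esup>\<close> remains.
\<close>

lemma b_qnorm_multiscale:
  assumes "0 < p" "0 < q" "s < 1"
  obtains C :: real where "0 < C"
    "\<And>(\<Omega> :: (real^'n::finite) set) lam mu c. (\<And>j m. 0 \<le> lam j m) \<Longrightarrow> 0 \<le> c \<Longrightarrow>
      (\<And>k l. l \<in> cube_indices \<Omega> k \<Longrightarrow>
         cmod (mu k l) \<le> c * (\<Sum>j\<le>k. (\<Sum>m\<in>near_cubes j k l. lam j m) / 2 ^ (k - j))) \<Longrightarrow>
      b_qnorm s p q \<Omega> mu \<le> ennreal (C * c) * coef_qnorm s p q lam"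
proof -
  define \<theta> where "\<theta> = 1 / enn2real p"
  define n where "n = real CARD('n)"
  \<comment> \<open>The ratio \<open>2\<^bsup>s-1\<^esup> = r\<^sup>2\<close> is shared by the summation inside a level and the one over levels.\<close>
  define \<delta> where "\<delta> = (1 - s) / 2"
  define r where "r = 2 powr (- \<delta>)"
  have r: "0 \<le> r" "r < 1"
    using assms(3) powr_less_mono[of "- \<delta>" 0 2] by (auto simp: r_def \<delta>_def)
  have rj: "r ^ j = 2 powr (- (real j * \<delta>))" for j
    by (simp add: r_def powr_realpow[symmetric] powr_powr algebra_simps)
  obtain Cp where Cp: "0 < Cp"
    "\<And>(M :: (int^'n) measure) g D. (\<And>j::nat. g j \<in> borel_measurable M) \<Longrightarrow> (\<And>j. Lp_qnorm p M (g j) \<le> D) \<Longrightarrow>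
       Lp_qnorm p M (\<lambda>x. \<Sum>j. ennreal (r ^ j) * g j x) \<le> ennreal Cp * D"
    using Lp_qnorm_geometric[OF assms(1) r] by blast
  obtain Cq where Cq: "0 < Cq"
    "\<And>(M :: nat measure) g D. (\<And>j::nat. g j \<in> borel_measurable M) \<Longrightarrow> (\<And>j. Lp_qnorm q M (g j) \<le> D) \<Longrightarrow>
       Lp_qnorm q M (\<lambda>x. \<Sum>j. ennreal (r ^ j) * g j x) \<le> ennreal Cq * D"
    using Lp_qnorm_geometric[OF assms(2) r] by blast
  define C1 where "C1 = 11 ^ CARD('n) * (11 ^ CARD('n)) powr \<theta>"
  have C1: "0 < C1" by (simp add: C1_def)
  define w where "w k = 2 powr (real k * (s - n * \<theta>))" for k :: nat
  have w: "0 < w k" for k by (simp add: w_def)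
  show ?thesis
  proof (rule that[of "Cp * C1 * Cq"])
    show "0 < Cp * C1 * Cq" using Cp Cq C1 by simp
    fix \<Omega> :: "(real^'n) set" and lam :: "nat \<Rightarrow> int^'n \<Rightarrow> real" and mu :: "nat \<Rightarrow> int^'n \<Rightarrow> complex" and c :: real
    assume lam: "\<And>j m. 0 \<le> lam j m" and c: "0 \<le> c"
      and mu: "\<And>k l. l \<in> cube_indices \<Omega> k \<Longrightarrow>
         cmod (mu k l) \<le> c * (\<Sum>j\<le>k. (\<Sum>m\<in>near_cubes j k l. lam j m) / 2 ^ (k - j))"
    define L where "L j = Lp_qnorm p (count_space (UNIV :: (int^'n) set)) (\<lambda>m. ennreal (lam j m))" for j
    define a where "a j = ennreal (w j) * L j" for j
    define h where "h i k = (if i \<le> k then a (k - i) else 0)" for i k :: nat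
    define H where "H k = (\<Sum>i. ennreal (r ^ i) * h i k)" for k
    have an: "Lp_qnorm q (count_space UNIV) a = coef_qnorm s p q lam"
      using lam by (simp add: coef_qnorm_def b_qnorm_def a_def[abs_def] L_def w_def \<theta>_def n_def)
    have Hn: "Lp_qnorm q (count_space UNIV) H \<le> ennreal Cq * coef_qnorm s p q lam"
      unfolding H_def
    proof (rule Cq(2))
      fix i :: nat
      let ?R = "\<lambda>k::nat. if i \<le> k then {k - i} else {}"
      have "Lp_qnorm q (count_space UNIV) (\<lambda>k. \<Sum>m\<in>?R k. a m)
          \<le> ennreal (real 1 * 1 powr (1 / enn2real q)) * Lp_qnorm q (count_space UNIV) a"
      proof (rule Lp_qnorm_Schur(2)[OF assms(2)])
        fix m :: nat
        have "{x \<in> space (count_space UNIV). m \<in> ?R x} = {m + i}"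
          by (auto split: if_splits)
        then show "emeasure (count_space UNIV) {x \<in> space (count_space UNIV). m \<in> ?R x} \<le> ennreal 1"
          by simp
      qed auto
      moreover have "(\<lambda>k. \<Sum>m\<in>?R k. a m) = h i"
        by (auto simp: h_def fun_eq_iff)
      ultimately show "Lp_qnorm q (count_space UNIV) (h i) \<le> coef_qnorm s p q lam"
        by (simp add: an)
    qed auto
    have level: "ennreal (w k) * Lp_qnorm p (count_space (cube_indices \<Omega> k)) (\<lambda>l. ennreal (cmod (mu k l)))
        \<le> ennreal (Cp * C1 * c) * H k" for k
    proof -
      let ?M = "count_space (cube_indices \<Omega> k)"
      define g where "g i l = (if i \<le> k then ennreal (2 powr (- (real i * (1 - \<delta>)))) *
          (\<Sum>m\<in>near_cubes (k - i) k l. ennreal (lam (k - i) m)) else 0)" for i l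
      have gn: "Lp_qnorm p ?M (g i) \<le> ennreal (C1 / w k) * H k" for i
      proof (cases "i \<le> k")
        case True
        let ?b = "(11 * 2 ^ i) ^ CARD('n) :: real"
        have fc: "finite (near_cubes (k - i) k l)" "card (near_cubes (k - i) k l) \<le> 11 ^ CARD('n)" for l :: "int^'n"
          by (rule card_near_cubes; simp)+
        have "Lp_qnorm p ?M (g i) \<le> ennreal (2 powr (- (real i * (1 - \<delta>)))) *
            Lp_qnorm p ?M (\<lambda>l. \<Sum>m\<in>near_cubes (k - i) k l. ennreal (lam (k - i) m))"
          using True Lp_qnorm_cmult[OF assms(1), of "\<lambda>l. \<Sum>m\<in>near_cubes (k - i) k l. ennreal (lam (k - i) m)" ?M]
          by (simp add: g_def[abs_def])
        also have "\<dots> \<le> ennreal (2 powr (- (real i * (1 - \<delta>)))) * (ennreal (real (11 ^ CARD('n)) * ?b powr (1 / enn2real p)) * L (k - i))"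
          unfolding L_def
        proof (intro mult_left_mono Lp_qnorm_Schur(2)[OF assms(1)])
          fix m :: "int^'n"
          have "emeasure ?M {x \<in> space ?M. m \<in> near_cubes (k - i) k x}
              \<le> emeasure (count_space UNIV) {l. m \<in> near_cubes (k - i) k l}"
            using card_near_cubes(3)[of "k - i" k m] by (subst (1 2) emeasure_count_space) (auto intro!: card_mono)
          also have "\<dots> = ennreal (real (card {l. m \<in> near_cubes (k - i) k l}))"
            using card_near_cubes(3)[of "k - i" k m] by (subst emeasure_count_space) (auto simp: ennreal_of_nat_eq_real_of_nat)
          also have "\<dots> \<le> ennreal ?b"
            using card_near_cubes(4)[of "k - i" k m] True by (intro ennreal_leI) simp
          finally show "emeasure ?M {x \<in> space ?M. m \<in> near_cubes (k - i) k x} \<le> ennreal ?b" .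
        qed (use fc in auto)
        also have "\<dots> = ennreal (C1 / w k) * (ennreal (r ^ i) * h i k)"
        proof -
          have "?b = 11 ^ CARD('n) * 2 powr (n * real i)"
            by (simp add: n_def powr_realpow[symmetric] powr_powr power_mult_distrib algebra_simps)
          then have A: "?b powr \<theta> = (11 ^ CARD('n)) powr \<theta> * 2 powr (real i * (n * \<theta>))"
            by (simp add: powr_mult powr_powr algebra_simps)
          have B: "2 powr (- (real i * (1 - \<delta>))) * 2 powr (real i * (n * \<theta>)) = 1 / w k * (r ^ i * w (k - i))"
          proof -
            have "r ^ i * w (k - i) = w k * (2 powr (- (real i * (1 - \<delta>))) * 2 powr (real i * (n * \<theta>)))"
              unfolding rj w_def powr_add[symmetric]
              by (rule arg_cong[where f = "\<lambda>x. 2 powr x"]) (use True in \<open>simp add: of_nat_diff \<delta>_def field_simps\<close>)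
            then show ?thesis
              using w[of k] by (simp add: field_simps)
          qed
          have "2 powr (- (real i * (1 - \<delta>))) * (real (11 ^ CARD('n)) * ?b powr \<theta>)
              = C1 * (2 powr (- (real i * (1 - \<delta>))) * 2 powr (real i * (n * \<theta>)))"
            unfolding A C1_def by simp
          then have "2 powr (- (real i * (1 - \<delta>))) * (real (11 ^ CARD('n)) * ?b powr \<theta>) = C1 / w k * (r ^ i * w (k - i))"
            unfolding B by simp
          then have "ennreal (2 powr (- (real i * (1 - \<delta>)))) * ennreal (real (11 ^ CARD('n)) * ?b powr \<theta>)
              = ennreal (C1 / w k) * (ennreal (r ^ i) * ennreal (w (k - i)))"
            using r C1 w[of k] w[of "k - i"] ennreal_mult[of "2 powr (- (real i * (1 - \<delta>)))" "real (11 ^ CARD('n)) * ?b powr \<theta>"]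
              ennreal_mult[of "C1 / w k" "r ^ i * w (k - i)"] ennreal_mult[of "r ^ i" "w (k - i)"] by simp
          then show ?thesis
            using True by (simp add: h_def a_def \<theta>_def) (metis mult.assoc)
        qed
        also have "\<dots> \<le> ennreal (C1 / w k) * H k"
          unfolding H_def using sum_le_suminf[of "\<lambda>i. ennreal (r ^ i) * h i k" "{i}"]
          by (intro mult_left_mono) auto
        finally show ?thesis .
      next
        case False
        then show ?thesis
          by (simp add: g_def[abs_def] Lp_qnorm_zero[OF assms(1)])
      qed
      have sumeq: "(\<Sum>i. ennreal (r ^ i) * g i l) = ennreal (\<Sum>j\<le>k. (\<Sum>m\<in>near_cubes j k l. lam j m) / 2 ^ (k - j))" for l
      proof -
        have t: "ennreal (r ^ i) * g i l = ennreal ((\<Sum>m\<in>near_cubes (k - i) k l. lam (k - i) m) / 2 ^ i)" if "i \<le> k" for i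
        proof -
          have "r ^ i * (2 powr (- (real i * (1 - \<delta>))) * X) = X / 2 ^ i" for X
          proof -
            have "r ^ i * 2 powr (- (real i * (1 - \<delta>))) = 2 powr (- real i)"
              unfolding rj by (simp add: powr_add[symmetric] algebra_simps)
            then show ?thesis
              by (simp add: powr_minus powr_realpow divide_inverse mult.assoc[symmetric])
          qed
          then show ?thesis
            using that lam r by (simp add: g_def sum_ennreal sum_nonneg flip: ennreal_mult)
        qed
        have "(\<Sum>i. ennreal (r ^ i) * g i l) = (\<Sum>i\<in>{..k}. ennreal (r ^ i) * g i l)"
          by (intro suminf_finite) (auto simp: g_def)
        also have "\<dots> = ennreal (\<Sum>i\<le>k. (\<Sum>m\<in>near_cubes (k - i) k l. lam (k - i) m) / 2 ^ i)"
          using lam by (subst sum_ennreal[symmetric]) (auto intro!: sum.cong t sum_nonneg divide_nonneg_nonneg)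
        also have "(\<Sum>i\<le>k. (\<Sum>m\<in>near_cubes (k - i) k l. lam (k - i) m) / 2 ^ i)
            = (\<Sum>j\<le>k. (\<Sum>m\<in>near_cubes j k l. lam j m) / 2 ^ (k - j))"
          by (rule sum.reindex_bij_witness[of _ "\<lambda>j. k - j" "\<lambda>i. k - i"]) auto
        finally show ?thesis .
      qed
      have "Lp_qnorm p ?M (\<lambda>l. ennreal (cmod (mu k l))) \<le> Lp_qnorm p ?M (\<lambda>l. ennreal c * (\<Sum>i. ennreal (r ^ i) * g i l))"
        unfolding sumeq using c lam mu
        by (intro Lp_qnorm_count_space_mono[OF assms(1)])
           (auto simp: sum_nonneg simp flip: ennreal_mult intro!: ennreal_leI)
      also have "\<dots> \<le> ennreal c * Lp_qnorm p ?M (\<lambda>l. \<Sum>i. ennreal (r ^ i) * g i l)"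
        by (intro Lp_qnorm_cmult[OF assms(1)]) auto
      also have "\<dots> \<le> ennreal c * (ennreal Cp * (ennreal (C1 / w k) * H k))"
        using gn by (intro mult_left_mono Cp(2)) auto
      finally have "ennreal (w k) * Lp_qnorm p ?M (\<lambda>l. ennreal (cmod (mu k l)))
          \<le> ennreal (w k) * (ennreal c * (ennreal Cp * (ennreal (C1 / w k) * H k)))"
        by (intro mult_left_mono) auto
      also have "\<dots> = (ennreal (w k) * (ennreal c * (ennreal Cp * ennreal (C1 / w k)))) * H k"
        by (simp add: mult.assoc)
      also have "ennreal (w k) * (ennreal c * (ennreal Cp * ennreal (C1 / w k))) = ennreal (Cp * C1 * c)"
      proof -
        have "w k * (c * (Cp * (C1 / w k))) = Cp * C1 * c"
          using w[of k] by simp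
        then show ?thesis
          using c Cp(1) C1 w[of k] ennreal_mult[of "w k" "c * (Cp * (C1 / w k))"]
            ennreal_mult[of c "Cp * (C1 / w k)"] ennreal_mult[of Cp "C1 / w k"] by (simp add: mult.commute mult.left_commute)
      qed
      finally show ?thesis .
    qed
    have "b_qnorm s p q \<Omega> mu \<le> Lp_qnorm q (count_space UNIV) (\<lambda>k. ennreal (Cp * C1 * c) * H k)"
      unfolding b_qnorm_def using level
      by (intro Lp_qnorm_count_space_mono[OF assms(2)]) (simp add: w_def \<theta>_def n_def)
    also have "\<dots> \<le> ennreal (Cp * C1 * c) * Lp_qnorm q (count_space UNIV) H"
      by (intro Lp_qnorm_cmult[OF assms(2)]) auto
    also have "\<dots> \<le> ennreal (Cp * C1 * c) * (ennreal Cq * coef_qnorm s p q lam)"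
      by (intro mult_left_mono Hn) auto
    also have "\<dots> = ennreal (Cp * C1 * Cq * c) * coef_qnorm s p q lam"
    proof -
      have "ennreal (Cp * C1 * c) * ennreal Cq = ennreal (Cp * C1 * Cq * c)"
        using c Cp(1) C1 Cq(1) by (subst ennreal_mult[symmetric]) (auto simp: ac_simps)
      then show ?thesis
        by (simp flip: mult.assoc)
    qed
    finally show "b_qnorm s p q \<Omega> mu \<le> ennreal (Cp * C1 * Cq * c) * coef_qnorm s p q lam" .
  qed
qed

section \<open>Functions of one variable of class \<open>C\<^sup>k\<close>\<close>

text \<open>
  The recursive form, with the derivative as a witness, lets the closure properties below be
  proved by induction on the order.
\<close>

primrec Ck :: "nat \<Rightarrow> (real \<Rightarrow> real) \<Rightarrow> bool" where
  "Ck 0 f \<longleftrightarrow> continuous_on UNIV f"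
| "Ck (Suc k) f \<longleftrightarrow> (\<exists>f'. (\<forall>x. (f has_real_derivative f' x) (at x)) \<and> Ck k f')"

lemma Ck_SucI: "(\<And>x. (f has_real_derivative f' x) (at x)) \<Longrightarrow> Ck k f' \<Longrightarrow> Ck (Suc k) f"
  by auto

lemma Ck_SucD:
  assumes "Ck (Suc k) f"
  shows "(f has_real_derivative deriv f x) (at x)" and "Ck k (deriv f)"
proof -
  obtain f' where f': "\<And>x. (f has_real_derivative f' x) (at x)" "Ck k f'"
    using assms by auto
  then have "deriv f = f'"
    by (auto simp: fun_eq_iff intro: DERIV_imp_deriv)
  with f' show "(f has_real_derivative deriv f x) (at x)" and "Ck k (deriv f)"
    by auto
qed

lemma Ck_Suc_imp_Ck: "Ck (Suc k) f \<Longrightarrow> Ck k f"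
proof (induction k arbitrary: f)
  case 0
  then have "isCont f x" for x
    using DERIV_isCont by auto
  then show ?case
    by (simp add: continuous_at_imp_continuous_on)
next
  case (Suc k)
  from Ck_SucD[OF Suc.prems] Suc.IH show ?case
    by (intro Ck_SucI[where f' = "deriv f"]) auto
qed

lemma Ck_imp_continuous: "Ck k f \<Longrightarrow> continuous_on UNIV f"
  by (induction k) (use Ck_Suc_imp_Ck in auto)

lemma Ck_const: "Ck k (\<lambda>x. c)"
  by (induction k arbitrary: c) (auto intro!: exI[of _ "\<lambda>x. 0"])

lemma Ck_add: "Ck k f \<Longrightarrow> Ck k g \<Longrightarrow> Ck k (\<lambda>x. f x + g x)"
proof (induction k arbitrary: f g)
  case 0
  then show ?case by (auto intro: continuous_intros)
next
  case (Suc k)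
  from Suc.prems obtain f' g' where "\<And>x. (f has_real_derivative f' x) (at x)" "Ck k f'"
     "\<And>x. (g has_real_derivative g' x) (at x)" "Ck k g'"
    by auto
  then show ?case
    using Suc.IH by (intro Ck_SucI[where f' = "\<lambda>x. f' x + g' x"]) (auto intro!: derivative_eq_intros)
qed

lemma Ck_mult: "Ck k f \<Longrightarrow> Ck k g \<Longrightarrow> Ck k (\<lambda>x. f x * g x)"
proof (induction k arbitrary: f g)
  case 0
  then show ?case by (auto intro: continuous_intros)
next
  case (Suc k)
  from Suc.prems obtain f' g' where *: "\<And>x. (f has_real_derivative f' x) (at x)" "Ck k f'"
     "\<And>x. (g has_real_derivative g' x) (at x)" "Ck k g'"
    by auto
  have "Ck k f" "Ck k g"
    using Suc.prems Ck_Suc_imp_Ck by auto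
  with * Suc.IH show ?case
    by (intro Ck_SucI[where f' = "\<lambda>x. f' x * g x + g' x * f x"] Ck_add) (auto intro!: derivative_eq_intros)
qed

lemma Ck_diff: "Ck k f \<Longrightarrow> Ck k g \<Longrightarrow> Ck k (\<lambda>x. f x - g x)"
  using Ck_add[of k f "\<lambda>x. - 1 * g x"] Ck_mult[OF Ck_const[of k "- 1"], of g] by simp

lemma Ck_inverse: "Ck k f \<Longrightarrow> (\<And>x. f x \<noteq> 0) \<Longrightarrow> Ck k (\<lambda>x. inverse (f x))"
proof (induction k arbitrary: f)
  case 0
  then show ?case by (auto intro!: continuous_intros)
next
  case (Suc k)
  from Suc.prems obtain f' where *: "\<And>x. (f has_real_derivative f' x) (at x)" "Ck k f'"
    by auto
  have "Ck k (\<lambda>x. inverse (f x))"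
    using Suc Ck_Suc_imp_Ck by auto
  then have "Ck k (\<lambda>x. - 1 * (inverse (f x) * f' x * inverse (f x)))"
    using * by (intro Ck_mult Ck_const)
  then show ?case
    using * Suc.prems
    by (intro Ck_SucI[where f' = "\<lambda>x. - 1 * (inverse (f x) * f' x * inverse (f x))"])
       (auto intro!: derivative_eq_intros)
qed

lemma Ck_affine: "Ck k f \<Longrightarrow> Ck k (\<lambda>x. f (a * x + b))"
proof (induction k arbitrary: f)
  case 0
  then show ?case by (auto intro!: continuous_on_compose2[where f = "\<lambda>x. a * x + b", of UNIV f] continuous_intros)
next
  case (Suc k)
  from Suc.prems obtain f' where *: "\<And>x. (f has_real_derivative f' x) (at x)" "Ck k f'"
    by auto
  have "((\<lambda>x. f (a * x + b)) has_real_derivative a * f' (a * x + b)) (at x)" for x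
    by (subst mult.commute, rule DERIV_chain2[where g = "\<lambda>x. a * x + b"], rule *(1))
      (auto intro!: derivative_eq_intros)
  then show ?case
    using *(2) Suc.IH by (intro Ck_SucI[where f' = "\<lambda>x. a * f' (a * x + b)"] Ck_mult Ck_const) auto
qed

lemma Ck_deriv_iter: "Ck K f \<Longrightarrow> i \<le> K \<Longrightarrow> Ck (K - i) ((deriv ^^ i) f)"
proof (induction i)
  case (Suc i)
  then have "Ck (Suc (K - Suc i)) ((deriv ^^ i) f)"
    by (simp add: Suc_diff_Suc)
  then show ?case
    using Ck_SucD(2) by auto
qed simp

lemma Ck_deriv_iter_continuous: "Ck K f \<Longrightarrow> i \<le> K \<Longrightarrow> continuous_on UNIV ((deriv ^^ i) f)"
  using Ck_deriv_iter Ck_imp_continuous by blast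

lemma Ck_deriv_iter_DERIV:
  assumes "Ck K f" "i < K"
  shows "((deriv ^^ i) f has_real_derivative (deriv ^^ Suc i) f x) (at x)"
proof -
  have "Ck (Suc (K - Suc i)) ((deriv ^^ i) f)"
    using Ck_deriv_iter[of K f i] assms by (simp add: Suc_diff_Suc)
  then show ?thesis
    using Ck_SucD(1) by auto
qed

lemma deriv_iter_affine:
  assumes "Ck K f" "i \<le> K"
  shows "(deriv ^^ i) (\<lambda>x. f (a * x + b)) = (\<lambda>x. a ^ i * (deriv ^^ i) f (a * x + b))"
  using assms(2)
proof (induction i)
  case (Suc i)
  have "((\<lambda>x. a ^ i * (deriv ^^ i) f (a * x + b)) has_real_derivative
      a ^ Suc i * (deriv ^^ Suc i) f (a * x + b)) (at x)" for x
  proof -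
    have "((\<lambda>x. (deriv ^^ i) f (a * x + b)) has_real_derivative (deriv ^^ Suc i) f (a * x + b) * a) (at x)"
      using Suc.prems by (intro DERIV_chain2[OF Ck_deriv_iter_DERIV[OF assms(1)]]) (auto intro!: derivative_eq_intros)
    from DERIV_cmult[OF this, of "a ^ i"] show ?thesis
      by (simp add: ac_simps)
  qed
  then have "deriv (\<lambda>x. a ^ i * (deriv ^^ i) f (a * x + b)) = (\<lambda>x. a ^ Suc i * (deriv ^^ Suc i) f (a * x + b))"
    by (intro ext DERIV_imp_deriv)
  moreover have "(deriv ^^ Suc i) (\<lambda>x. f (a * x + b)) = deriv (\<lambda>x. a ^ i * (deriv ^^ i) f (a * x + b))"
    using Suc by simp
  ultimately show ?case
    by simp
qed simp

text \<open>
  All derivatives vanish outside \<open>[-1, 1]\<close> as well, and they are bounded there by compactness.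
\<close>

lemma Ck_compact_support_bounded:
  assumes "Ck K f" and supp: "\<And>t. \<bar>t\<bar> \<ge> 1 \<Longrightarrow> f t = 0"
  obtains D where "\<And>i t. i \<le> K \<Longrightarrow> \<bar>(deriv ^^ i) f t\<bar> \<le> D"
proof -
  have op: "open {t::real. \<bar>t\<bar> > 1}"
    by (intro open_Collect_less continuous_intros)
  have van: "(deriv ^^ i) f t = 0" if "i \<le> K" "\<bar>t\<bar> > 1" for i t
    using that
  proof (induction i arbitrary: t)
    case (Suc i)
    have "((deriv ^^ i) f has_real_derivative 0) (at t)"
      by (rule has_field_derivative_transform_within_open[OF _ op, where f = "\<lambda>x. 0"])
        (use Suc in auto)
    then show ?case
      by (simp add: DERIV_imp_deriv)
  qed (use supp in auto)
  have "\<exists>D. \<forall>t. \<bar>(deriv ^^ i) f t\<bar> \<le> D" if "i \<le> K" for i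
  proof -
    have "compact ((deriv ^^ i) f ` {-1..1})"
      using Ck_deriv_iter_continuous[OF assms(1) that]
      by (intro compact_continuous_image) (auto intro: continuous_on_subset)
    then obtain D where D: "\<And>t. t \<in> {-1..1} \<Longrightarrow> \<bar>(deriv ^^ i) f t\<bar> \<le> D"
      using compact_imp_bounded bounded_iff by (metis image_eqI real_norm_def)
    have "\<bar>(deriv ^^ i) f t\<bar> \<le> max D 0" for t
    proof (cases "\<bar>t\<bar> > 1")
      case True
      then show ?thesis using van[OF that True] by simp
    next
      case False
      then have "t \<in> {-1..1}" by auto
      from D[OF this] show ?thesis by simp
    qed
    then show ?thesis by blast
  qed
  then obtain D where D: "\<And>i t. i \<le> K \<Longrightarrow> \<bar>(deriv ^^ i) f t\<bar> \<le> D i"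
    by metis
  show ?thesis
  proof (rule that)
    fix i t assume i: "i \<le> K"
    have "\<bar>(deriv ^^ i) f t\<bar> \<le> D i" by (rule D[OF i])
    also have "\<dots> \<le> (\<Sum>i\<le>K. D i)"
      using i D[of _ 0] by (intro member_le_sum) (auto intro: order_trans[OF abs_ge_zero])
    finally show "\<bar>(deriv ^^ i) f t\<bar> \<le> (\<Sum>i\<le>K. D i)" .
  qed
qed

section \<open>A partition of unity on the line\<close>

lemma Ck_pos_part_power: "Ck r (\<lambda>t. max 0 t ^ Suc r)"
proof (induction r)
  case 0
  then show ?case by (auto intro!: continuous_intros)
next
  case (Suc r)
  have "((\<lambda>t. max 0 t ^ Suc (Suc r)) has_real_derivative real (r + 2) * max 0 t ^ Suc r) (at t)" for t :: real
  proof -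
    consider "t > 0" | "t < 0" | "t = 0" by linarith
    then show ?thesis
    proof cases
      case 1
      have "((\<lambda>t. t ^ Suc (Suc r)) has_real_derivative real (r + 2) * t ^ Suc r) (at t)"
        using DERIV_pow[of "Suc (Suc r)" t UNIV] by (simp add: add.commute)
      then have "((\<lambda>t. t ^ Suc (Suc r)) has_real_derivative real (r + 2) * max 0 t ^ Suc r) (at t)"
        using 1 by simp
      then show ?thesis
        by (rule has_field_derivative_transform_within_open[of _ _ _ "{0<..}"]) (use 1 in auto)
    next
      case 2
      have "((\<lambda>t. 0) has_real_derivative real (r + 2) * max 0 t ^ Suc r) (at t)"
        using 2 by (simp add: max_absorb1)
      then show ?thesis
        by (rule has_field_derivative_transform_within_open[of _ _ _ "{..<0}"]) (use 2 in auto)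
    next
      case 3
      have "((\<lambda>h::real. max 0 h ^ Suc r) \<longlongrightarrow> max 0 0 ^ Suc r) (at 0)"
        by (intro tendsto_intros)
      moreover have "\<forall>\<^sub>F h in at (0::real). max 0 h ^ Suc r = (max 0 (0 + h) ^ Suc (Suc r) - max 0 0 ^ Suc (Suc r)) / h"
        unfolding eventually_at_filter by (intro always_eventually) (auto simp: max_def)
      ultimately have "((\<lambda>h::real. (max 0 (0 + h) ^ Suc (Suc r) - max 0 0 ^ Suc (Suc r)) / h) \<longlongrightarrow> max 0 0 ^ Suc r) (at 0)"
        by (rule Lim_transform_eventually)
      then show ?thesis
        using 3 by (simp add: DERIV_def)
    qed
  qed
  then show ?case
    using Suc.IH by (intro Ck_SucI[where f' = "\<lambda>t. real (r + 2) * max 0 t ^ Suc r"] Ck_mult Ck_const) auto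
qed

text \<open>
  Let \<open>\<sigma>\<close> be a step of class \<open>C\<^sup>K\<close> from \<open>0\<close> on the left of \<open>0\<close> to \<open>1\<close> on the right of \<open>1\<close>. The
  bump \<open>\<sigma>(t + 1) - \<sigma>(t)\<close> lives on \<open>[-1, 1]\<close>, and its integer translates add up to \<open>1\<close> by
  telescoping.
\<close>

lemma partition_of_unity_line:
  obtains h :: "real \<Rightarrow> real"
  where "Ck K h" "\<And>t. \<bar>t\<bar> \<ge> 1 \<Longrightarrow> h t = 0" "\<And>t. 0 \<le> h t" "\<And>t. h t \<le> 1"
    "\<And>t. (\<Sum>z\<in>{z::int. \<bar>real_of_int z - t\<bar> \<le> 1}. h (t - real_of_int z)) = 1"
proof -
  define A where "A t = max 0 t ^ Suc K" for t :: real
  define \<sigma> where "\<sigma> t = A t * inverse (A t + A (-1 * t + 1))" for t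
  define h where "h t = \<sigma> (1 * t + 1) - \<sigma> t" for t
  have A: "Ck K A" "0 \<le> A t" "t > 0 \<Longrightarrow> A t > 0" "t \<le> 0 \<Longrightarrow> A t = 0" for t
    unfolding A_def[abs_def] by (rule Ck_pos_part_power) auto
  have den: "A t + A (-1 * t + 1) > 0" for t
  proof (cases "t > 0")
    case True
    then show ?thesis using A(2,3) by (intro add_pos_nonneg)
  next
    case False
    then show ?thesis using A(2) A(3)[of "-1 * t + 1"] by (intro add_nonneg_pos) auto
  qed
  have C\<sigma>: "Ck K \<sigma>"
    unfolding \<sigma>_def[abs_def] by (intro Ck_mult Ck_inverse Ck_add Ck_affine A(1)) (use den in \<open>simp add: less_imp_neq[symmetric]\<close>)
  have Ch: "Ck K h"
    unfolding h_def[abs_def] by (intro Ck_diff Ck_affine C\<sigma>)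
  have \<sigma>0: "\<sigma> t = 0" if "t \<le> 0" for t
    using that A by (simp add: \<sigma>_def)
  have \<sigma>1: "\<sigma> t = 1" if "t \<ge> 1" for t
  proof -
    have "A (-1 * t + 1) = 0" using that A(4) by simp
    then show ?thesis using A(3)[of t] that by (simp add: \<sigma>_def)
  qed
  have \<sigma>: "0 \<le> \<sigma> t" "\<sigma> t \<le> 1" for t
    using den[of t] A(2)[of t] A(2)[of "-1 * t + 1"] by (auto simp: \<sigma>_def field_simps)
  show ?thesis
  proof (rule that[OF Ch])
    show supp: "h t = 0" if "\<bar>t\<bar> \<ge> 1" for t
      using that \<sigma>0[of t] \<sigma>0[of "t + 1"] \<sigma>1[of t] \<sigma>1[of "t + 1"] by (cases "t \<ge> 1") (auto simp: h_def)
    show "0 \<le> h t" "h t \<le> 1" for t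
      using \<sigma>[of t] \<sigma>[of "t + 1"] \<sigma>0[of t] \<sigma>1[of "t + 1"] by (cases "t \<le> 0"; simp add: h_def)+
    show "(\<Sum>z\<in>{z::int. \<bar>real_of_int z - t\<bar> \<le> 1}. h (t - real_of_int z)) = 1" for t
    proof -
      define u where "u = t - real_of_int \<lfloor>t\<rfloor>"
      have u: "0 \<le> u" "u < 1"
        using floor_correct[of t] unfolding u_def by linarith+
      have fin: "finite {z::int. \<bar>real_of_int z - t\<bar> \<le> 1}"
        by (rule card_int_interval) simp
      have "(\<Sum>z\<in>{z::int. \<bar>real_of_int z - t\<bar> \<le> 1}. h (t - real_of_int z))
          = (\<Sum>z\<in>{\<lfloor>t\<rfloor>, \<lfloor>t\<rfloor> + 1}. h (t - real_of_int z))"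
      proof (rule sum.mono_neutral_right[OF fin])
        show "{\<lfloor>t\<rfloor>, \<lfloor>t\<rfloor> + 1} \<subseteq> {z::int. \<bar>real_of_int z - t\<bar> \<le> 1}"
        proof -
          have "\<bar>real_of_int \<lfloor>t\<rfloor> - t\<bar> \<le> 1" "\<bar>real_of_int (\<lfloor>t\<rfloor> + 1) - t\<bar> \<le> 1"
            using floor_correct[of t] by linarith+
          then show ?thesis
            by blast
        qed
        show "\<forall>z\<in>{z::int. \<bar>real_of_int z - t\<bar> \<le> 1} - {\<lfloor>t\<rfloor>, \<lfloor>t\<rfloor> + 1}. h (t - real_of_int z) = 0"
        proof
          fix z assume z: "z \<in> {z::int. \<bar>real_of_int z - t\<bar> \<le> 1} - {\<lfloor>t\<rfloor>, \<lfloor>t\<rfloor> + 1}"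
          then have "z < \<lfloor>t\<rfloor> \<or> z > \<lfloor>t\<rfloor> + 1"
            by auto
          then have "\<bar>t - real_of_int z\<bar> \<ge> 1"
            using u by (auto simp: u_def) linarith+
          then show "h (t - real_of_int z) = 0"
            by (rule supp)
        qed
      qed
      also have "\<dots> = h u + h (u - 1)"
        by (simp add: u_def algebra_simps)
      also have "\<dots> = 1"
        using u \<sigma>0[of "u - 1"] \<sigma>1[of "u + 1"] by (simp add: h_def)
      finally show ?thesis .
    qed
  qed
qed

section \<open>Smooth atoms from tensor products\<close>

lemma tensor_has_vector_derivative:
  fixes G :: "'n::finite \<Rightarrow> real \<Rightarrow> real" and x :: "real^'n"
  assumes "(G i has_real_derivative g) (at (x $ i))"
  shows "((\<lambda>t. complex_of_real (\<Prod>j\<in>UNIV. G j ((x + t *\<^sub>R axis i 1) $ j))) has_vector_derivative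
           complex_of_real (g * (\<Prod>j\<in>UNIV - {i}. G j (x $ j)))) (at 0)"
proof -
  have eq: "(\<Prod>j\<in>UNIV. G j ((x + t *\<^sub>R axis i 1) $ j)) = G i (x $ i + t) * (\<Prod>j\<in>UNIV - {i}. G j (x $ j))" for t
    by (subst prod.remove[of _ i]) (auto simp: axis_def intro!: prod.cong)
  have "((\<lambda>t. G i (x $ i + t)) has_real_derivative g) (at 0)"
    using assms DERIV_shift[of "G i" g 0 "x $ i"] by (simp add: add.commute)
  then have "((\<lambda>t. G i (x $ i + t) * (\<Prod>j\<in>UNIV - {i}. G j (x $ j))) has_real_derivative
      g * (\<Prod>j\<in>UNIV - {i}. G j (x $ j))) (at 0)"
    by (rule DERIV_cmult_right)
  then show ?thesis
    unfolding eq by (rule has_vector_derivative_of_real)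
qed

lemma tensor_sum_derivative:
  fixes H :: "'v \<Rightarrow> 'n::finite \<Rightarrow> real \<Rightarrow> real" and x :: "real^'n" and c :: "'v \<Rightarrow> complex"
  assumes C: "\<And>v i. v \<in> V \<Longrightarrow> Ck K (H v i)" and "length \<alpha> < K"
  shows "((\<lambda>t. \<Sum>v\<in>V. c v * complex_of_real (\<Prod>j\<in>UNIV. (deriv ^^ count_list \<alpha> j) (H v j) ((x + t *\<^sub>R axis i 1) $ j)))
      has_vector_derivative
      (\<Sum>v\<in>V. c v * complex_of_real (\<Prod>j\<in>UNIV. (deriv ^^ count_list (i # \<alpha>) j) (H v j) (x $ j)))) (at 0)"
proof (intro has_vector_derivative_sum has_vector_derivative_mult_right)
  fix v assume v: "v \<in> V"
  have "count_list \<alpha> i < K"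
    using count_le_length[of \<alpha> i] assms(2) by simp
  then have dv: "((deriv ^^ count_list \<alpha> i) (H v i) has_real_derivative (deriv ^^ Suc (count_list \<alpha> i)) (H v i) (x $ i)) (at (x $ i))"
    using C[OF v] by (intro Ck_deriv_iter_DERIV)
  have eq: "(\<Prod>j\<in>UNIV. (deriv ^^ count_list (i # \<alpha>) j) (H v j) (x $ j))
      = (deriv ^^ Suc (count_list \<alpha> i)) (H v i) (x $ i) * (\<Prod>j\<in>UNIV - {i}. (deriv ^^ count_list \<alpha> j) (H v j) (x $ j))"
  proof -
    have "(\<Prod>j\<in>UNIV - {i}. (deriv ^^ count_list (i # \<alpha>) j) (H v j) (x $ j))
        = (\<Prod>j\<in>UNIV - {i}. (deriv ^^ count_list \<alpha> j) (H v j) (x $ j))"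
      by (rule prod.cong) auto
    then show ?thesis
      by (subst prod.remove[of UNIV i]) auto
  qed
  from tensor_has_vector_derivative[of "\<lambda>j. (deriv ^^ count_list \<alpha> j) (H v j)", OF dv]
  show "((\<lambda>t. complex_of_real (\<Prod>j\<in>UNIV. (deriv ^^ count_list \<alpha> j) (H v j) ((x + t *\<^sub>R axis i 1) $ j)))
      has_vector_derivative
      complex_of_real (\<Prod>j\<in>UNIV. (deriv ^^ count_list (i # \<alpha>) j) (H v j) (x $ j))) (at 0)"
    unfolding eq .
qed

lemma iter_partial_tensor_sum:
  fixes H :: "'v \<Rightarrow> 'n::finite \<Rightarrow> real \<Rightarrow> real" and c :: "'v \<Rightarrow> complex"
  assumes C: "\<And>v i. v \<in> V \<Longrightarrow> Ck K (H v i)" and "length \<alpha> \<le> K"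
  shows "iter_partial \<alpha> (\<lambda>x::real^'n. \<Sum>v\<in>V. c v * complex_of_real (\<Prod>j\<in>UNIV. H v j (x $ j)))
     = (\<lambda>x. \<Sum>v\<in>V. c v * complex_of_real (\<Prod>j\<in>UNIV. (deriv ^^ count_list \<alpha> j) (H v j) (x $ j)))"
  using assms(2)
proof (induction \<alpha>)
  case Nil
  then show ?case by (simp add: iter_partial_def)
next
  case (Cons i \<alpha>)
  have "iter_partial (i # \<alpha>) (\<lambda>x::real^'n. \<Sum>v\<in>V. c v * complex_of_real (\<Prod>j\<in>UNIV. H v j (x $ j)))
     = partial_deriv i (\<lambda>x. \<Sum>v\<in>V. c v * complex_of_real (\<Prod>j\<in>UNIV. (deriv ^^ count_list \<alpha> j) (H v j) (x $ j)))"
    using Cons by (simp add: iter_partial_def)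
  also have "\<dots> = (\<lambda>x. \<Sum>v\<in>V. c v * complex_of_real (\<Prod>j\<in>UNIV. (deriv ^^ count_list (i # \<alpha>) j) (H v j) (x $ j)))"
    unfolding partial_deriv_def
    using Cons.prems by (intro ext vector_derivative_at tensor_sum_derivative[where H = H, OF C]) auto
  finally show ?case .
qed

lemma class_C_tensor_sum:
  fixes H :: "'v \<Rightarrow> 'n::finite \<Rightarrow> real \<Rightarrow> real" and c :: "'v \<Rightarrow> complex"
  assumes C: "\<And>v i. v \<in> V \<Longrightarrow> Ck K (H v i)"
  shows "class_C K (\<lambda>x::real^'n. \<Sum>v\<in>V. c v * complex_of_real (\<Prod>j\<in>UNIV. H v j (x $ j)))"
    (is "class_C K ?a")
proof -
  let ?d = "\<lambda>\<alpha> (x::real^'n). \<Sum>v\<in>V. c v * complex_of_real (\<Prod>j\<in>UNIV. (deriv ^^ count_list \<alpha> j) (H v j) (x $ j))"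
  have eq: "iter_partial \<alpha> ?a = ?d \<alpha>" if "length \<alpha> \<le> K" for \<alpha>
    using iter_partial_tensor_sum[where c = c and V = V and H = H, OF C that] by blast
  have cont: "continuous_on UNIV (\<lambda>x::real^'n. (deriv ^^ count_list \<alpha> j) (H v j) (x $ j))"
    if "v \<in> V" "length \<alpha> \<le> K" for v j \<alpha>
  proof -
    have "continuous_on UNIV ((deriv ^^ count_list \<alpha> j) (H v j))"
      using Ck_deriv_iter_continuous[OF C[OF that(1)], of "count_list \<alpha> j"] count_le_length[of \<alpha> j] that(2) by simp
    moreover have "continuous_on UNIV (\<lambda>x::real^'n. x $ j)"
      by (intro continuous_intros)
    ultimately show ?thesis
      by (rule continuous_on_compose2) simp
  qed
  have "continuous_on UNIV (?d \<alpha>)" if "length \<alpha> \<le> K" for \<alpha>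
    by (intro continuous_on_sum continuous_on_mult continuous_on_const continuous_on_of_real continuous_on_prod cont that)
  moreover have "(\<lambda>t. ?d \<alpha> (x + t *\<^sub>R axis i 1)) differentiable at 0" if "length \<alpha> < K" for \<alpha> i x
    using tensor_sum_derivative[where c = c and x = x and i = i and V = V and H = H, OF C that]
    by (rule differentiableI_vector)
  ultimately show ?thesis
    unfolding class_C_def by (auto simp only: eq less_imp_le)
qed

text \<open>
  The building blocks of all atoms: at scale \<open>2\<^bsup>-k\<^esup>\<close> the bump attached to the cube
  \<open>Q\<^bsub>k,l\<^esub>\<close> times a bump of twice that scale. Up to translation and dilation only finitely
  many such products occur, which makes the derivative bound \<open>D\<close> uniform.
\<close>

lemma atoms_from_bumps:
  obtains h :: "real \<Rightarrow> real" and D :: real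
  where "0 < D" "\<And>t. \<bar>t\<bar> \<ge> 1 \<Longrightarrow> h t = 0" "\<And>t. 0 \<le> h t" "\<And>t. h t \<le> 1"
    "\<And>t. (\<Sum>z\<in>{z::int. \<bar>real_of_int z - t\<bar> \<le> 1}. h (t - real_of_int z)) = 1"
    "\<And>(V :: (int^'n::finite) set) c k l d. 1 \<le> d \<Longrightarrow> D * (\<Sum>v\<in>V. cmod (c v)) \<le> 1 \<Longrightarrow>
      is_atom d K k l (\<lambda>x. \<Sum>v\<in>V. c v * complex_of_real
        (\<Prod>i\<in>UNIV. h (2 ^ k * x $ i - real_of_int (l $ i)) * h (2 ^ k / 2 * x $ i - real_of_int (v $ i))))"
proof -
  obtain h :: "real \<Rightarrow> real" where h: "Ck K h" "\<And>t. \<bar>t\<bar> \<ge> 1 \<Longrightarrow> h t = 0" "\<And>t. 0 \<le> h t" "\<And>t. h t \<le> 1"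
    "\<And>t. (\<Sum>z\<in>{z::int. \<bar>real_of_int z - t\<bar> \<le> 1}. h (t - real_of_int z)) = 1"
    using partition_of_unity_line by blast
  \<comment> \<open>In the variable \<open>y = 2\<^sup>k t - l\<close> the coarse bump with index \<open>v\<close> depends only on \<open>e = l - 2 v\<close>.\<close>
  define \<theta> where "\<theta> e y = h y * h (1 / 2 * y + real_of_int e / 2)" for e :: int and y :: real
  have C\<theta>: "Ck K (\<theta> e)" for e
    unfolding \<theta>_def[abs_def] by (intro Ck_mult Ck_affine h(1))
  have \<theta>0: "\<theta> e t = 0" if "\<bar>t\<bar> \<ge> 1" for e t
    using h(2)[OF that] by (simp add: \<theta>_def)
  have "\<exists>D. \<forall>i t. i \<le> K \<longrightarrow> \<bar>(deriv ^^ i) (\<theta> e) t\<bar> \<le> D" for e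
    using Ck_compact_support_bounded[OF C\<theta> \<theta>0] by metis
  then obtain D' where D': "\<And>e i t. i \<le> K \<Longrightarrow> \<bar>(deriv ^^ i) (\<theta> e) t\<bar> \<le> D' e"
    by metis
  have D'0: "0 \<le> D' e" for e
    using D'[of 0 e 0] abs_ge_zero order_trans by blast
  \<comment> \<open>For \<open>\<bar>e\<bar> \<ge> 3\<close> the product of the two bumps vanishes, so finitely many functions remain.\<close>
  define D1 where "D1 = (\<Sum>e\<in>{-3..3}. D' e) + 1"
  have D1: "\<bar>(deriv ^^ i) (\<theta> e) t\<bar> \<le> D1" if i: "i \<le> K" for e i t
  proof -
    have *: "\<bar>(deriv ^^ i) (\<theta> e) t\<bar> \<le> D1" if "e \<in> {-3..3}" for e
    proof -
      have "D' e \<le> (\<Sum>e\<in>{-3..3}. D' e)"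
        using that D'0 by (intro member_le_sum) auto
      then show ?thesis
        using D'[OF i, of e t] by (simp add: D1_def)
    qed
    show ?thesis
    proof (cases "e \<in> {-3..3}")
      case False
      have z: "\<theta> e = (\<lambda>t. 0)" if "\<bar>e\<bar> \<ge> 3" for e
      proof
        fix y
        show "\<theta> e y = 0"
        proof (cases "\<bar>y\<bar> \<ge> 1")
          case True
          then show ?thesis by (rule \<theta>0)
        next
          case False
          then have "\<bar>1 / 2 * y + real_of_int e / 2\<bar> \<ge> 1"
            using that by linarith
          then show ?thesis
            using h(2) by (simp add: \<theta>_def)
        qed
      qed
      have "\<bar>e\<bar> \<ge> 3"
        using False by (simp add: abs_if) linarith
      then have "\<theta> e = \<theta> 3"
        by (simp add: z)
      then show ?thesis
        using *[of 3] by simp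
    qed (rule *)
  qed
  have D1pos: "1 \<le> D1"
    using D'0 by (simp add: D1_def sum_nonneg)
  show ?thesis
  proof (rule that[of "D1 ^ CARD('n)" h, OF _ h(2-5)])
    show "0 < D1 ^ CARD('n)" using D1pos by simp
    fix V :: "(int^'n) set" and c k l and d :: real
    assume d: "1 \<le> d" and c: "D1 ^ CARD('n) * (\<Sum>v\<in>V. cmod (c v)) \<le> 1"
    define H where "H v i t = \<theta> (l $ i - 2 * v $ i) (2 ^ k * t + - real_of_int (l $ i))" for v :: "int^'n" and i t
    have CH: "Ck K (H v i)" for v i
      unfolding H_def[abs_def] by (intro Ck_affine C\<theta>)
    have Heq: "h (2 ^ k * t - real_of_int (l $ i)) * h (2 ^ k / 2 * t - real_of_int (v $ i)) = H v i t" for v i t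
    proof -
      have "1 / 2 * (2 ^ k * t + - real_of_int (l $ i)) + real_of_int (l $ i - 2 * v $ i) / 2 = 2 ^ k / 2 * t - real_of_int (v $ i)"
        by (simp add: field_simps)
      then show ?thesis
        unfolding H_def \<theta>_def by simp
    qed
    have Hb: "\<bar>(deriv ^^ r) (H v i) t\<bar> \<le> (2 ^ k) ^ r * D1" if "r \<le> K" for r v i t
    proof -
      have "\<bar>(deriv ^^ r) (H v i) t\<bar> = (2 ^ k) ^ r * \<bar>(deriv ^^ r) (\<theta> (l $ i - 2 * v $ i)) (2 ^ k * t + - real_of_int (l $ i))\<bar>"
        unfolding H_def[abs_def] deriv_iter_affine[OF C\<theta> that] by (simp add: abs_mult)
      also have "\<dots> \<le> (2 ^ k) ^ r * D1"
        by (intro mult_left_mono D1 that) auto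
      finally show ?thesis .
    qed
    let ?a = "\<lambda>x. \<Sum>v\<in>V. c v * complex_of_real (\<Prod>i\<in>UNIV. H v i (x $ i))"
    have "is_atom d K k l ?a"
      unfolding is_atom_def
    proof (intro conjI allI impI)
      show "class_C K ?a"
        by (intro class_C_tensor_sum CH)
      show "supp ?a \<subseteq> dcube d k l"
        unfolding supp_def
      proof (rule closure_minimal)
        show "closed (dcube d k l)"
          by (simp only: dcube_eq_cbox closed_cbox)
        show "{x. ?a x \<noteq> 0} \<subseteq> dcube d k l"
        proof
          fix x assume x: "x \<in> {x. ?a x \<noteq> 0}"
          have "\<not> (\<forall>v\<in>V. (\<Prod>i\<in>UNIV. H v i (x $ i)) = 0)"
          proof
            assume "\<forall>v\<in>V. (\<Prod>i\<in>UNIV. H v i (x $ i)) = 0"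
            then have "?a x = 0"
              by (intro sum.neutral) simp
            with x show False
              by blast
          qed
          then obtain v where "(\<Prod>i\<in>UNIV. H v i (x $ i)) \<noteq> 0"
            by blast
          then have ne: "H v i (x $ i) \<noteq> 0" for i
            by simp
          have "\<bar>real_of_int (l $ i) - 2 ^ k * x $ i\<bar> \<le> d" for i
          proof (rule ccontr)
            assume "\<not> ?thesis"
            then have "1 \<le> \<bar>2 ^ k * x $ i + - real_of_int (l $ i)\<bar>"
              using d by linarith
            then have "H v i (x $ i) = 0"
              unfolding H_def by (rule \<theta>0)
            with ne show False
              by blast
          qed
          then show "x \<in> dcube d k l"
            unfolding dcube_scaled by blast
        qed
      qed
      fix \<alpha> :: "'n list" and x :: "real^'n"
      assume \<alpha>: "length \<alpha> \<le> K"
      have "cmod (iter_partial \<alpha> ?a x) \<le> (\<Sum>v\<in>V. cmod (c v) * \<bar>\<Prod>j\<in>UNIV. (deriv ^^ count_list \<alpha> j) (H v j) (x $ j)\<bar>)"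
        unfolding iter_partial_tensor_sum[where H = H and V = V and c = c, OF CH \<alpha>]
        by (intro order_trans[OF norm_sum] sum_mono) (simp add: norm_mult del: of_real_prod)
      also have "\<dots> \<le> (\<Sum>v\<in>V. cmod (c v) * (2 ^ (length \<alpha> * k) * D1 ^ CARD('n)))"
      proof (intro sum_mono mult_left_mono)
        fix v
        have "\<bar>\<Prod>j\<in>UNIV. (deriv ^^ count_list \<alpha> j) (H v j) (x $ j)\<bar>
            \<le> (\<Prod>j\<in>UNIV. (2 ^ k) ^ count_list \<alpha> j * D1)"
          unfolding abs_prod using count_le_length[of \<alpha>] \<alpha>
          by (intro prod_mono conjI Hb) (auto intro: order_trans)
        also have "\<dots> = (2 ^ k) ^ (\<Sum>j\<in>UNIV. count_list \<alpha> j) * D1 ^ CARD('n)"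
          by (simp add: prod.distrib power_sum)
        also have "(\<Sum>j\<in>UNIV. count_list \<alpha> j) = length \<alpha>"
          by (intro sum_count_set) auto
        finally show "\<bar>\<Prod>j\<in>UNIV. (deriv ^^ count_list \<alpha> j) (H v j) (x $ j)\<bar> \<le> 2 ^ (length \<alpha> * k) * D1 ^ CARD('n)"
          by (simp add: power_mult[symmetric] mult.commute)
      qed auto
      also have "\<dots> = 2 ^ (length \<alpha> * k) * (D1 ^ CARD('n) * (\<Sum>v\<in>V. cmod (c v)))"
        by (simp add: sum_distrib_right sum_distrib_left ac_simps)
      also have "\<dots> \<le> 2 ^ (length \<alpha> * k) * 1"
        by (intro mult_left_mono c) auto
      finally show "cmod (iter_partial \<alpha> ?a x) \<le> 2 ^ (length \<alpha> * k)" by simp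
    qed
    then show "is_atom d K k l (\<lambda>x. \<Sum>v\<in>V. c v * complex_of_real
        (\<Prod>i\<in>UNIV. h (2 ^ k * x $ i - real_of_int (l $ i)) * h (2 ^ k / 2 * x $ i - real_of_int (v $ i))))"
      unfolding Heq .
  qed
qed

text \<open>
  The sum over all indices is the product of one sum for each coordinate.
\<close>

lemma tensor_partition_of_unity:
  fixes x :: "real^'n::finite" and r :: real
  assumes "\<And>t. (\<Sum>z\<in>{z::int. \<bar>real_of_int z - t\<bar> \<le> 1}. h (t - real_of_int z)) = (1::real)"
  shows "(\<Sum>l\<in>{l::int^'n. \<forall>i. \<bar>real_of_int (l $ i) - r * x $ i\<bar> \<le> 1}. \<Prod>i\<in>UNIV. h (r * x $ i - real_of_int (l $ i))) = 1"
proof -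
  define B where "B i = {z::int. \<bar>real_of_int z - r * x $ i\<bar> \<le> 1}" for i
  have fin: "finite (B i)" for i
    unfolding B_def by (rule card_int_interval) simp
  have "(\<Sum>l\<in>{l::int^'n. \<forall>i. \<bar>real_of_int (l $ i) - r * x $ i\<bar> \<le> 1}. \<Prod>i\<in>UNIV. h (r * x $ i - real_of_int (l $ i)))
      = (\<Sum>g\<in>PiE UNIV B. \<Prod>i\<in>UNIV. h (r * x $ i - real_of_int (g i)))"
    by (rule sum.reindex_bij_witness[of _ "\<lambda>g. \<chi> i. g i" "\<lambda>l i. l $ i"]) (auto simp: B_def PiE_UNIV_domain)
  also have "\<dots> = (\<Prod>i\<in>UNIV. \<Sum>z\<in>B i. h (r * x $ i - real_of_int z))"
    using fin by (subst prod_sum_PiE) auto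
  also have "\<dots> = 1"
    unfolding B_def assms by simp
  finally show ?thesis .
qed

section \<open>Lipschitz representations\<close>

text \<open>
  A weak substitute for an atomic representation. The pieces \<open>u j\<close> need to be defined only on
  \<open>\<Omega>\<close> and are merely Lipschitz at scale \<open>2\<^bsup>-j\<^esup>\<close>, both measured by the coefficients of the
  cubes that contain the point. The series converges pointwise almost everywhere. All three
  features are stable under bi-Lipschitz changes of variables; smoothness and convergence
  in \<open>L\<^sub>p\<close> are recovered afterwards.
\<close>

definition lip_rep :: "(real^'n) set \<Rightarrow> (real^'n \<Rightarrow> complex) \<Rightarrow>
    (nat \<Rightarrow> int^'n \<Rightarrow> real) \<Rightarrow> (nat \<Rightarrow> real^'n \<Rightarrow> complex) \<Rightarrow> bool" where
  "lip_rep \<Omega> f lam u \<longleftrightarrow>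
     (\<forall>j m. 0 \<le> lam j m) \<and>
     (\<forall>j. \<forall>x\<in>\<Omega>. cmod (u j x) \<le> cover_sum (lam j) j x) \<and>
     (\<forall>j. \<forall>x\<in>\<Omega>. \<forall>y\<in>\<Omega>. cmod (u j x - u j y)
        \<le> 2 ^ j * norm (x - y) * (cover_sum (lam j) j x + cover_sum (lam j) j y)) \<and>
     (AE x in lebesgue_on \<Omega>. (\<lambda>j. u j x) sums f x)"

definition lip_qnorm :: "real \<Rightarrow> ennreal \<Rightarrow> ennreal \<Rightarrow> (real^'n) set \<Rightarrow> (real^'n \<Rightarrow> complex) \<Rightarrow> ennreal" where
  "lip_qnorm s p q \<Omega> f = Inf {coef_qnorm s p q lam | lam u. lip_rep \<Omega> f lam u}"

lemma lip_qnorm_le: "lip_rep \<Omega> f lam u \<Longrightarrow> lip_qnorm s p q \<Omega> f \<le> coef_qnorm s p q lam"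
  unfolding lip_qnorm_def by (rule Inf_lower) auto

lemma ennreal_le_mult_Inf:
  fixes a :: ennreal
  assumes "0 < C" "\<And>b. b \<in> S \<Longrightarrow> a \<le> ennreal C * b"
  shows "a \<le> ennreal C * Inf S"
proof -
  have inv: "ennreal (1 / C) * (ennreal C * b) = b" "ennreal C * (ennreal (1 / C) * b) = b" for b
  proof -
    have "ennreal (1 / C) * ennreal C = 1" "ennreal C * ennreal (1 / C) = 1"
      using assms(1) by (simp_all flip: ennreal_mult)
    then show "ennreal (1 / C) * (ennreal C * b) = b" "ennreal C * (ennreal (1 / C) * b) = b"
      by (simp_all flip: mult.assoc)
  qed
  have "ennreal (1 / C) * a \<le> Inf S"
  proof (rule Inf_greatest)
    fix b assume "b \<in> S"
    then have "ennreal (1 / C) * a \<le> ennreal (1 / C) * (ennreal C * b)"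
      using assms(2) by (intro mult_left_mono) auto
    then show "ennreal (1 / C) * a \<le> b"
      by (simp only: inv)
  qed
  then have "ennreal C * (ennreal (1 / C) * a) \<le> ennreal C * Inf S"
    by (intro mult_left_mono) auto
  then show ?thesis
    by (simp only: inv)
qed

lemma measurable_lebesgue_on_AE:
  fixes f g :: "real^'n::finite \<Rightarrow> 'b::euclidean_space"
  assumes "\<Omega> \<in> sets lebesgue" "f \<in> borel_measurable (lebesgue_on \<Omega>)" "AE x in lebesgue_on \<Omega>. f x = g x"
  shows "g \<in> borel_measurable (lebesgue_on \<Omega>)"
proof -
  have "(\<lambda>x. if x \<in> \<Omega> then f x else 0) \<in> borel_measurable lebesgue"
    using assms(1,2) by (simp add: borel_measurable_if)
  moreover have "AE x in lebesgue. (if x \<in> \<Omega> then f x else 0) = (if x \<in> \<Omega> then g x else 0)"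
    using assms(1,3) by (subst (asm) AE_restrict_space_iff) (auto elim: eventually_mono)
  ultimately have "(\<lambda>x. if x \<in> \<Omega> then g x else 0) \<in> borel_measurable lebesgue"
    by (rule borel_measurable_AE)
  then show ?thesis
    using assms(1) by (simp add: borel_measurable_if)
qed

lemma measurable_AE_sums:
  fixes f :: "real^'n::finite \<Rightarrow> complex"
  assumes "\<Omega> \<in> sets lebesgue" and [measurable]: "\<And>k. g k \<in> borel_measurable (lebesgue_on \<Omega>)"
    and "AE x in lebesgue_on \<Omega>. (\<lambda>k. g k x) sums f x"
  shows "f \<in> borel_measurable (lebesgue_on \<Omega>)"
proof (rule measurable_lebesgue_on_AE[OF assms(1)])
  show "(\<lambda>x. lim (\<lambda>n. \<Sum>k<n. g k x)) \<in> borel_measurable (lebesgue_on \<Omega>)"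
    by measurable
  show "AE x in lebesgue_on \<Omega>. lim (\<lambda>n. \<Sum>k<n. g k x) = f x"
    using assms(3) by eventually_elim (auto simp: sums_def intro: limI)
qed

lemma norm_tail_le:
  fixes g :: "nat \<Rightarrow> complex"
  assumes "g sums f" "\<And>k. cmod (g k) \<le> M k"
  shows "ennreal (cmod (f - (\<Sum>k<J. g k))) \<le> (\<Sum>k. if J \<le> k then ennreal (M k) else 0)"
proof -
  have M: "0 \<le> M k" for k
    using assms(2)[of k] norm_ge_zero order_trans by blast
  have "(\<lambda>n. \<Sum>k<n. g k) \<longlonglongrightarrow> f"
    using assms(1) by (simp add: sums_def)
  then have lim: "(\<lambda>n. ennreal (cmod ((\<Sum>k<n. g k) - (\<Sum>k<J. g k)))) \<longlonglongrightarrow> ennreal (cmod (f - (\<Sum>k<J. g k)))"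
    by (intro tendsto_intros)
  have bd: "ennreal (cmod ((\<Sum>k<n. g k) - (\<Sum>k<J. g k))) \<le> (\<Sum>k. if J \<le> k then ennreal (M k) else 0)"
    if "n \<ge> J" for n
  proof -
    have "(\<Sum>k<n. g k) - (\<Sum>k<J. g k) = (\<Sum>k\<in>{J..<n}. g k)"
      using that by (simp add: sum_diff_nat_ivl[of 0 J n g, symmetric] atLeast0LessThan)
    then have "cmod ((\<Sum>k<n. g k) - (\<Sum>k<J. g k)) \<le> (\<Sum>k\<in>{J..<n}. M k)"
      using assms(2) by (simp add: sum_norm_le)
    then have "ennreal (cmod ((\<Sum>k<n. g k) - (\<Sum>k<J. g k))) \<le> ennreal (\<Sum>k\<in>{J..<n}. M k)"
      by (rule ennreal_leI)
    also have "\<dots> = (\<Sum>k\<in>{J..<n}. if J \<le> k then ennreal (M k) else 0)"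
      using M by (subst sum_ennreal[symmetric]) auto
    also have "\<dots> \<le> (\<Sum>k. if J \<le> k then ennreal (M k) else 0)"
      by (intro sum_le_suminf) auto
    finally show ?thesis .
  qed
  show ?thesis
    by (rule LIMSEQ_le_const2[OF lim]) (intro exI[of _ J] allI impI bd)
qed

text \<open>
  The tail estimate \<open>cover_sum_tail\<close> is used here in two ways: from level \<open>0\<close> on it shows that the
  series of the cube sums is finite almost everywhere, and from level \<open>J\<close> on, with
  \<open>J \<rightarrow> \<infinity>\<close>, it dominates the remainders of every smaller series.
\<close>

lemma cover_sum_AE_summable:
  fixes lam :: "nat \<Rightarrow> int^'n::finite \<Rightarrow> real"
  assumes "0 < p" "0 < q" "0 < s" "\<Omega> \<in> sets lebesgue" "\<And>j m. 0 \<le> lam j m" "coef_qnorm s p q lam < \<infinity>"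
  shows "AE x in lebesgue_on \<Omega>. summable (\<lambda>j. cover_sum (lam j) j x)"
proof -
  obtain C :: real where C: "0 < C"
    "\<And>(\<Omega> :: (real^'n) set) lam J. \<Omega> \<in> sets lebesgue \<Longrightarrow> (\<And>j m. 0 \<le> lam j m) \<Longrightarrow>
      Lp_qnorm p (lebesgue_on \<Omega>) (\<lambda>x. \<Sum>j. if J \<le> j then ennreal (cover_sum (lam j) j x) else 0)
        \<le> ennreal (C * 2 powr (- (real J * s / 2))) * coef_qnorm s p q lam"
    "\<And>(\<Omega> :: (real^'n) set) lam j. \<Omega> \<in> sets lebesgue \<Longrightarrow> (\<And>j m. 0 \<le> lam j m) \<Longrightarrow>
      (\<lambda>x. ennreal (cover_sum (lam j) j x)) \<in> borel_measurable (lebesgue_on \<Omega>)"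
    using cover_sum_tail[OF assms(1-3)] by blast
  note [measurable] = C(3)[where lam = lam, OF assms(4,5)]
  have "Lp_qnorm p (lebesgue_on \<Omega>) (\<lambda>x. \<Sum>j. ennreal (cover_sum (lam j) j x)) \<le> ennreal C * coef_qnorm s p q lam"
    using C(2)[where J = 0 and lam = lam, OF assms(4,5)] by simp
  also have "\<dots> < \<infinity>"
    using assms(6) by (simp add: ennreal_mult_less_top)
  finally have "AE x in lebesgue_on \<Omega>. (\<Sum>j. ennreal (cover_sum (lam j) j x)) < \<infinity>"
    by (intro Lp_qnorm_finite_AE[OF assms(1)]) auto
  then show ?thesis
    by eventually_elim (auto intro!: summable_suminf_not_top cover_sum_nonneg assms(5))
qed

lemma Lp_convergence_of_dominated_sums:
  fixes f :: "real^'n::finite \<Rightarrow> complex"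
  assumes "0 < p" "0 < q" "0 < s" "\<Omega> \<in> sets lebesgue" "\<And>j m. 0 \<le> lam j m" "coef_qnorm s p q lam < \<infinity>"
    and g [measurable]: "\<And>k. g k \<in> borel_measurable (lebesgue_on \<Omega>)"
    and bound: "\<And>k x. x \<in> \<Omega> \<Longrightarrow> cmod (g k x) \<le> cover_sum (lam k) k x"
    and sums: "AE x in lebesgue_on \<Omega>. (\<lambda>k. g k x) sums f x"
  shows "(\<lambda>J. Lp_qnorm p (lebesgue_on \<Omega>) (\<lambda>x. ennreal (cmod (f x - (\<Sum>k<J. g k x))))) \<longlonglongrightarrow> 0"
proof -
  obtain C :: real where C: "0 < C"
    "\<And>(\<Omega> :: (real^'n) set) lam J. \<Omega> \<in> sets lebesgue \<Longrightarrow> (\<And>j m. 0 \<le> lam j m) \<Longrightarrow>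
      Lp_qnorm p (lebesgue_on \<Omega>) (\<lambda>x. \<Sum>j. if J \<le> j then ennreal (cover_sum (lam j) j x) else 0)
        \<le> ennreal (C * 2 powr (- (real J * s / 2))) * coef_qnorm s p q lam"
    "\<And>(\<Omega> :: (real^'n) set) lam j. \<Omega> \<in> sets lebesgue \<Longrightarrow> (\<And>j m. 0 \<le> lam j m) \<Longrightarrow>
      (\<lambda>x. ennreal (cover_sum (lam j) j x)) \<in> borel_measurable (lebesgue_on \<Omega>)"
    using cover_sum_tail[OF assms(1-3)] by blast
  have [measurable]: "f \<in> borel_measurable (lebesgue_on \<Omega>)"
    by (rule measurable_AE_sums[OF assms(4) g sums])
  have AE\<Omega>: "AE x in lebesgue_on \<Omega>. x \<in> \<Omega>"
    by (rule AE_I2) simp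
  obtain N where N: "coef_qnorm s p q lam = ennreal N" "0 \<le> N"
    using assms(6) by (cases "coef_qnorm s p q lam") auto
  have le: "Lp_qnorm p (lebesgue_on \<Omega>) (\<lambda>x. ennreal (cmod (f x - (\<Sum>k<J. g k x))))
      \<le> ennreal (C * 2 powr (- (real J * s / 2)) * N)" for J
  proof -
    have "Lp_qnorm p (lebesgue_on \<Omega>) (\<lambda>x. ennreal (cmod (f x - (\<Sum>k<J. g k x))))
        \<le> Lp_qnorm p (lebesgue_on \<Omega>) (\<lambda>x. \<Sum>j. if J \<le> j then ennreal (cover_sum (lam j) j x) else 0)"
    proof (rule Lp_qnorm_mono_AE[OF assms(1)])
      show "AE x in lebesgue_on \<Omega>. ennreal (cmod (f x - (\<Sum>k<J. g k x)))
          \<le> (\<Sum>j. if J \<le> j then ennreal (cover_sum (lam j) j x) else 0)"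
        using sums AE\<Omega> by eventually_elim (rule norm_tail_le, auto intro: bound)
    qed measurable
    also have "\<dots> \<le> ennreal (C * 2 powr (- (real J * s / 2))) * ennreal N"
      using C(2)[where J = J and lam = lam, OF assms(4,5)] by (simp add: N)
    finally show ?thesis
      using C(1) N by (simp flip: ennreal_mult)
  qed
  have "(\<lambda>J. (2 powr (- (s / 2))) ^ J) \<longlonglongrightarrow> 0"
    using assms(3) powr_less_mono[of "- (s / 2)" 0 2] by (intro LIMSEQ_power_zero) simp
  also have "(\<lambda>J. (2 powr (- (s / 2))) ^ J) = (\<lambda>J. 2 powr (- (real J * s / 2)))"
    by (simp add: fun_eq_iff powr_realpow[symmetric] powr_powr mult.commute)
  finally have "(\<lambda>J. ennreal (C * 2 powr (- (real J * s / 2)) * N)) \<longlonglongrightarrow> ennreal (C * 0 * N)"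
    by (intro tendsto_intros)
  then have lim: "(\<lambda>J. ennreal (C * 2 powr (- (real J * s / 2)) * N)) \<longlonglongrightarrow> 0"
    by simp
  show ?thesis
    by (rule tendsto_sandwich[OF _ _ tendsto_const lim]) (simp_all only: le zero_le eventually_True)
qed

lemma cover_sum_locally_bounded:
  fixes x :: "real^'n::finite"
  assumes "\<And>m. 0 \<le> c m"
  obtains S where "\<And>y. norm (y - x) \<le> 1 / 2 ^ j \<Longrightarrow> cover_sum c j y \<le> S"
proof -
  define N where "N = {m::int^'n. \<forall>i. \<bar>real_of_int (m $ i) - 2 ^ j * x $ i\<bar> \<le> 2}"
  have fin: "finite N"
    unfolding N_def by (rule card_int_box) simp
  show ?thesis
  proof (rule that)
    fix y assume y: "norm (y - x) \<le> 1 / 2 ^ j"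
    have "cubes_at j y \<subseteq> N"
    proof
      fix m assume m: "m \<in> cubes_at j y"
      have "\<bar>real_of_int (m $ i) - 2 ^ j * x $ i\<bar> \<le> 2" for i
      proof -
        have "\<bar>y $ i - x $ i\<bar> \<le> 1 / 2 ^ j"
          using component_le_norm_cart[of "y - x" i] y by simp
        then have "2 ^ j * \<bar>y $ i - x $ i\<bar> \<le> 1"
          by (simp add: field_simps)
        then have "\<bar>2 ^ j * y $ i - 2 ^ j * x $ i\<bar> \<le> 1"
          by (simp add: abs_mult flip: right_diff_distrib)
        moreover have "\<bar>real_of_int (m $ i) - 2 ^ j * y $ i\<bar> \<le> 1"
          using m by (simp add: cubes_at_def dcube_scaled)
        ultimately show ?thesis by linarith
      qed
      then show "m \<in> N" by (simp add: N_def)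
    qed
    then show "cover_sum c j y \<le> (\<Sum>m\<in>N. c m)"
      unfolding cover_sum_def using fin assms by (intro sum_mono2) auto
  qed
qed

text \<open>
  Near a given point only finitely many cubes of level \<open>j\<close> matter, so the bound is a local
  Lipschitz condition. In particular the pieces are measurable, and so is their sum.
\<close>

lemma lip_bound_continuous_on:
  fixes u :: "real^'n::finite \<Rightarrow> complex"
  assumes c: "\<And>m. 0 \<le> c m"
    and lip: "\<And>x y. x \<in> \<Omega> \<Longrightarrow> y \<in> \<Omega> \<Longrightarrow> cmod (u x - u y) \<le> 2 ^ j * norm (x - y) * (cover_sum c j x + cover_sum c j y)"
  shows "continuous_on \<Omega> u"
  unfolding continuous_on_def
proof
  fix x assume x: "x \<in> \<Omega>"
  obtain S where S: "\<And>y. norm (y - x) \<le> 1 / 2 ^ j \<Longrightarrow> cover_sum c j y \<le> S"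
    using cover_sum_locally_bounded[where c = c and x = x and j = j, OF c] by blast
  have ev: "\<forall>\<^sub>F y in at x within \<Omega>. norm (u y - u x) \<le> 2 ^ j * norm (y - x) * (S + S)"
    unfolding eventually_at
  proof (intro exI[of _ "1 / 2 ^ j"] conjI ballI impI)
    fix y assume y: "y \<in> \<Omega>" "y \<noteq> x \<and> dist y x < 1 / 2 ^ j"
    have "cover_sum c j y \<le> S" "cover_sum c j x \<le> S"
      using S[of y] S[of x] y by (auto simp: dist_norm)
    then show "norm (u y - u x) \<le> 2 ^ j * norm (y - x) * (S + S)"
      using lip[OF y(1) x] by (intro order_trans[OF lip[OF y(1) x]] mult_left_mono add_mono) auto
  qed simp
  have lim: "((\<lambda>y. 2 ^ j * norm (y - x) * (S + S)) \<longlongrightarrow> 2 ^ j * norm (x - x) * (S + S)) (at x within \<Omega>)"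
    by (intro tendsto_intros)
  have "((\<lambda>y. u y - u x) \<longlongrightarrow> 0) (at x within \<Omega>)"
    by (rule Lim_null_comparison[OF ev]) (use lim in simp)
  then show "(u \<longlongrightarrow> u x) (at x within \<Omega>)"
    by (rule LIM_zero_cancel)
qed

lemma lip_rep_measurable:
  fixes f :: "real^'n::finite \<Rightarrow> complex"
  assumes "\<Omega> \<in> sets lebesgue" "lip_rep \<Omega> f lam u"
  shows "u j \<in> borel_measurable (lebesgue_on \<Omega>)" and "f \<in> borel_measurable (lebesgue_on \<Omega>)"
proof -
  show u: "u j \<in> borel_measurable (lebesgue_on \<Omega>)" for j
  proof (rule continuous_imp_measurable_on_sets_lebesgue[OF _ assms(1)])
    show "continuous_on \<Omega> (u j)"
      using assms(2) by (intro lip_bound_continuous_on[where c = "lam j" and j = j]) (simp_all add: lip_rep_def)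
  qed
  show "f \<in> borel_measurable (lebesgue_on \<Omega>)"
    using assms(2) unfolding lip_rep_def by (intro measurable_AE_sums[OF assms(1) u]) auto
qed

text \<open>
  The tail estimate from level \<open>0\<close> on bounds the \<open>L\<^sub>p\<close> quasi-norm by the intermediate one.
\<close>

lemma lip_qnorm_eq_0_AE:
  fixes f :: "real^'n::finite \<Rightarrow> complex"
  assumes "0 < p" "0 < q" "0 < s" "\<Omega> \<in> sets lebesgue" "lip_qnorm s p q \<Omega> f = 0"
  shows "AE x in lebesgue_on \<Omega>. f x = 0"
proof -
  obtain C :: real where C: "0 < C"
    "\<And>(\<Omega> :: (real^'n) set) lam J. \<Omega> \<in> sets lebesgue \<Longrightarrow> (\<And>j m. 0 \<le> lam j m) \<Longrightarrow>
      Lp_qnorm p (lebesgue_on \<Omega>) (\<lambda>x. \<Sum>j. if J \<le> j then ennreal (cover_sum (lam j) j x) else 0)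
        \<le> ennreal (C * 2 powr (- (real J * s / 2))) * coef_qnorm s p q lam"
    "\<And>(\<Omega> :: (real^'n) set) lam j. \<Omega> \<in> sets lebesgue \<Longrightarrow> (\<And>j m. 0 \<le> lam j m) \<Longrightarrow>
      (\<lambda>x. ennreal (cover_sum (lam j) j x)) \<in> borel_measurable (lebesgue_on \<Omega>)"
    using cover_sum_tail[OF assms(1-3)] by blast
  obtain lam0 u0 where r0: "lip_rep \<Omega> f lam0 u0"
  proof -
    have "Inf {coef_qnorm s p q lam | lam u. lip_rep \<Omega> f lam u} < 1"
      using assms(5) by (simp add: lip_qnorm_def)
    then show ?thesis
      using that unfolding Inf_less_iff by blast
  qed
  have fm: "f \<in> borel_measurable (lebesgue_on \<Omega>)"
    by (rule lip_rep_measurable(2)[OF assms(4) r0])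
  note [measurable] = fm
  have AE\<Omega>: "AE x in lebesgue_on \<Omega>. x \<in> \<Omega>"
    by (rule AE_I2) simp
  have "Lp_qnorm p (lebesgue_on \<Omega>) (\<lambda>x. ennreal (cmod (f x))) \<le> ennreal C * lip_qnorm s p q \<Omega> f"
    unfolding lip_qnorm_def
  proof (rule ennreal_le_mult_Inf[OF C(1)])
    fix b assume "b \<in> {coef_qnorm s p q lam | lam u. lip_rep \<Omega> f lam u}"
    then obtain lam u where r: "lip_rep \<Omega> f lam u" and b: "b = coef_qnorm s p q lam"
      by auto
    have "Lp_qnorm p (lebesgue_on \<Omega>) (\<lambda>x. ennreal (cmod (f x)))
        \<le> Lp_qnorm p (lebesgue_on \<Omega>) (\<lambda>x. \<Sum>j. if 0 \<le> j then ennreal (cover_sum (lam j) j x) else 0)"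
    proof (rule Lp_qnorm_mono_AE[OF assms(1)])
      have "AE x in lebesgue_on \<Omega>. (\<lambda>j. u j x) sums f x"
        using r by (simp add: lip_rep_def)
      with AE\<Omega> show "AE x in lebesgue_on \<Omega>. ennreal (cmod (f x))
          \<le> (\<Sum>j. if 0 \<le> j then ennreal (cover_sum (lam j) j x) else 0)"
      proof eventually_elim
        case (elim x)
        then show ?case
          using norm_tail_le[of "\<lambda>j. u j x" "f x" "\<lambda>j. cover_sum (lam j) j x" 0] r by (simp add: lip_rep_def)
      qed
    qed measurable
    also have "\<dots> \<le> ennreal C * coef_qnorm s p q lam"
      using C(2)[OF assms(4), where J = 0 and lam = lam] r by (simp add: lip_rep_def)
    finally show "Lp_qnorm p (lebesgue_on \<Omega>) (\<lambda>x. ennreal (cmod (f x))) \<le> ennreal C * b"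
      by (simp add: b)
  qed
  then have "Lp_qnorm p (lebesgue_on \<Omega>) (\<lambda>x. ennreal (cmod (f x))) = 0"
    using assms(5) by simp
  then have "AE x in lebesgue_on \<Omega>. ennreal (cmod (f x)) = 0"
    by (intro Lp_qnorm_eq_0_AE[OF assms(1)]) auto
  then show ?thesis
    by eventually_elim simp
qed

section \<open>Atomic representations are Lipschitz representations\<close>

text \<open>
  The point is moved in one coordinate at a time, and the mean value inequality applies on each
  segment.
\<close>

lemma bounded_partials_imp_lipschitz:
  fixes f :: "real^'n::finite \<Rightarrow> 'b::real_normed_vector"
  assumes diff: "\<And>x i. (\<lambda>t. f (x + t *\<^sub>R axis i 1)) differentiable at 0"
    and B: "\<And>x i. norm (partial_deriv i f x) \<le> B"
  shows "norm (f x - f y) \<le> real CARD('n) * B * norm (x - y)"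
proof -
  have B0: "0 \<le> B"
    using B[of undefined undefined] norm_ge_zero order_trans by blast
  have line: "norm (f (x + t *\<^sub>R axis i 1) - f x) \<le> B * \<bar>t\<bar>" for x t i
  proof -
    have "((\<lambda>t. f (x + t *\<^sub>R axis i 1)) has_derivative (\<lambda>h. h *\<^sub>R partial_deriv i f (x + \<tau> *\<^sub>R axis i 1))) (at \<tau> within UNIV)" for \<tau>
    proof -
      have "((\<lambda>t. f (x + \<tau> *\<^sub>R axis i 1 + t *\<^sub>R axis i 1)) has_vector_derivative partial_deriv i f (x + \<tau> *\<^sub>R axis i 1)) (at (\<tau> - \<tau>))"
        using diff[of "x + \<tau> *\<^sub>R axis i 1" i] unfolding partial_deriv_def
        by (simp add: vector_derivative_works)
      moreover have "((\<lambda>t. t - \<tau>) has_vector_derivative 1) (at \<tau>)"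
        by (auto intro!: derivative_eq_intros)
      ultimately have "((\<lambda>t. f (x + \<tau> *\<^sub>R axis i 1 + t *\<^sub>R axis i 1)) \<circ> (\<lambda>t. t - \<tau>) has_vector_derivative
          1 *\<^sub>R partial_deriv i f (x + \<tau> *\<^sub>R axis i 1)) (at \<tau>)"
        by (rule vector_diff_chain_at[rotated])
      moreover have "(\<lambda>t. f (x + \<tau> *\<^sub>R axis i 1 + t *\<^sub>R axis i 1)) \<circ> (\<lambda>t. t - \<tau>) = (\<lambda>t. f (x + t *\<^sub>R axis i 1))"
        by (auto simp: fun_eq_iff algebra_simps)
      ultimately show ?thesis
        by (simp add: has_vector_derivative_def)
    qed
    moreover have "onorm (\<lambda>h. h *\<^sub>R partial_deriv i f (x + \<tau> *\<^sub>R axis i 1)) \<le> B" for \<tau>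
      using B[of i "x + \<tau> *\<^sub>R axis i 1"] B0 by (intro onorm_bound) (auto simp: mult.commute[of B] intro: mult_left_mono)
    ultimately have "norm (f (x + t *\<^sub>R axis i 1) - f (x + 0 *\<^sub>R axis i 1)) \<le> B * norm (t - 0)"
      by (intro differentiable_bound[OF convex_UNIV, where f = "\<lambda>t. f (x + t *\<^sub>R axis i 1)"]) auto
    then show ?thesis
      by simp
  qed
  define P where "P S = (\<chi> i. if i \<in> S then x $ i else y $ i)" for S
  have "norm (f (P S) - f y) \<le> B * (\<Sum>i\<in>S. \<bar>x $ i - y $ i\<bar>)" if "finite S" for S
    using that
  proof (induction S)
    case empty
    then show ?case by (simp add: P_def vec_lambda_eta)
  next
    case (insert i S)
    have "P (insert i S) = P S + (x $ i - y $ i) *\<^sub>R axis i 1"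
      using insert(2) by (auto simp: P_def vec_eq_iff axis_def)
    then have "norm (f (P (insert i S)) - f (P S)) \<le> B * \<bar>x $ i - y $ i\<bar>"
      using line by simp
    then have "norm (f (P (insert i S)) - f y) \<le> B * \<bar>x $ i - y $ i\<bar> + B * (\<Sum>i\<in>S. \<bar>x $ i - y $ i\<bar>)"
      using insert(3) norm_triangle_ineq[of "f (P (insert i S)) - f (P S)" "f (P S) - f y"] by simp
    then show ?case
      using insert(1,2) by (simp add: distrib_left)
  qed
  from this[of UNIV] have "norm (f x - f y) \<le> B * (\<Sum>i\<in>UNIV. \<bar>x $ i - y $ i\<bar>)"
    by (simp add: P_def vec_lambda_eta)
  also have "(\<Sum>i\<in>UNIV. \<bar>x $ i - y $ i\<bar>) \<le> (\<Sum>i\<in>(UNIV :: 'n set). norm (x - y))"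
    using component_le_norm_cart[of "x - y"] by (intro sum_mono) simp
  finally show ?thesis
    using B0 by (simp add: mult_left_mono mult.assoc mult.left_commute)
qed

lemma is_atom_lipschitz:
  fixes a :: "real^'n::finite \<Rightarrow> complex"
  assumes "is_atom d K j m a" "1 \<le> K"
  shows "cmod (a x) \<le> 1" and "cmod (a x - a y) \<le> real CARD('n) * 2 ^ j * norm (x - y)"
    and "x \<notin> dcube d j m \<Longrightarrow> a x = 0"
proof -
  have it: "iter_partial [] a = a" "iter_partial [i] a = partial_deriv i a" for i
    by (simp_all add: iter_partial_def)
  have b: "cmod (iter_partial \<alpha> a x) \<le> 2 ^ (length \<alpha> * j)" if "length \<alpha> \<le> K" for \<alpha> x
    using assms(1) that by (simp add: is_atom_def)
  show "cmod (a x) \<le> 1"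
    using b[of "[]" x] by (simp add: it)
  have "(\<lambda>t. iter_partial [] a (x + t *\<^sub>R axis i 1)) differentiable at 0" for x i
    using assms unfolding is_atom_def class_C_def by auto
  moreover have "cmod (partial_deriv i a x) \<le> 2 ^ j" for i x
    using b[of "[i]" x] assms(2) by (simp add: it)
  ultimately show "cmod (a x - a y) \<le> real CARD('n) * 2 ^ j * norm (x - y)"
    by (intro bounded_partials_imp_lipschitz) (simp_all add: it)
  show "a x = 0" if "x \<notin> dcube d j m"
    using that assms(1) closure_subset[of "{x. a x \<noteq> 0}"] by (auto simp: is_atom_def supp_def)
qed

text \<open>
  Convergence in \<open>L\<^sub>p\<close> is converted to convergence almost everywhere: the dominated
  series converges to some function both almost everywhere and in \<open>L\<^sub>p\<close>, and limits
  in \<open>L\<^sub>p\<close> are unique. The enlarged supports \<open>dQ\<^bsub>j,m\<^esub>\<close> are absorbed by summing the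
  coefficients of neighbouring cubes.
\<close>

lemma lip_qnorm_le_besov_qnorm:
  assumes "0 < p" "0 < q" "0 < s" "0 < d" "1 \<le> K"
  obtains C :: real where "0 < C"
    "\<And>(\<Omega> :: (real^'n::finite) set) f. \<Omega> \<in> sets lebesgue \<Longrightarrow> f \<in> borel_measurable (lebesgue_on \<Omega>) \<Longrightarrow>
       lip_qnorm s p q \<Omega> f \<le> ennreal C * besov_qnorm d K s p q \<Omega> f"
proof -
  define n where "n = real CARD('n)"
  have n1: "1 \<le> n"
    by (simp add: n_def Suc_le_eq)
  define b where "b = nat \<lceil>(2 * (d + 1) + 1) ^ CARD('n)\<rceil>"
  have b: "(2 * (d + 1) + 1) ^ CARD('n) \<le> real b"
    unfolding b_def by (rule real_nat_ceiling_ge)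
  have b0: "0 < b"
  proof -
    have "0 < (2 * (d + 1) + 1) ^ CARD('n)"
      using assms(4) by simp
    then show ?thesis using b by simp
  qed
  define box where "box m = {m'::int^'n. \<forall>i. \<bar>real_of_int (m' $ i) - real_of_int (m $ i)\<bar> \<le> d + 1}" for m
  have box: "finite (box m)" "card (box m) \<le> b" for m
  proof -
    show "finite (box m)"
      unfolding box_def using assms(4) by (intro card_int_box) simp
    have "real (card (box m)) \<le> (2 * (d + 1) + 1) ^ CARD('n)"
      unfolding box_def using assms(4) by (intro card_int_box) simp
    then show "card (box m) \<le> b" using b by linarith
  qed
  define C where "C = n * (real b * real b powr (1 / enn2real p))"
  have C: "0 < C"
    using n1 b0 by (simp add: C_def)
  obtain Cadd :: real where Cadd: "0 < Cadd"
    "\<And>(M :: (real^'n) measure) g h. g \<in> borel_measurable M \<Longrightarrow> h \<in> borel_measurable M \<Longrightarrow>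
       Lp_qnorm p M (\<lambda>x. g x + h x) \<le> ennreal Cadd * (Lp_qnorm p M g + Lp_qnorm p M h)"
    using Lp_qnorm_add[OF assms(1)] by blast
  show ?thesis
  proof (rule that[OF C])
    fix \<Omega> :: "(real^'n) set" and f :: "real^'n \<Rightarrow> complex"
    assume \<Omega>: "\<Omega> \<in> sets lebesgue" and f [measurable]: "f \<in> borel_measurable (lebesgue_on \<Omega>)"
    show "lip_qnorm s p q \<Omega> f \<le> ennreal C * besov_qnorm d K s p q \<Omega> f"
      unfolding besov_qnorm_def
    proof (rule ennreal_le_mult_Inf[OF C])
      fix t assume "t \<in> {b_qnorm s p q \<Omega> lam |lam a. atomic_rep d K p \<Omega> f lam a}"
      then obtain lam a where rep: "atomic_rep d K p \<Omega> f lam a" and t: "t = b_qnorm s p q \<Omega> lam"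
        by auto
      show "lip_qnorm s p q \<Omega> f \<le> ennreal C * t"
      proof (cases "t = \<infinity>")
        case True
        then show ?thesis using C by (simp add: ennreal_mult_top)
      next
        case False
        define I where "I j = cube_indices \<Omega> j" for j
        define R where "R j m = box m \<inter> I j" for j m
        \<comment> \<open>The factor \<open>n\<close> is the Lipschitz constant from \<open>is_atom_lipschitz\<close>.\<close>
        define mu where "mu j m = n * (\<Sum>m'\<in>R j m. cmod (lam j m'))" for j m
        define u where "u j x = (\<Sum>\<^sub>\<infinity>m\<in>I j. lam j m * a j m x)" for j x
        define X where "X j x = {m \<in> I j. x \<in> dcube d j m}" for j x
        define w where "w j x = (\<Sum>m\<in>X j x. cmod (lam j m))" for j x
        have atom: "is_atom d K j m (a j m)" if "m \<in> I j" for j m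
          using rep that by (simp add: atomic_rep_def I_def)
        note at = is_atom_lipschitz[OF atom assms(5)]
        have mu0: "0 \<le> mu j m" for j m
          using n1 by (simp add: mu_def sum_nonneg)
        have "coef_qnorm s p q mu \<le> ennreal (n * (real b * real b powr (1 / enn2real p))) * b_qnorm s p q \<Omega> lam"
          unfolding coef_qnorm_def
        proof (rule b_qnorm_Schur[OF assms(1,2), where R = R])
          fix j m
          show "finite (R j m) \<and> R j m \<subseteq> cube_indices \<Omega> j \<and> card (R j m) \<le> b"
            using box[of m] card_mono[OF box(1)[of m], of "R j m"] by (auto simp: R_def I_def)
          have "{m' \<in> cube_indices UNIV j. m \<in> R j m'} \<subseteq> box m"
            by (auto simp: R_def box_def abs_minus_commute)
          then show "finite {m' \<in> cube_indices UNIV j. m \<in> R j m'} \<and> card {m' \<in> cube_indices UNIV j. m \<in> R j m'} \<le> b"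
            using box[of m] card_mono[OF box(1)[of m]] finite_subset by (meson order_trans)
          show "cmod (complex_of_real (mu j m)) \<le> n * (\<Sum>m'\<in>R j m. cmod (lam j m'))"
          proof -
            have "cmod (complex_of_real (mu j m)) = mu j m"
              using mu0[of j m] by simp
            then show ?thesis
              by (simp only: mu_def order_refl)
          qed
        qed (use n1 b0 in auto)
        then have coef: "coef_qnorm s p q mu \<le> ennreal C * t"
          by (simp add: C_def t)
        have coef_fin: "coef_qnorm s p q mu < \<infinity>"
        proof -
          have "ennreal C * t < \<infinity>"
            using False by (simp add: ennreal_mult_less_top less_top)
          then show ?thesis
            using coef by (rule le_less_trans[rotated])
        qed
        have XR: "X j x \<subseteq> R j m" if "m \<in> cubes_at j x" for j x m
        proof
          fix m' assume m': "m' \<in> X j x"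
          have "\<bar>real_of_int (m' $ i) - real_of_int (m $ i)\<bar> \<le> d + 1" for i
          proof -
            have "\<bar>real_of_int (m' $ i) - 2 ^ j * x $ i\<bar> \<le> d"
              using m' by (simp add: X_def dcube_scaled)
            moreover have "\<bar>real_of_int (m $ i) - 2 ^ j * x $ i\<bar> \<le> 1"
              using that by (simp add: cubes_at_def dcube_scaled)
            ultimately show ?thesis by linarith
          qed
          then show "m' \<in> R j m"
            using m' by (simp add: R_def box_def X_def)
        qed
        have finX: "finite (X j x)" for j x
        proof -
          obtain m where "m \<in> cubes_at j x"
            by (rule cubes_at_nonempty)
          from XR[OF this] show ?thesis
            using box(1) by (auto simp: R_def intro: finite_subset)
        qed
        have wc: "n * w j x \<le> cover_sum (mu j) j x" for j x
        proof -
          obtain m where m: "m \<in> cubes_at j x"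
            by (rule cubes_at_nonempty)
          have "w j x \<le> (\<Sum>m'\<in>R j m. cmod (lam j m'))"
            unfolding w_def using XR[OF m] box(1) by (intro sum_mono2) (auto simp: R_def)
          then have "n * w j x \<le> mu j m"
            unfolding mu_def using n1 by (intro mult_left_mono) auto
          also have "\<dots> \<le> cover_sum (mu j) j x"
            unfolding cover_sum_def using m mu0 card_cubes_at(1) by (intro member_le_sum) auto
          finally show ?thesis .
        qed
        have w0: "0 \<le> w j x" for j x
          by (simp add: w_def sum_nonneg)
        have u_sum: "u j x = (\<Sum>m\<in>Y. lam j m * a j m x)" if "X j x \<subseteq> Y" "Y \<subseteq> I j" "finite Y" for j x Y
        proof -
          have "a j m x = 0" if "m \<in> I j" "m \<notin> Y" for m
            using at(3)[OF that(1), of x] that \<open>X j x \<subseteq> Y\<close> by (auto simp: X_def)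
          then have "u j x = (\<Sum>\<^sub>\<infinity>m\<in>Y. lam j m * a j m x)"
            unfolding u_def using that by (intro infsum_cong_neutral) auto
          then show ?thesis
            using that(3) by simp
        qed
        have ub: "cmod (u j x) \<le> cover_sum (mu j) j x" for j x
        proof -
          have "u j x = (\<Sum>m\<in>X j x. lam j m * a j m x)"
            by (rule u_sum[OF order_refl _ finX]) (auto simp: X_def)
          then have "cmod (u j x) \<le> (\<Sum>m\<in>X j x. cmod (lam j m * a j m x))"
            by (simp only: norm_sum)
          also have "\<dots> \<le> w j x"
            unfolding w_def using at(1) by (intro sum_mono) (auto simp: norm_mult X_def intro!: mult_left_le)
          also have "\<dots> \<le> n * w j x"
            using n1 w0[of j x] by (simp add: mult_le_cancel_right1)
          finally show ?thesis using wc[of j x] by linarith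
        qed
        have ul: "cmod (u j x - u j y) \<le> 2 ^ j * norm (x - y) * (cover_sum (mu j) j x + cover_sum (mu j) j y)" for j x y
        proof -
          have I: "X j x \<union> X j y \<subseteq> I j" "finite (X j x \<union> X j y)"
            using finX by (auto simp: X_def)
          have "u j x - u j y = (\<Sum>m\<in>X j x \<union> X j y. lam j m * (a j m x - a j m y))"
            using u_sum[OF Un_upper1 I] u_sum[OF Un_upper2 I] by (simp add: sum_subtractf right_diff_distrib)
          then have "cmod (u j x - u j y) \<le> (\<Sum>m\<in>X j x \<union> X j y. cmod (lam j m) * cmod (a j m x - a j m y))"
            using norm_sum by (simp flip: norm_mult)
          also have "\<dots> \<le> (\<Sum>m\<in>X j x \<union> X j y. cmod (lam j m) * (n * 2 ^ j * norm (x - y)))"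
            using at(2) I(1) by (intro sum_mono mult_left_mono) (auto simp: n_def)
          also have "\<dots> = n * 2 ^ j * norm (x - y) * (\<Sum>m\<in>X j x \<union> X j y. cmod (lam j m))"
            by (simp add: sum_distrib_left mult.commute)
          also have "\<dots> \<le> n * 2 ^ j * norm (x - y) * (w j x + w j y)"
          proof (intro mult_left_mono)
            have "0 \<le> (\<Sum>m\<in>X j x \<inter> X j y. cmod (lam j m))"
              by (rule sum_nonneg) simp
            then show "(\<Sum>m\<in>X j x \<union> X j y. cmod (lam j m)) \<le> w j x + w j y"
              unfolding w_def using sum.union_inter[OF finX finX, of "\<lambda>m. cmod (lam j m)" j x j y] by linarith
          qed (use n1 in auto)
          also have "\<dots> = 2 ^ j * norm (x - y) * (n * w j x + n * w j y)"
            by (simp add: algebra_simps)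
          also have "\<dots> \<le> 2 ^ j * norm (x - y) * (cover_sum (mu j) j x + cover_sum (mu j) j y)"
            by (intro mult_left_mono add_mono wc) auto
          finally show ?thesis .
        qed
        have um [measurable]: "u j \<in> borel_measurable (lebesgue_on \<Omega>)" for j
          by (intro continuous_imp_measurable_on_sets_lebesgue[OF _ \<Omega>]
              lip_bound_continuous_on[where c = "mu j" and j = j] mu0 ul)
        define v where "v x = (\<Sum>j. u j x)" for x
        have sv: "AE x in lebesgue_on \<Omega>. (\<lambda>j. u j x) sums v x"
          using cover_sum_AE_summable[where lam = mu, OF assms(1-3) \<Omega> mu0 coef_fin]
        proof eventually_elim
          case (elim x)
          then have "summable (\<lambda>j. u j x)"
            using ub by (intro summable_comparison_test'[OF elim]) auto
          then show ?case
            unfolding v_def by (rule summable_sums)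
        qed
        have [measurable]: "v \<in> borel_measurable (lebesgue_on \<Omega>)"
          by (rule measurable_AE_sums[OF \<Omega> um sv])
        define A where "A J = Lp_qnorm p (lebesgue_on \<Omega>) (\<lambda>x. ennreal (cmod (f x - (\<Sum>j<J. u j x))))" for J
        define B where "B J = Lp_qnorm p (lebesgue_on \<Omega>) (\<lambda>x. ennreal (cmod (v x - (\<Sum>j<J. u j x))))" for J
        have A0: "A \<longlonglongrightarrow> 0"
          using rep by (simp add: A_def[abs_def] atomic_rep_def u_def I_def)
        have B0: "B \<longlonglongrightarrow> 0"
          unfolding B_def[abs_def]
          by (rule Lp_convergence_of_dominated_sums[where lam = mu and g = u, OF assms(1-3) \<Omega> mu0 coef_fin um ub sv])
        have "Lp_qnorm p (lebesgue_on \<Omega>) (\<lambda>x. ennreal (cmod (f x - v x))) \<le> ennreal Cadd * (A J + B J)" for J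
        proof -
          have "Lp_qnorm p (lebesgue_on \<Omega>) (\<lambda>x. ennreal (cmod (f x - v x)))
              \<le> Lp_qnorm p (lebesgue_on \<Omega>) (\<lambda>x. ennreal (cmod (f x - (\<Sum>j<J. u j x))) + ennreal (cmod (v x - (\<Sum>j<J. u j x))))"
          proof (rule Lp_qnorm_mono_AE[OF assms(1)])
            have "cmod (f x - v x) \<le> cmod (f x - (\<Sum>j<J. u j x)) + cmod (v x - (\<Sum>j<J. u j x))" for x
              using norm_triangle_ineq4[of "f x - (\<Sum>j<J. u j x)" "v x - (\<Sum>j<J. u j x)"] by simp
            then show "AE x in lebesgue_on \<Omega>. ennreal (cmod (f x - v x))
                \<le> ennreal (cmod (f x - (\<Sum>j<J. u j x))) + ennreal (cmod (v x - (\<Sum>j<J. u j x)))"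
              by (intro AE_I2) (simp flip: ennreal_plus add: ennreal_leI)
          qed measurable
          also have "\<dots> \<le> ennreal Cadd * (A J + B J)"
            unfolding A_def B_def by (intro Cadd(2)) measurable
          finally show ?thesis .
        qed
        moreover have "(\<lambda>J. ennreal Cadd * (A J + B J)) \<longlonglongrightarrow> ennreal Cadd * (0 + 0)"
          by (intro ennreal_tendsto_cmult tendsto_add A0 B0) simp
        ultimately have "Lp_qnorm p (lebesgue_on \<Omega>) (\<lambda>x. ennreal (cmod (f x - v x))) \<le> ennreal Cadd * (0 + 0)"
          by (intro LIMSEQ_le_const[of "\<lambda>J. ennreal Cadd * (A J + B J)"]) auto
        then have "Lp_qnorm p (lebesgue_on \<Omega>) (\<lambda>x. ennreal (cmod (f x - v x))) = 0"
          by simp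
        then have "AE x in lebesgue_on \<Omega>. ennreal (cmod (f x - v x)) = 0"
          by (intro Lp_qnorm_eq_0_AE[OF assms(1)]) auto
        with sv have "AE x in lebesgue_on \<Omega>. (\<lambda>j. u j x) sums f x"
          by eventually_elim simp
        then have "lip_rep \<Omega> f mu u"
          unfolding lip_rep_def using mu0 ub ul by blast
        then show ?thesis
          using lip_qnorm_le coef order_trans by blast
      qed
    qed
  qed
qed

section \<open>Stability of Lipschitz representations\<close>

lemma AE_lebesgue_on_iff_negligible:
  assumes "\<Omega> \<in> sets lebesgue"
  shows "(AE x in lebesgue_on \<Omega>. P x) \<longleftrightarrow> negligible {x \<in> \<Omega>. \<not> P x}"
proof -
  have "(AE x in lebesgue_on \<Omega>. P x) \<longleftrightarrow> (AE x in lebesgue. x \<in> \<Omega> \<longrightarrow> P x)"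
    using assms by (intro AE_restrict_space_iff) simp
  also have "\<dots> \<longleftrightarrow> {x \<in> \<Omega>. \<not> P x} \<in> null_sets lebesgue"
    by (simp add: completion.AE_iff_null_sets)
  finally show ?thesis
    by (simp add: negligible_iff_null_sets)
qed

text \<open>
  The preimage is the image under the Lipschitz inverse, and Lipschitz maps preserve null sets.
\<close>

lemma negligible_bilipschitz_preimage:
  fixes T :: "real^'n::finite \<Rightarrow> real^'n"
  assumes "negligible N" "\<And>x y. x \<in> E \<Longrightarrow> y \<in> E \<Longrightarrow> norm (x - y) \<le> L * norm (T x - T y)"
  shows "negligible {x \<in> E. T x \<in> N}"
proof -
  have inj: "inj_on T E"
  proof (rule inj_onI)
    fix x y assume "x \<in> E" "y \<in> E" "T x = T y"
    then show "x = y" using assms(2)[of x y] by simp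
  qed
  have inv: "inv_into E T (T x) = x" if "x \<in> E" for x
    using inj that by simp
  have "negligible (inv_into E T ` (N \<inter> T ` E))"
  proof (rule negligible_locally_Lipschitz_image)
    show "negligible (N \<inter> T ` E)"
      using assms(1) by (rule negligible_subset) auto
    fix z assume z: "z \<in> N \<inter> T ` E"
    show "\<exists>U B. open U \<and> z \<in> U \<and> (\<forall>y\<in>N \<inter> T ` E \<inter> U. norm (inv_into E T y - inv_into E T z) \<le> B * norm (y - z))"
      using z assms(2) by (intro exI[of _ UNIV] exI[of _ L]) (auto simp: inv)
  qed simp
  moreover have "{x \<in> E. T x \<in> N} \<subseteq> inv_into E T ` (N \<inter> T ` E)"
  proof
    fix x assume x: "x \<in> {x \<in> E. T x \<in> N}"
    then have "x = inv_into E T (T x)" by (simp add: inv)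
    then show "x \<in> inv_into E T ` (N \<inter> T ` E)" using x by blast
  qed
  ultimately show ?thesis
    by (rule negligible_subset)
qed

lemma norm_le_card_mult:
  fixes z :: "real^'n::finite"
  assumes "\<And>i. \<bar>z $ i\<bar> \<le> c"
  shows "norm z \<le> real CARD('n) * c"
proof -
  have "norm z \<le> (\<Sum>i\<in>UNIV. \<bar>z $ i\<bar>)"
    by (rule norm_le_l1_cart)
  also have "\<dots> \<le> (\<Sum>i\<in>(UNIV :: 'n set). c)"
    by (intro sum_mono assms)
  finally show ?thesis by simp
qed

lemma dcube_points_dist:
  fixes x y :: "real^'n::finite"
  assumes "x \<in> dcube 1 j m" "y \<in> dcube 1 j m"
  shows "2 ^ j * norm (x - y) \<le> 2 * real CARD('n)"
proof -
  have "\<bar>(x - y) $ i\<bar> \<le> 2 / 2 ^ j" for i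
  proof -
    have "\<bar>x $ i - real_of_int (m $ i) / 2 ^ j\<bar> \<le> 1 / 2 ^ j" "\<bar>y $ i - real_of_int (m $ i) / 2 ^ j\<bar> \<le> 1 / 2 ^ j"
      using assms by (auto simp: dcube_def)
    then show ?thesis by simp
  qed
  from norm_le_card_mult[OF this] show ?thesis
    by (simp add: field_simps)
qed

text \<open>
  Together with \<open>card_int_box\<close> this bounds the number of cubes of one level that a Lipschitz
  map can reach from a single cube.
\<close>

lemma dcube_indices_dist:
  fixes x y :: "real^'n::finite"
  assumes "x \<in> dcube 1 j m" "y \<in> dcube 1 j m'" "2 ^ j * norm (x - y) \<le> r"
  shows "\<bar>real_of_int (m $ i) - real_of_int (m' $ i)\<bar> \<le> r + 2"
proof -
  have "\<bar>real_of_int (m $ i) - 2 ^ j * x $ i\<bar> \<le> 1" "\<bar>real_of_int (m' $ i) - 2 ^ j * y $ i\<bar> \<le> 1"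
    using assms by (auto simp: dcube_scaled)
  moreover have "\<bar>2 ^ j * x $ i - 2 ^ j * y $ i\<bar> \<le> r"
  proof -
    have "2 ^ j * \<bar>x $ i - y $ i\<bar> \<le> 2 ^ j * norm (x - y)"
      using component_le_norm_cart[of "x - y" i] by simp
    moreover have "\<bar>2 ^ j * x $ i - 2 ^ j * y $ i\<bar> = 2 ^ j * \<bar>x $ i - y $ i\<bar>"
      by (simp add: abs_mult flip: right_diff_distrib)
    ultimately show ?thesis
      using assms(3) by linarith
  qed
  ultimately show ?thesis by linarith
qed

text \<open>
  The pieces are transformed like the function itself. Their Lipschitz bounds at scale
  \<open>2\<^bsup>-j\<^esup>\<close> survive the multiplication with \<open>M\<close> because \<open>2\<^sup>j \<ge> 1\<close>, and the extension by zero
  because \<open>M\<close> vanishes outside \<open>E\<close> and is Lipschitz across the boundary of \<open>E\<close>. As \<open>T\<close> distorts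
  distances by bounded factors only, cubes correspond to boundedly many cubes of the
  same level in both directions, and the Schur test applies.
\<close>

lemma lip_qnorm_transform:
  fixes T :: "real^'n::finite \<Rightarrow> real^'n" and M :: "real^'n \<Rightarrow> real"
  assumes "0 < p" "0 < q" "0 \<le> L" "0 \<le> D" "\<Omega> \<in> sets lebesgue" "\<Omega>' \<in> sets lebesgue"
    and E: "E \<subseteq> \<Omega>" "\<And>x. x \<in> E \<Longrightarrow> T x \<in> \<Omega>'"
    and T: "\<And>x y. x \<in> E \<Longrightarrow> y \<in> E \<Longrightarrow> norm (T x - T y) \<le> L * norm (x - y)"
    and T': "\<And>x y. x \<in> E \<Longrightarrow> y \<in> E \<Longrightarrow> norm (x - y) \<le> L * norm (T x - T y)"
    and M: "\<And>x. x \<in> \<Omega> \<Longrightarrow> \<bar>M x\<bar> \<le> D" "\<And>x y. x \<in> \<Omega> \<Longrightarrow> y \<in> \<Omega> \<Longrightarrow> \<bar>M x - M y\<bar> \<le> D * norm (x - y)"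
    and M0: "\<And>x. x \<in> \<Omega> \<Longrightarrow> x \<notin> E \<Longrightarrow> M x = 0"
  obtains C :: real where "0 < C"
    "\<And>g. lip_qnorm s p q \<Omega> (\<lambda>x. if x \<in> E then of_real (M x) * g (T x) else 0) \<le> ennreal C * lip_qnorm s p q \<Omega>' g"
proof -
  define n where "n = real CARD('n)"
  define A where "A = 2 * n * L + 2"
  have A0: "0 \<le> A" using assms(3) by (simp add: A_def n_def)
  define b where "b = nat \<lceil>(2 * A + 1) ^ CARD('n)\<rceil>"
  have b: "(2 * A + 1) ^ CARD('n) \<le> real b"
    unfolding b_def by (rule real_nat_ceiling_ge)
  have b0: "0 < b"
  proof -
    have "0 < (2 * A + 1) ^ CARD('n)"
      using A0 by simp
    then show ?thesis using b by simp
  qed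
  define box where "box m = {m'::int^'n. \<forall>i. \<bar>real_of_int (m' $ i) - real_of_int (m $ i)\<bar> \<le> A}" for m
  have box: "finite (box m)" "card (box m) \<le> b" for m
  proof -
    show "finite (box m)"
      unfolding box_def using A0 by (intro card_int_box)
    have "real (card (box m)) \<le> (2 * A + 1) ^ CARD('n)"
      unfolding box_def using A0 by (intro card_int_box)
    then show "card (box m) \<le> b" using b by linarith
  qed
  have small: "finite S \<and> card S \<le> b" if "\<And>m m'. m \<in> S \<Longrightarrow> m' \<in> S \<Longrightarrow> m \<in> box m'" for S
  proof (cases "S = {}")
    case False
    then obtain m' where "m' \<in> S" by blast
    then have "S \<subseteq> box m'" using that by blast
    then show ?thesis
      using box[of m'] card_mono[OF box(1)[of m']] finite_subset order_trans by metis
  qed (use b0 in simp)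
  define R where "R j m' = {m. \<exists>x\<in>E. x \<in> dcube 1 j m' \<and> T x \<in> dcube 1 j m}" for j m'
  have R1: "finite (R j m') \<and> card (R j m') \<le> b" for j m'
  proof (rule small)
    fix m1 m2 assume "m1 \<in> R j m'" "m2 \<in> R j m'"
    then obtain x1 x2 where x: "x1 \<in> E" "x1 \<in> dcube 1 j m'" "T x1 \<in> dcube 1 j m1"
      "x2 \<in> E" "x2 \<in> dcube 1 j m'" "T x2 \<in> dcube 1 j m2"
      unfolding R_def by blast
    have "2 ^ j * norm (T x1 - T x2) \<le> L * (2 ^ j * norm (x1 - x2))"
      using T[OF x(1,4)] by (simp add: mult.left_commute)
    also have "\<dots> \<le> L * (2 * n)"
      unfolding n_def using dcube_points_dist[OF x(2,5)] assms(3) by (intro mult_left_mono)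
    finally have "2 ^ j * norm (T x1 - T x2) \<le> 2 * n * L"
      by (simp add: mult.commute)
    from dcube_indices_dist[OF x(3,6) this] show "m1 \<in> box m2"
      by (simp add: box_def A_def)
  qed
  have R2: "finite {m'. m \<in> R j m'} \<and> card {m'. m \<in> R j m'} \<le> b" for j m
  proof (rule small)
    fix m1 m2 assume "m1 \<in> {m'. m \<in> R j m'}" "m2 \<in> {m'. m \<in> R j m'}"
    then obtain x1 x2 where x: "x1 \<in> E" "x1 \<in> dcube 1 j m1" "T x1 \<in> dcube 1 j m"
      "x2 \<in> E" "x2 \<in> dcube 1 j m2" "T x2 \<in> dcube 1 j m"
      unfolding R_def by blast
    have "2 ^ j * norm (x1 - x2) \<le> L * (2 ^ j * norm (T x1 - T x2))"
      using T'[OF x(1,4)] by (simp add: mult.left_commute)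
    also have "\<dots> \<le> L * (2 * n)"
      unfolding n_def using dcube_points_dist[OF x(3,6)] assms(3) by (intro mult_left_mono)
    finally have "2 ^ j * norm (x1 - x2) \<le> 2 * n * L"
      by (simp add: mult.commute)
    from dcube_indices_dist[OF x(2,5) this] show "m1 \<in> box m2"
      by (simp add: box_def A_def)
  qed
  define c where "c = D * (L + 1)"
  have c0: "0 \<le> c" "D \<le> c" "D * L + D = c"
    using assms(3,4) by (simp_all add: c_def algebra_simps)
  define C where "C = c * (real b * real b powr (1 / enn2real p)) + 1"
  have C: "0 < C"
    using c0(1) by (simp add: C_def add_nonneg_pos)
  show ?thesis
  proof (rule that[OF C])
    fix g :: "real^'n \<Rightarrow> complex"
    let ?f = "\<lambda>x. if x \<in> E then of_real (M x) * g (T x) else 0"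
    show "lip_qnorm s p q \<Omega> ?f \<le> ennreal C * lip_qnorm s p q \<Omega>' g"
      unfolding lip_qnorm_def[of s p q \<Omega>']
    proof (rule ennreal_le_mult_Inf[OF C])
      fix t assume "t \<in> {coef_qnorm s p q lam |lam u. lip_rep \<Omega>' g lam u}"
      then obtain lam u where rep: "lip_rep \<Omega>' g lam u" and t: "t = coef_qnorm s p q lam"
        by auto
      have lam0: "0 \<le> lam j m" for j m
        using rep by (simp add: lip_rep_def)
      have ub: "cmod (u j x) \<le> cover_sum (lam j) j x" if "x \<in> \<Omega>'" for j x
        using rep that by (simp add: lip_rep_def)
      have ul: "cmod (u j x - u j y) \<le> 2 ^ j * norm (x - y) * (cover_sum (lam j) j x + cover_sum (lam j) j y)"
        if "x \<in> \<Omega>'" "y \<in> \<Omega>'" for j x y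
        using rep that by (simp add: lip_rep_def)
      define mu where "mu j m' = c * (\<Sum>m\<in>R j m'. lam j m)" for j m'
      define v where "v j x = (if x \<in> E then of_real (M x) * u j (T x) else 0)" for j x
      have mu0: "0 \<le> mu j m" for j m
        unfolding mu_def using c0(1) lam0 by (simp add: sum_nonneg)
      have cov0: "0 \<le> cover_sum (mu j) j x" "0 \<le> cover_sum (lam j) j x" for j x
        using mu0 lam0 by (auto intro: cover_sum_nonneg)
      have cov: "c * cover_sum (lam j) j (T x) \<le> cover_sum (mu j) j x" if "x \<in> E" for j x
      proof -
        obtain m' where m': "m' \<in> cubes_at j x"
          by (rule cubes_at_nonempty)
        have "cubes_at j (T x) \<subseteq> R j m'"
          using m' that by (auto simp: R_def cubes_at_def)
        then have "cover_sum (lam j) j (T x) \<le> (\<Sum>m\<in>R j m'. lam j m)"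
          unfolding cover_sum_def using R1 lam0 by (intro sum_mono2) auto
        then have "c * cover_sum (lam j) j (T x) \<le> mu j m'"
          unfolding mu_def using c0(1) by (intro mult_left_mono)
        also have "\<dots> \<le> cover_sum (mu j) j x"
          unfolding cover_sum_def using m' mu0 card_cubes_at(1) by (intro member_le_sum) auto
        finally show ?thesis .
      qed
      have vb: "cmod (v j x) \<le> cover_sum (mu j) j x" if "x \<in> \<Omega>" for j x
      proof (cases "x \<in> E")
        case True
        have "cmod (v j x) \<le> D * cover_sum (lam j) j (T x)"
          using M(1)[OF that] ub[OF E(2)[OF True]] True assms(4) by (simp add: v_def norm_mult mult_mono)
        also have "\<dots> \<le> c * cover_sum (lam j) j (T x)"
          using c0 cov0 by (intro mult_right_mono) auto
        finally show ?thesis using cov[OF True] order_trans by blast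
      qed (simp add: v_def cov0)
      have half: "cmod (v j x - v j y) \<le> 2 ^ j * norm (x - y) * (cover_sum (mu j) j x + cover_sum (mu j) j y)"
        if x: "x \<in> E" and y: "y \<in> \<Omega>" for j x y
      proof (cases "y \<in> E")
        case True
        let ?cx = "cover_sum (lam j) j (T x)" and ?cy = "cover_sum (lam j) j (T y)"
        have "v j x - v j y = of_real (M x) * (u j (T x) - u j (T y)) + of_real (M x - M y) * u j (T y)"
          using x True by (simp add: v_def algebra_simps)
        then have "cmod (v j x - v j y) \<le> \<bar>M x\<bar> * cmod (u j (T x) - u j (T y)) + \<bar>M x - M y\<bar> * cmod (u j (T y))"
          by (metis norm_mult norm_of_real norm_triangle_ineq)
        also have "\<dots> \<le> D * (2 ^ j * (L * norm (x - y)) * (?cx + ?cy)) + (D * (2 ^ j * norm (x - y))) * ?cy"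
        proof (intro add_mono mult_mono)
          show "\<bar>M x\<bar> \<le> D" using M(1) x E(1) by blast
          have "cmod (u j (T x) - u j (T y)) \<le> 2 ^ j * norm (T x - T y) * (?cx + ?cy)"
            using ul[OF E(2)[OF x] E(2)[OF True]] .
          also have "\<dots> \<le> 2 ^ j * (L * norm (x - y)) * (?cx + ?cy)"
            using T[OF x True] cov0 by (intro mult_right_mono mult_left_mono) auto
          finally show "cmod (u j (T x) - u j (T y)) \<le> 2 ^ j * (L * norm (x - y)) * (?cx + ?cy)" .
          have "\<bar>M x - M y\<bar> \<le> D * (1 * norm (x - y))"
            using M(2) x y E(1) by auto
          also have "\<dots> \<le> D * (2 ^ j * norm (x - y))"
            using assms(4) by (intro mult_left_mono mult_right_mono) auto
          finally show "\<bar>M x - M y\<bar> \<le> D * (2 ^ j * norm (x - y))" .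
          show "cmod (u j (T y)) \<le> ?cy"
            using ub[OF E(2)[OF True]] .
        qed (use assms(3,4) in auto)
        also have "\<dots> \<le> D * (2 ^ j * (L * norm (x - y)) * (?cx + ?cy)) + (D * (2 ^ j * norm (x - y))) * (?cx + ?cy)"
          using assms(4) cov0 by (intro add_left_mono mult_left_mono) auto
        also have "\<dots> = 2 ^ j * norm (x - y) * ((D * L + D) * ?cx + (D * L + D) * ?cy)"
          by (simp add: algebra_simps)
        also have "\<dots> \<le> 2 ^ j * norm (x - y) * (cover_sum (mu j) j x + cover_sum (mu j) j y)"
          unfolding c0(3) by (intro mult_left_mono add_mono cov x True) auto
        finally show ?thesis .
      next
        case False
        have Mx: "\<bar>M x\<bar> \<le> D * norm (x - y)"
          using M(2)[of x y] M0[OF y False] x y E(1) by auto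
        have "cmod (v j x - v j y) \<le> (D * norm (x - y)) * cover_sum (lam j) j (T x)"
          using x False Mx ub[OF E(2)[OF x]] assms(4) by (simp add: v_def norm_mult mult_mono)
        also have "\<dots> = norm (x - y) * (D * cover_sum (lam j) j (T x))"
          by simp
        also have "\<dots> \<le> norm (x - y) * (c * cover_sum (lam j) j (T x))"
          using c0 cov0 by (intro mult_left_mono mult_right_mono) auto
        also have "\<dots> \<le> norm (x - y) * cover_sum (mu j) j x"
          by (intro mult_left_mono cov x) auto
        also have "\<dots> \<le> (2 ^ j * norm (x - y)) * (cover_sum (mu j) j x + cover_sum (mu j) j y)"
          using cov0 by (intro mult_mono) (auto simp: mult_le_cancel_right1)
        finally show ?thesis .
      qed
      have vl: "cmod (v j x - v j y) \<le> 2 ^ j * norm (x - y) * (cover_sum (mu j) j x + cover_sum (mu j) j y)"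
        if x: "x \<in> \<Omega>" and y: "y \<in> \<Omega>" for j x y
      proof -
        consider "x \<in> E" | "y \<in> E" | "x \<notin> E" "y \<notin> E" by blast
        then show ?thesis
        proof cases
          case 1
          then show ?thesis using half y by blast
        next
          case 2
          then show ?thesis
            using half[OF 2 x, of j] by (simp add: norm_minus_commute add.commute)
        next
          case 3
          then show ?thesis
            using cov0 by (simp add: v_def)
        qed
      qed
      have "negligible {y \<in> \<Omega>'. \<not> (\<lambda>j. u j y) sums g y}"
        using rep assms(6) by (simp add: lip_rep_def AE_lebesgue_on_iff_negligible)
      then have "negligible {x \<in> E. T x \<in> {y \<in> \<Omega>'. \<not> (\<lambda>j. u j y) sums g y}}"
        using T' by (rule negligible_bilipschitz_preimage)
      moreover have "{x \<in> \<Omega>. \<not> (\<lambda>j. v j x) sums ?f x} \<subseteq> {x \<in> E. T x \<in> {y \<in> \<Omega>'. \<not> (\<lambda>j. u j y) sums g y}}"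
        using E(2) by (auto simp: v_def intro: sums_mult)
      ultimately have "negligible {x \<in> \<Omega>. \<not> (\<lambda>j. v j x) sums ?f x}"
        by (rule negligible_subset)
      then have "AE x in lebesgue_on \<Omega>. (\<lambda>j. v j x) sums ?f x"
        using assms(5) by (simp only: AE_lebesgue_on_iff_negligible)
      then have "lip_rep \<Omega> ?f mu v"
        unfolding lip_rep_def using mu0 vb vl by blast
      then have "lip_qnorm s p q \<Omega> ?f \<le> coef_qnorm s p q mu"
        by (rule lip_qnorm_le)
      also have "\<dots> \<le> ennreal (c * (real b * real b powr (1 / enn2real p))) * coef_qnorm s p q lam"
        unfolding coef_qnorm_def
      proof (rule b_qnorm_Schur[OF assms(1,2), where R = R])
        fix j m
        show "finite (R j m) \<and> R j m \<subseteq> cube_indices UNIV j \<and> card (R j m) \<le> b"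
          using R1 by auto
        show "finite {m' \<in> cube_indices UNIV j. m \<in> R j m'} \<and> card {m' \<in> cube_indices UNIV j. m \<in> R j m'} \<le> b"
          using R2 by auto
        have "cmod (complex_of_real (mu j m)) = mu j m"
          using mu0[of j m] by simp
        then show "cmod (complex_of_real (mu j m)) \<le> c * (\<Sum>m'\<in>R j m. cmod (complex_of_real (lam j m')))"
          using lam0 by (simp add: mu_def)
      qed (use c0 b0 in auto)
      also have "\<dots> \<le> ennreal C * t"
        unfolding t by (intro mult_right_mono ennreal_leI) (auto simp: C_def)
      finally show "lip_qnorm s p q \<Omega> ?f \<le> ennreal C * t" .
    qed
  qed
qed

lemma coef_qnorm_add:
  assumes "0 < p" "0 < q"
  obtains C :: real where "0 < C"
    "\<And>lam mu :: nat \<Rightarrow> int^'n::finite \<Rightarrow> real. (\<And>j m. 0 \<le> lam j m) \<Longrightarrow> (\<And>j m. 0 \<le> mu j m) \<Longrightarrow>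
      coef_qnorm s p q (\<lambda>j m. lam j m + mu j m) \<le> ennreal C * (coef_qnorm s p q lam + coef_qnorm s p q mu)"
proof -
  obtain Cp :: real where Cp: "0 < Cp"
    "\<And>(M :: (int^'n) measure) g h. g \<in> borel_measurable M \<Longrightarrow> h \<in> borel_measurable M \<Longrightarrow>
       Lp_qnorm p M (\<lambda>x. g x + h x) \<le> ennreal Cp * (Lp_qnorm p M g + Lp_qnorm p M h)"
    using Lp_qnorm_add[OF assms(1)] by blast
  obtain Cq :: real where Cq: "0 < Cq"
    "\<And>(M :: nat measure) g h. g \<in> borel_measurable M \<Longrightarrow> h \<in> borel_measurable M \<Longrightarrow>
       Lp_qnorm q M (\<lambda>x. g x + h x) \<le> ennreal Cq * (Lp_qnorm q M g + Lp_qnorm q M h)"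
    using Lp_qnorm_add[OF assms(2)] by blast
  show ?thesis
  proof (rule that[of "Cp * Cq"])
    show "0 < Cp * Cq" using Cp Cq by simp
    fix lam mu :: "nat \<Rightarrow> int^'n \<Rightarrow> real"
    assume lam: "\<And>j m. 0 \<le> lam j m" and mu: "\<And>j m. 0 \<le> mu j m"
    define w where "w j = ennreal (2 powr (real j * (s - real CARD('n) / enn2real p)))" for j :: nat
    define N where "N lam j = Lp_qnorm p (count_space UNIV) (\<lambda>m. ennreal (lam j m))" for lam :: "nat \<Rightarrow> int^'n \<Rightarrow> real" and j
    have eq: "coef_qnorm s p q lam = Lp_qnorm q (count_space UNIV) (\<lambda>j. w j * N lam j)"
      if "\<And>j m. 0 \<le> lam j m" for lam :: "nat \<Rightarrow> int^'n \<Rightarrow> real"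
      using that by (simp add: coef_qnorm_def b_qnorm_def w_def N_def)
    have N: "N (\<lambda>j m. lam j m + mu j m) j \<le> ennreal Cp * (N lam j + N mu j)" for j
      unfolding N_def using Cp(2)[of "\<lambda>m. ennreal (lam j m)" "count_space UNIV" "\<lambda>m. ennreal (mu j m)"] lam mu
      by simp
    have "coef_qnorm s p q (\<lambda>j m. lam j m + mu j m)
        \<le> Lp_qnorm q (count_space UNIV) (\<lambda>j. ennreal Cp * (w j * N lam j + w j * N mu j))"
    proof (subst eq)
      show "Lp_qnorm q (count_space UNIV) (\<lambda>j. w j * N (\<lambda>j m. lam j m + mu j m) j)
        \<le> Lp_qnorm q (count_space UNIV) (\<lambda>j. ennreal Cp * (w j * N lam j + w j * N mu j))"
      proof (intro Lp_qnorm_count_space_mono[OF assms(2)])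
        fix j
        have "w j * N (\<lambda>j m. lam j m + mu j m) j \<le> w j * (ennreal Cp * (N lam j + N mu j))"
          by (intro mult_left_mono N) auto
        then show "w j * N (\<lambda>j m. lam j m + mu j m) j \<le> ennreal Cp * (w j * N lam j + w j * N mu j)"
          by (simp add: distrib_left ac_simps)
      qed
    qed (use lam mu in simp)
    also have "\<dots> \<le> ennreal Cp * Lp_qnorm q (count_space UNIV) (\<lambda>j. w j * N lam j + w j * N mu j)"
      by (intro Lp_qnorm_cmult[OF assms(2)]) auto
    also have "\<dots> \<le> ennreal Cp * (ennreal Cq * (coef_qnorm s p q lam + coef_qnorm s p q mu))"
      using Cq(2) lam mu by (intro mult_left_mono) (auto simp: eq)
    also have "\<dots> = ennreal (Cp * Cq) * (coef_qnorm s p q lam + coef_qnorm s p q mu)"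
      using Cp(1) Cq(1) by (simp add: ennreal_mult mult.assoc)
    finally show "coef_qnorm s p q (\<lambda>j m. lam j m + mu j m) \<le> ennreal (Cp * Cq) * (coef_qnorm s p q lam + coef_qnorm s p q mu)" .
  qed
qed

lemma cover_sum_add: "cover_sum (\<lambda>m. c m + c' m) j x = cover_sum c j x + cover_sum c' j x"
  by (simp add: cover_sum_def sum.distrib)

lemma lip_rep_add:
  assumes "lip_rep \<Omega> f lam u" "lip_rep \<Omega> g mu v"
  shows "lip_rep \<Omega> (\<lambda>x. f x + g x) (\<lambda>j m. lam j m + mu j m) (\<lambda>j x. u j x + v j x)"
  unfolding lip_rep_def
proof (intro conjI allI ballI)
  fix j m
  show "0 \<le> lam j m + mu j m"
    using assms by (simp add: lip_rep_def)
next
  fix j x assume x: "x \<in> \<Omega>"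
  have "cmod (u j x) \<le> cover_sum (lam j) j x" "cmod (v j x) \<le> cover_sum (mu j) j x"
    using assms x by (auto simp: lip_rep_def)
  then show "cmod (u j x + v j x) \<le> cover_sum (\<lambda>m. lam j m + mu j m) j x"
    using norm_triangle_ineq[of "u j x" "v j x"] by (simp add: cover_sum_add)
  fix y assume y: "y \<in> \<Omega>"
  have "cmod (u j x - u j y) \<le> 2 ^ j * norm (x - y) * (cover_sum (lam j) j x + cover_sum (lam j) j y)"
    "cmod (v j x - v j y) \<le> 2 ^ j * norm (x - y) * (cover_sum (mu j) j x + cover_sum (mu j) j y)"
    using assms x y by (auto simp: lip_rep_def)
  moreover have "cmod (u j x + v j x - (u j y + v j y)) \<le> cmod (u j x - u j y) + cmod (v j x - v j y)"
    using norm_triangle_ineq[of "u j x - u j y" "v j x - v j y"] by (simp add: algebra_simps)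
  ultimately show "cmod (u j x + v j x - (u j y + v j y)) \<le> 2 ^ j * norm (x - y) *
      (cover_sum (\<lambda>m. lam j m + mu j m) j x + cover_sum (\<lambda>m. lam j m + mu j m) j y)"
    by (simp add: cover_sum_add algebra_simps)
next
  have "AE x in lebesgue_on \<Omega>. (\<lambda>j. u j x) sums f x" "AE x in lebesgue_on \<Omega>. (\<lambda>j. v j x) sums g x"
    using assms by (auto simp: lip_rep_def)
  then show "AE x in lebesgue_on \<Omega>. (\<lambda>j. u j x + v j x) sums (f x + g x)"
    by eventually_elim (rule sums_add)
qed

lemma ennreal_le_mult_add_Inf:
  fixes a :: ennreal
  assumes "0 < C" "\<And>b c. b \<in> S \<Longrightarrow> c \<in> T \<Longrightarrow> a \<le> ennreal C * (b + c)"
  shows "a \<le> ennreal C * (Inf S + Inf T)"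
proof (cases "Inf S < \<infinity> \<and> Inf T < \<infinity>")
  case True
  show ?thesis
  proof (rule ennreal_le_epsilon)
    fix e :: real assume e: "0 < e"
    define \<delta> where "\<delta> = e / (2 * C)"
    have \<delta>: "0 < \<delta>" using e assms(1) by (simp add: \<delta>_def)
    have "x < x + ennreal \<delta>" if "x < \<infinity>" for x :: ennreal
      using that \<delta> by (cases x) (auto simp: ennreal_less_iff simp flip: ennreal_plus)
    then have "Inf S < Inf S + ennreal \<delta>" "Inf T < Inf T + ennreal \<delta>"
      using True by blast+
    then obtain b c where bc: "b \<in> S" "b < Inf S + ennreal \<delta>" "c \<in> T" "c < Inf T + ennreal \<delta>"
      unfolding Inf_less_iff by blast
    have "a \<le> ennreal C * (b + c)"
      using assms(2) bc by blast
    also have "\<dots> \<le> ennreal C * ((Inf S + ennreal \<delta>) + (Inf T + ennreal \<delta>))"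
      using bc by (intro mult_left_mono add_mono) auto
    also have "\<dots> = ennreal C * (Inf S + Inf T) + ennreal C * (ennreal \<delta> + ennreal \<delta>)"
      by (simp add: distrib_left ac_simps)
    also have "ennreal C * (ennreal \<delta> + ennreal \<delta>) = ennreal e"
      using assms(1) \<delta> by (simp add: \<delta>_def flip: ennreal_plus ennreal_mult)
    finally show "a \<le> ennreal C * (Inf S + Inf T) + ennreal e" .
  qed
next
  case False
  then have "Inf S = \<infinity> \<or> Inf T = \<infinity>"
    unfolding infinity_ennreal_def less_top[symmetric] by blast
  then have eq: "Inf S + Inf T = \<infinity>"
    by (elim disjE) (simp_all only: infinity_ennreal_def add_top_left_ennreal add_top_right_ennreal)
  show ?thesis
    unfolding eq using assms(1) by (simp add: ennreal_mult_top)
qed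

lemma lip_qnorm_add:
  assumes "0 < p" "0 < q"
  obtains C :: real where "0 < C"
    "\<And>(\<Omega> :: (real^'n::finite) set) f g. lip_qnorm s p q \<Omega> (\<lambda>x. f x + g x) \<le> ennreal C * (lip_qnorm s p q \<Omega> f + lip_qnorm s p q \<Omega> g)"
proof -
  obtain C :: real where C: "0 < C"
    "\<And>lam mu :: nat \<Rightarrow> int^'n \<Rightarrow> real. (\<And>j m. 0 \<le> lam j m) \<Longrightarrow> (\<And>j m. 0 \<le> mu j m) \<Longrightarrow>
      coef_qnorm s p q (\<lambda>j m. lam j m + mu j m) \<le> ennreal C * (coef_qnorm s p q lam + coef_qnorm s p q mu)"
    using coef_qnorm_add[OF assms] by blast
  show ?thesis
  proof (rule that[OF C(1)])
    fix \<Omega> :: "(real^'n) set" and f g :: "real^'n \<Rightarrow> complex"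
    show "lip_qnorm s p q \<Omega> (\<lambda>x. f x + g x) \<le> ennreal C * (lip_qnorm s p q \<Omega> f + lip_qnorm s p q \<Omega> g)"
      unfolding lip_qnorm_def[of s p q \<Omega> f] lip_qnorm_def[of s p q \<Omega> g]
    proof (rule ennreal_le_mult_add_Inf[OF C(1)], clarify)
      fix lam u mu v
      assume r: "lip_rep \<Omega> f lam u" "lip_rep \<Omega> g mu v"
      have "lip_qnorm s p q \<Omega> (\<lambda>x. f x + g x) \<le> coef_qnorm s p q (\<lambda>j m. lam j m + mu j m)"
        by (rule lip_qnorm_le[OF lip_rep_add[OF r]])
      also have "\<dots> \<le> ennreal C * (coef_qnorm s p q lam + coef_qnorm s p q mu)"
        using r by (intro C(2)) (auto simp: lip_rep_def)
      finally show "lip_qnorm s p q \<Omega> (\<lambda>x. f x + g x) \<le> ennreal C * (coef_qnorm s p q lam + coef_qnorm s p q mu)" .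
    qed
  qed
qed

section \<open>From Lipschitz pieces to smooth atoms\<close>

text \<open>
  Up to a factor these are the terms of the Cauchy product of \<open>a\<close> with a geometric series.
\<close>

lemma geometric_convolution_tendsto_0:
  fixes a :: "nat \<Rightarrow> real"
  assumes "summable a" "\<And>j. 0 \<le> a j"
  shows "(\<lambda>J. \<Sum>j<J. a j / 2 ^ (J - j)) \<longlonglongrightarrow> 0"
proof -
  have "summable (\<lambda>k. \<Sum>i\<le>k. a i * (1 / 2) ^ (k - i))"
    using assms by (intro summable_Cauchy_product) (auto simp: summable_geometric)
  then have "(\<lambda>k. \<Sum>i\<le>k. a i * (1 / 2) ^ (k - i)) \<longlonglongrightarrow> 0"
    by (rule summable_LIMSEQ_zero)
  moreover have "(\<Sum>i\<le>k. a i * (1 / 2) ^ (k - i)) = 2 * (\<Sum>j<Suc k. a j / 2 ^ (Suc k - j))" for k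
  proof -
    have "a j * (1 / 2) ^ (k - j) = 2 * (a j / 2 ^ (Suc k - j))" if "j \<le> k" for j
      using that by (simp add: Suc_diff_le power_divide)
    then show ?thesis
      by (simp add: sum_distrib_left lessThan_Suc_atMost)
  qed
  ultimately have "(\<lambda>k. 2 * (\<Sum>j<Suc k. a j / 2 ^ (Suc k - j))) \<longlonglongrightarrow> 0"
    by simp
  then have "(\<lambda>k. 1 / 2 * (2 * (\<Sum>j<Suc k. a j / 2 ^ (Suc k - j)))) \<longlonglongrightarrow> 1 / 2 * 0"
    by (intro tendsto_mult tendsto_const)
  then have "(\<lambda>k. \<Sum>j<Suc k. a j / 2 ^ (Suc k - j)) \<longlonglongrightarrow> 0"
    by (simp del: sum.lessThan_Suc)
  then show ?thesis
    by (rule LIMSEQ_imp_Suc)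
qed

lemma Lp_qnorm_cong_AE:
  assumes "AE x in M. g x = h x" "g \<in> borel_measurable M \<longleftrightarrow> h \<in> borel_measurable M"
  shows "Lp_qnorm p M g = Lp_qnorm p M h"
proof -
  have "esssup M g = esssup M h"
    using assms esssup_AE_cong[of g M h] esssup_non_measurable[of g M] esssup_non_measurable[of h M]
    by (cases "g \<in> borel_measurable M") auto
  moreover have "(\<integral>\<^sup>+ x. enn_powr (g x) (enn2real p) \<partial>M) = (\<integral>\<^sup>+ x. enn_powr (h x) (enn2real p) \<partial>M)"
    using assms(1) by (intro nn_integral_cong_AE) (auto elim: eventually_mono)
  ultimately show ?thesis
    by (simp add: Lp_qnorm_def)
qed

lemma Lp_qnorm_cong:
  assumes "\<And>x. x \<in> space M \<Longrightarrow> g x = h x"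
  shows "Lp_qnorm p M g = Lp_qnorm p M h"
  using assms by (intro Lp_qnorm_cong_AE AE_I2 measurable_cong)

definition grid_cubes :: "real \<Rightarrow> real^'n \<Rightarrow> (int^'n) set" where
  "grid_cubes r x = {l. \<forall>i. \<bar>real_of_int (l $ i) - r * x $ i\<bar> \<le> 1}"

lemma cubes_at_eq_grid_cubes: "cubes_at k x = grid_cubes (2 ^ k) x"
  by (simp add: cubes_at_def dcube_scaled grid_cubes_def)

lemma finite_grid_cubes: "finite (grid_cubes r (x :: real^'n::finite))"
  unfolding grid_cubes_def by (rule card_int_box) simp

text \<open>
  The sample points must lie in \<open>\<Omega>\<close>, since the pieces of a Lipschitz representation are
  controlled only there.
\<close>

definition sample_point :: "(real^'n) set \<Rightarrow> real \<Rightarrow> int^'n \<Rightarrow> real^'n" where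
  "sample_point \<Omega> r l = (SOME x. x \<in> \<Omega> \<and> l \<in> grid_cubes r x)"

lemma sample_point:
  assumes "x \<in> \<Omega>" "l \<in> grid_cubes r x"
  shows "sample_point \<Omega> r l \<in> \<Omega>" "l \<in> grid_cubes r (sample_point \<Omega> r l)"
  using someI[of "\<lambda>x. x \<in> \<Omega> \<and> l \<in> grid_cubes r x" x] assms by (auto simp: sample_point_def)

definition quasi_interpolant ::
    "(real \<Rightarrow> real) \<Rightarrow> (real^'n) set \<Rightarrow> real \<Rightarrow> (real^'n \<Rightarrow> complex) \<Rightarrow> real^'n \<Rightarrow> complex" where
  "quasi_interpolant h \<Omega> r F x =
     (\<Sum>l\<in>grid_cubes r x. of_real (\<Prod>i\<in>UNIV. h (r * x $ i - real_of_int (l $ i))) * F (sample_point \<Omega> r l))"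

text \<open>
  If the series \<open>f = \<Sum> u\<^sub>j\<close> has partial sums \<open>F\<^sub>k\<close>, then \<open>f\<close> is the telescoping sum of the
  differences of the quasi-interpolants of \<open>F\<^bsub>k+1\<^esub>\<close> at scale \<open>2\<^bsup>-k\<^esup>\<close> and of \<open>F\<^sub>k\<close> at
  twice that scale. On \<open>\<Omega>\<close>, where both families of bumps add up to \<open>1\<close>, such a
  difference is a sum of products of bumps with coefficients
  \<open>F\<^bsub>k+1\<^esub>(X) - F\<^sub>k(X')\<close> at neighbouring sample points. The Lipschitz bounds for
  \<open>u\<^sub>0, \<dots>, u\<^bsub>k-1\<^esub>\<close> make these coefficients small.
\<close>

lemma lip_rep_imp_atomic_rep:
  assumes "0 < p" "0 < q" "0 < s" "s < 1" "1 \<le> d"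
  obtains C :: real where "0 < C"
    "\<And>(\<Omega> :: (real^'n::finite) set) f lam u. \<Omega> \<in> sets lebesgue \<Longrightarrow> lip_rep \<Omega> f lam u \<Longrightarrow> coef_qnorm s p q lam < \<infinity> \<Longrightarrow>
      (\<exists>mu a. atomic_rep d K p \<Omega> f mu a \<and> b_qnorm s p q \<Omega> mu \<le> ennreal C * coef_qnorm s p q lam)"
proof -
  define n where "n = real CARD('n)"
  have n1: "1 \<le> n"
    by (simp add: n_def Suc_le_eq)
  obtain h :: "real \<Rightarrow> real" and D :: real where D: "0 < D"
    and h: "\<And>t. \<bar>t\<bar> \<ge> 1 \<Longrightarrow> h t = 0" "\<And>t. 0 \<le> h t" "\<And>t. h t \<le> 1"
      "\<And>t. (\<Sum>z\<in>{z::int. \<bar>real_of_int z - t\<bar> \<le> 1}. h (t - real_of_int z)) = 1"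
    and atoms: "\<And>(V :: (int^'n) set) c k l d. 1 \<le> d \<Longrightarrow> D * (\<Sum>v\<in>V. cmod (c v)) \<le> 1 \<Longrightarrow>
      is_atom d K k l (\<lambda>x. \<Sum>v\<in>V. c v * complex_of_real
        (\<Prod>i\<in>UNIV. h (2 ^ k * x $ i - real_of_int (l $ i)) * h (2 ^ k / 2 * x $ i - real_of_int (v $ i))))"
    by (rule atoms_from_bumps[where K = K and 'n = 'n]) (rule that)
  obtain Cm :: real where Cm: "0 < Cm"
    "\<And>(\<Omega> :: (real^'n) set) lam mu c. (\<And>j m. 0 \<le> lam j m) \<Longrightarrow> 0 \<le> c \<Longrightarrow>
      (\<And>k l. l \<in> cube_indices \<Omega> k \<Longrightarrow>
         cmod (mu k l) \<le> c * (\<Sum>j\<le>k. (\<Sum>m\<in>near_cubes j k l. lam j m) / 2 ^ (k - j))) \<Longrightarrow>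
      b_qnorm s p q \<Omega> mu \<le> ennreal (Cm * c) * coef_qnorm s p q lam"
    using b_qnorm_multiscale[OF assms(1,2,4), where 'n = 'n] by blast
  define \<eta> where "\<eta> r l x = (\<Prod>i\<in>UNIV. h (r * x $ i - real_of_int (l $ i)))" for r and l :: "int^'n" and x :: "real^'n"
  have \<eta>_nonneg: "0 \<le> \<eta> r l x" for r l x
    unfolding \<eta>_def by (intro prod_nonneg ballI h(2))
  have \<eta>_sum: "(\<Sum>l\<in>grid_cubes r x. \<eta> r l x) = 1" for r x
    unfolding \<eta>_def grid_cubes_def by (rule tensor_partition_of_unity[OF h(4)])
  have \<eta>_zero: "\<eta> r l x = 0" if "\<bar>r * x $ i - real_of_int (l $ i)\<bar> \<ge> 1" for r l x i
    using h(1)[OF that] by (auto simp: \<eta>_def)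
  have \<eta>_off: "\<eta> r l x = 0" if off: "l \<notin> grid_cubes r x" for r l x
  proof -
    obtain i where "\<not> \<bar>real_of_int (l $ i) - r * x $ i\<bar> \<le> 1"
      using off by (auto simp: grid_cubes_def)
    then show ?thesis
      by (intro \<eta>_zero[of r x i l]) linarith
  qed
  \<comment> \<open>Coarse indices \<open>v\<close> whose bump overlaps the fine bump \<open>l\<close>: then \<open>\<bar>2 v - l\<bar> < 3\<close>, hence \<open>\<le> 2\<close>.\<close>
  define V where "V l = {v::int^'n. \<forall>i. \<bar>real_of_int (v $ i) - real_of_int (l $ i) / 2\<bar> \<le> 1}" for l :: "int^'n"
  have V: "finite (V l)" "real (card (V l)) \<le> 3 ^ CARD('n)" for l
    using card_int_box[of 1 "\<lambda>i. real_of_int (l $ i) / 2"] by (simp_all add: V_def)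
  \<comment> \<open>\<open>D\<close> normalizes the atoms, \<open>3\<^sup>n\<close> bounds the size of \<open>V\<close>, and \<open>12 n\<close> is twice the distance \<open>6 n 2\<^bsup>-k\<^esup>\<close> of sample points.\<close>
  define c0 where "c0 = D * (3 ^ CARD('n) * (12 * n))"
  have c0: "0 \<le> c0" using D n1 by (simp add: c0_def)
  show ?thesis
  proof (rule that[of "Cm * c0 + 1"])
    show "0 < Cm * c0 + 1"
      using Cm(1) c0 by (simp add: add_nonneg_pos)
    fix \<Omega> :: "(real^'n) set" and f :: "real^'n \<Rightarrow> complex" and lam u
    assume \<Omega>: "\<Omega> \<in> sets lebesgue" and rep: "lip_rep \<Omega> f lam u" and fin: "coef_qnorm s p q lam < \<infinity>"
    have lam0: "0 \<le> lam j m" for j m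
      using rep by (simp add: lip_rep_def)
    have ub: "cmod (u j x) \<le> cover_sum (lam j) j x" if "x \<in> \<Omega>" for j x
      using rep that by (simp add: lip_rep_def)
    have ul: "cmod (u j x - u j y) \<le> 2 ^ j * norm (x - y) * (cover_sum (lam j) j x + cover_sum (lam j) j y)"
      if "x \<in> \<Omega>" "y \<in> \<Omega>" for j x y
      using rep that by (simp add: lip_rep_def)
    define F where "F k x = (\<Sum>j<k. u j x)" for k x
    define X where "X = sample_point \<Omega>"
    define I where "I k = cube_indices \<Omega> k" for k
    \<comment> \<open>For \<open>k = 0\<close> the coarse scale is \<open>1/2\<close>; it contributes nothing because \<open>F 0 = 0\<close>.\<close>
    define G where "G k = {v. \<exists>x\<in>\<Omega>. v \<in> grid_cubes (2 ^ k / 2) x}" for k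
    define c where "c k l v = (if v \<in> G k then F (Suc k) (X (2 ^ k) l) - F k (X (2 ^ k / 2) v) else 0)" for k l v
    define mu where "mu k l = (if l \<in> I k then D * (\<Sum>v\<in>V l. cmod (c k l v)) else 0)" for k l
    \<comment> \<open>If \<open>mu k l = 0\<close>, all \<open>c k l v\<close> vanish and the quotient \<open>0 / 0 = 0\<close> gives the zero atom.\<close>
    define a where "a k l x = (\<Sum>v\<in>V l. c k l v / of_real (mu k l) * complex_of_real
        (\<Prod>i\<in>UNIV. h (2 ^ k * x $ i - real_of_int (l $ i)) * h (2 ^ k / 2 * x $ i - real_of_int (v $ i))))" for k l x
    define T where "T k = quasi_interpolant h \<Omega> (2 ^ k / 2) (F k)" for k
    define g where "g k x = T (Suc k) x - T k x" for k x
    have mu0: "0 \<le> mu k l" for k l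
      using D by (simp add: mu_def sum_nonneg)
    have near: "cover_sum (lam j) j x \<le> (\<Sum>m\<in>near_cubes j k l. lam j m)"
      if "j \<le> k" "\<And>i. \<bar>2 ^ k * x $ i - real_of_int (l $ i)\<bar> \<le> 4" for j k l x
    proof -
      have "cubes_at j x \<subseteq> near_cubes j k l"
      proof
        fix m assume m: "m \<in> cubes_at j x"
        have "\<bar>real_of_int (m $ i) / 2 ^ j - real_of_int (l $ i) / 2 ^ k\<bar> \<le> 5 / 2 ^ j" for i
        proof -
          have 1: "\<bar>x $ i - real_of_int (m $ i) / 2 ^ j\<bar> \<le> 1 / 2 ^ j"
            using m by (simp add: cubes_at_def dcube_def)
          have "x $ i - real_of_int (l $ i) / 2 ^ k = (2 ^ k * x $ i - real_of_int (l $ i)) / 2 ^ k"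
            by (simp add: field_simps)
          then have "\<bar>x $ i - real_of_int (l $ i) / 2 ^ k\<bar> \<le> 4 / 2 ^ k"
            using that(2)[of i] by (simp add: abs_divide divide_right_mono)
          also have "\<dots> \<le> 4 / 2 ^ j"
            using that(1) by (intro divide_left_mono) (auto simp: power_increasing)
          finally have "\<bar>x $ i - real_of_int (l $ i) / 2 ^ k\<bar> \<le> 4 / 2 ^ j" .
          moreover have "5 / 2 ^ j = 4 / 2 ^ j + (1::real) / 2 ^ j"
            by (simp add: add_divide_distrib[symmetric])
          ultimately show ?thesis using 1 by linarith
        qed
        then show "m \<in> near_cubes j k l" by (simp add: near_cubes_def)
      qed
      then show ?thesis
        unfolding cover_sum_def using card_near_cubes(1)[OF that(1)] lam0 by (intro sum_mono2) auto
    qed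
    have Xl: "X (2 ^ k) l \<in> \<Omega>" "\<bar>2 ^ k * X (2 ^ k) l $ i - real_of_int (l $ i)\<bar> \<le> 1" if l: "l \<in> I k" for k l i
    proof -
      obtain x where x: "x \<in> \<Omega>" "l \<in> grid_cubes (2 ^ k) x"
        using l by (auto simp: I_def cube_indices_def cubes_at_eq_grid_cubes[symmetric] cubes_at_def)
      show "X (2 ^ k) l \<in> \<Omega>"
        unfolding X_def by (rule sample_point(1)[OF x])
      show "\<bar>2 ^ k * X (2 ^ k) l $ i - real_of_int (l $ i)\<bar> \<le> 1"
        using sample_point(2)[OF x] by (simp add: X_def grid_cubes_def abs_minus_commute)
    qed
    have Xv: "X (2 ^ k / 2) v \<in> \<Omega>" "\<bar>2 ^ k * X (2 ^ k / 2) v $ i - 2 * real_of_int (v $ i)\<bar> \<le> 2" if v: "v \<in> G k" for k v i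
    proof -
      obtain x where x: "x \<in> \<Omega>" "v \<in> grid_cubes (2 ^ k / 2) x"
        using v by (auto simp: G_def)
      show "X (2 ^ k / 2) v \<in> \<Omega>"
        unfolding X_def by (rule sample_point(1)[OF x])
      have "\<bar>real_of_int (v $ i) - 2 ^ k / 2 * X (2 ^ k / 2) v $ i\<bar> \<le> 1"
        using sample_point(2)[OF x] by (simp add: X_def grid_cubes_def)
      then show "\<bar>2 ^ k * X (2 ^ k / 2) v $ i - 2 * real_of_int (v $ i)\<bar> \<le> 2"
        by linarith
    qed
    have c_bound: "cmod (c k l v) \<le> 12 * n * (\<Sum>j\<le>k. (\<Sum>m\<in>near_cubes j k l. lam j m) / 2 ^ (k - j))"
      if l: "l \<in> I k" and v: "v \<in> V l" for k l v
    proof (cases "v \<in> G k")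
      case True
      define x where "x = X (2 ^ k) l"
      define y where "y = X (2 ^ k / 2) v"
      have xy: "x \<in> \<Omega>" "y \<in> \<Omega>"
        using Xl[OF l] Xv[OF True] by (auto simp: x_def y_def)
      have xl: "\<bar>2 ^ k * x $ i - real_of_int (l $ i)\<bar> \<le> 1" for i
        using Xl[OF l] by (simp add: x_def)
      have yl: "\<bar>2 ^ k * y $ i - real_of_int (l $ i)\<bar> \<le> 4" for i
      proof -
        have "\<bar>2 ^ k * y $ i - 2 * real_of_int (v $ i)\<bar> \<le> 2"
          using Xv[OF True] by (simp add: y_def)
        moreover have "\<bar>real_of_int (v $ i) - real_of_int (l $ i) / 2\<bar> \<le> 1"
          using v by (simp add: V_def)
        ultimately show ?thesis by linarith
      qed
      have dist: "norm (x - y) \<le> 6 * n / 2 ^ k"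
      proof -
        have "\<bar>(x - y) $ i\<bar> \<le> 6 / 2 ^ k" for i
        proof -
          have "\<bar>2 ^ k * x $ i - 2 ^ k * y $ i\<bar> \<le> 6"
            using xl[of i] yl[of i] by linarith
          then have "2 ^ k * \<bar>x $ i - y $ i\<bar> \<le> 6"
            by (simp add: abs_mult flip: right_diff_distrib)
          then show ?thesis
            by (simp add: field_simps)
        qed
        from norm_le_card_mult[OF this] show ?thesis
          by (simp add: n_def mult.commute)
      qed
      define N where "N j = (\<Sum>m\<in>near_cubes j k l. lam j m)" for j
      have N0: "0 \<le> N j" for j
        unfolding N_def by (intro sum_nonneg lam0)
      have cx: "cover_sum (lam j) j x \<le> N j" "cover_sum (lam j) j y \<le> N j" if "j \<le> k" for j
        unfolding N_def using near[OF that, of x l] near[OF that, of y l] xl yl by (force intro: order_trans)+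
      have "c k l v = u k x + (\<Sum>j<k. u j x - u j y)"
        using True by (simp add: c_def F_def x_def y_def sum_subtractf)
      then have "cmod (c k l v) \<le> cmod (u k x) + cmod (\<Sum>j<k. u j x - u j y)"
        by (simp only: norm_triangle_ineq)
      also have "\<dots> \<le> cmod (u k x) + (\<Sum>j<k. cmod (u j x - u j y))"
        by (intro add_left_mono norm_sum)
      also have "\<dots> \<le> 12 * n * N k + (\<Sum>j<k. 12 * n * (N j / 2 ^ (k - j)))"
      proof (intro add_mono sum_mono)
        have "cmod (u k x) \<le> 1 * N k"
          using ub[OF xy(1), of k] cx(1)[of k] by simp
        also have "\<dots> \<le> 12 * n * N k"
          using n1 N0 by (intro mult_right_mono) auto
        finally show "cmod (u k x) \<le> 12 * n * N k" .
        fix j assume "j \<in> {..<k}"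
        then have j: "j \<le> k" by simp
        have "cmod (u j x - u j y) \<le> 2 ^ j * norm (x - y) * (cover_sum (lam j) j x + cover_sum (lam j) j y)"
          by (rule ul[OF xy])
        also have "\<dots> \<le> 2 ^ j * (6 * n / 2 ^ k) * (N j + N j)"
          using dist cx[OF j] lam0 n1 by (intro mult_mono add_mono mult_left_mono add_nonneg_nonneg cover_sum_nonneg) auto
        also have "\<dots> = 12 * n * (N j / 2 ^ (k - j))"
          using j by (simp add: power_diff field_simps)
        finally show "cmod (u j x - u j y) \<le> 12 * n * (N j / 2 ^ (k - j))" .
      qed
      also have "\<dots> = 12 * n * (\<Sum>j\<le>k. N j / 2 ^ (k - j))"
        by (simp add: lessThan_Suc_atMost[symmetric] sum_distrib_left algebra_simps)
      finally show ?thesis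
        by (simp add: N_def)
    next
      case False
      then show ?thesis
        using n1 lam0 by (simp add: c_def sum_nonneg)
    qed
    have mu_bound: "cmod (complex_of_real (mu k l)) \<le> c0 * (\<Sum>j\<le>k. (\<Sum>m\<in>near_cubes j k l. lam j m) / 2 ^ (k - j))" for k l
    proof (cases "l \<in> I k")
      case True
      define S where "S = (\<Sum>j\<le>k. (\<Sum>m\<in>near_cubes j k l. lam j m) / 2 ^ (k - j))"
      have S0: "0 \<le> S"
        unfolding S_def using lam0 by (simp add: sum_nonneg)
      have "(\<Sum>v\<in>V l. cmod (c k l v)) \<le> real (card (V l)) * (12 * n * S)"
        using c_bound[OF True] by (intro sum_bounded_above) (simp add: S_def)
      also have "\<dots> \<le> 3 ^ CARD('n) * (12 * n * S)"
        using V(2)[of l] n1 S0 by (intro mult_right_mono) auto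
      finally have "D * (\<Sum>v\<in>V l. cmod (c k l v)) \<le> D * (3 ^ CARD('n) * (12 * n * S))"
        using D by (intro mult_left_mono) auto
      then have "mu k l \<le> c0 * S"
        using True by (simp add: mu_def c0_def mult.assoc)
      moreover have "cmod (complex_of_real (mu k l)) = mu k l"
        using mu0[of k l] by simp
      ultimately show ?thesis
        by (simp only: S_def)
    next
      case False
      then show ?thesis
        using c0 lam0 by (simp add: mu_def sum_nonneg)
    qed
    have mu_cancel: "of_real (mu k l) * (c k l v / of_real (mu k l)) = c k l v" if l: "l \<in> I k" and v: "v \<in> V l" for k l v
    proof (cases "mu k l = 0")
      case True
      then have "(\<Sum>v\<in>V l. cmod (c k l v)) = 0"
        using D l by (simp add: mu_def)
      then have "cmod (c k l v) = 0"
        using v V(1) by (subst (asm) sum_nonneg_eq_0_iff) auto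
      then show ?thesis using True by simp
    qed simp
    have atom: "is_atom d K k l (a k l)" for k l
      unfolding a_def[abs_def]
    proof (rule atoms[OF assms(5)])
      show "D * (\<Sum>v\<in>V l. cmod (c k l v / of_real (mu k l))) \<le> 1"
      proof (cases "mu k l = 0")
        case False
        then have "mu k l = D * (\<Sum>v\<in>V l. cmod (c k l v))"
          by (auto simp: mu_def split: if_splits)
        moreover have "D * (\<Sum>v\<in>V l. cmod (c k l v / of_real (mu k l))) = D * (\<Sum>v\<in>V l. cmod (c k l v)) / mu k l"
          using mu0[of k l] by (simp add: norm_divide flip: sum_divide_distrib)
        ultimately show ?thesis using False by simp
      qed simp
    qed
    have a1: "cmod (a k l x) \<le> 1" for k l x
    proof -
      have "\<forall>\<alpha> x. length \<alpha> \<le> K \<longrightarrow> cmod (iter_partial \<alpha> (a k l) x) \<le> 2 ^ (length \<alpha> * k)"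
        using atom[of k l] by (simp add: is_atom_def)
      from this[rule_format, of "[]" x] show ?thesis
        by (simp add: iter_partial_def)
    qed
    have a_off: "a k l x = 0" if "l \<notin> cubes_at k x" for k l x
    proof -
      have "\<eta> (2 ^ k) l x = 0"
        using that by (intro \<eta>_off) (simp add: cubes_at_eq_grid_cubes)
      then show ?thesis
        by (simp add: a_def \<eta>_def prod.distrib del: prod_zero_iff)
    qed
    have sum_I: "(\<Sum>\<^sub>\<infinity>l\<in>I k. of_real (mu k l) * a k l x) = (\<Sum>l\<in>cubes_at k x. of_real (mu k l) * a k l x)"
      if "x \<in> \<Omega>" for k x
    proof -
      have "(\<Sum>\<^sub>\<infinity>l\<in>I k. of_real (mu k l) * a k l x) = (\<Sum>\<^sub>\<infinity>l\<in>cubes_at k x. of_real (mu k l) * a k l x)"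
        using cubes_at_subset[OF that, of k] a_off by (intro infsum_cong_neutral) (auto simp: I_def)
      then show ?thesis
        by (simp only: infsum_finite[OF card_cubes_at(1)])
    qed
    have g_eq: "g k x = (\<Sum>l\<in>cubes_at k x. of_real (mu k l) * a k l x)" if x: "x \<in> \<Omega>" for k x
    proof -
      let ?A = "grid_cubes (2 ^ k) x" and ?B = "grid_cubes (2 ^ k / 2) x"
      let ?p = "\<lambda>l. complex_of_real (\<eta> (2 ^ k) l x)" and ?q = "\<lambda>v. complex_of_real (\<eta> (2 ^ k / 2) v x)"
      let ?f = "\<lambda>l. F (Suc k) (X (2 ^ k) l)" and ?f' = "\<lambda>v. F k (X (2 ^ k / 2) v)"
      have lvl: "of_real (mu k l) * a k l x = (\<Sum>v\<in>?B. (?f l - ?f' v) * (?p l * ?q v))" if l: "l \<in> ?A" for l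
      proof -
        have lI: "l \<in> I k"
          using l cubes_at_subset[OF x, of k] by (auto simp: I_def cubes_at_eq_grid_cubes)
        have BG: "v \<in> G k" if "v \<in> ?B" for v
          using x that by (auto simp: G_def)
        have "of_real (mu k l) * a k l x = (\<Sum>v\<in>V l. (of_real (mu k l) * (c k l v / of_real (mu k l))) * (?p l * ?q v))"
          by (simp only: a_def sum_distrib_left \<eta>_def prod.distrib of_real_mult mult.assoc)
        also have "\<dots> = (\<Sum>v\<in>V l. c k l v * (?p l * ?q v))"
          using mu_cancel[OF lI] by (intro sum.cong) auto
        also have "\<dots> = (\<Sum>v\<in>V l \<inter> ?B. c k l v * (?p l * ?q v))"
          using V(1) \<eta>_off[of _ "2 ^ k / 2" x] by (intro sum.mono_neutral_right) auto
        also have "\<dots> = (\<Sum>v\<in>V l \<inter> ?B. (?f l - ?f' v) * (?p l * ?q v))"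
          using BG by (intro sum.cong) (auto simp: c_def)
        also have "\<dots> = (\<Sum>v\<in>?B. (?f l - ?f' v) * (?p l * ?q v))"
        proof (intro sum.mono_neutral_left finite_grid_cubes ballI)
          fix v assume v: "v \<in> ?B - V l \<inter> ?B"
          then obtain i where i: "\<not> \<bar>real_of_int (v $ i) - real_of_int (l $ i) / 2\<bar> \<le> 1"
            by (auto simp: V_def)
          have "\<eta> (2 ^ k) l x = 0 \<or> \<eta> (2 ^ k / 2) v x = 0"
          proof (rule ccontr)
            assume "\<not> ?thesis"
            then have "\<bar>2 ^ k * x $ i - real_of_int (l $ i)\<bar> < 1" "\<bar>2 ^ k / 2 * x $ i - real_of_int (v $ i)\<bar> < 1"
              using \<eta>_zero[of "2 ^ k" x i l] \<eta>_zero[of "2 ^ k / 2" x i v] by (auto simp: not_le[symmetric])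
            then have "real_of_int \<bar>2 * v $ i - l $ i\<bar> < real_of_int 3"
              by simp
            moreover have "real_of_int 2 < real_of_int \<bar>2 * v $ i - l $ i\<bar>"
              using i by simp
            ultimately show False
              unfolding of_int_less_iff
              by linarith
          qed
          then show "(?f l - ?f' v) * (?p l * ?q v) = 0"
            by auto
        qed auto
        finally show ?thesis .
      qed
      have q1: "(\<Sum>v\<in>?B. ?q v) = 1" and p1: "(\<Sum>l\<in>?A. ?p l) = 1"
        by (simp_all only: of_real_sum[symmetric] \<eta>_sum of_real_1)
      have "(\<Sum>l\<in>?A. of_real (mu k l) * a k l x) = (\<Sum>l\<in>?A. \<Sum>v\<in>?B. (?f l - ?f' v) * (?p l * ?q v))"
        by (intro sum.cong lvl) auto
      also have "\<dots> = (\<Sum>l\<in>?A. \<Sum>v\<in>?B. (?p l * ?f l) * ?q v) - (\<Sum>l\<in>?A. \<Sum>v\<in>?B. ?p l * (?q v * ?f' v))"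
        by (simp add: algebra_simps sum_subtractf)
      also have "\<dots> = (\<Sum>l\<in>?A. ?p l * ?f l) * (\<Sum>v\<in>?B. ?q v) - (\<Sum>l\<in>?A. ?p l) * (\<Sum>v\<in>?B. ?q v * ?f' v)"
        by (simp only: sum_product)
      also have "\<dots> = T (Suc k) x - T k x"
        unfolding q1 p1 by (simp add: T_def quasi_interpolant_def \<eta>_def X_def)
      finally show ?thesis
        by (simp add: g_def cubes_at_eq_grid_cubes)
    qed
    have g_bound: "cmod (g k x) \<le> cover_sum (mu k) k x" if x: "x \<in> \<Omega>" for k x
    proof -
      have "cmod (g k x) \<le> (\<Sum>l\<in>cubes_at k x. cmod (of_real (mu k l) * a k l x))"
        unfolding g_eq[OF x] by (rule norm_sum)
      also have "\<dots> \<le> (\<Sum>l\<in>cubes_at k x. mu k l)"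
        using mu0 a1 by (intro sum_mono) (simp add: norm_mult mult_left_le)
      finally show ?thesis
        by (simp add: cover_sum_def)
    qed
    have b1: "b_qnorm s p q \<Omega> (\<lambda>k l. complex_of_real (mu k l)) \<le> ennreal (Cm * c0) * coef_qnorm s p q lam"
      by (rule Cm(2)[where lam = lam, OF lam0 c0 mu_bound])
    have b2: "coef_qnorm s p q mu \<le> ennreal (Cm * c0) * coef_qnorm s p q lam"
      unfolding coef_qnorm_def[of s p q mu] by (rule Cm(2)[where lam = lam, OF lam0 c0 mu_bound])
    have fin2: "coef_qnorm s p q mu < \<infinity>"
      using fin by (intro le_less_trans[OF b2]) (simp add: ennreal_mult_less_top)
    \<comment> \<open>A locally finite sum of continuous functions is the limit of its sums over growing boxes.\<close>
    have g_meas: "g k \<in> borel_measurable (lebesgue_on \<Omega>)" for k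
    proof (rule borel_measurable_LIMSEQ_metric)
      define box where "box R = {l::int^'n. \<forall>i. \<bar>real_of_int (l $ i) - 0\<bar> \<le> real R}" for R :: nat
      have fin_box: "finite (box R)" for R
        unfolding box_def by (rule card_int_box) simp
      show "(\<lambda>x. \<Sum>l\<in>box R. of_real (mu k l) * a k l x) \<in> borel_measurable (lebesgue_on \<Omega>)" for R
      proof (rule continuous_imp_measurable_on_sets_lebesgue[OF _ \<Omega>])
        have "continuous_on \<Omega> (a k l)" for l
        proof -
          have "\<forall>\<alpha>. length \<alpha> \<le> K \<longrightarrow> continuous_on UNIV (iter_partial \<alpha> (a k l))"
            using atom[of k l] by (simp add: is_atom_def class_C_def)
          from this[rule_format, of "[]"] have "continuous_on UNIV (a k l)"
            by (simp add: iter_partial_def)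
          then show ?thesis
            by (rule continuous_on_subset) simp
        qed
        then show "continuous_on \<Omega> (\<lambda>x. \<Sum>l\<in>box R. of_real (mu k l) * a k l x)"
          by (intro continuous_on_sum continuous_on_mult continuous_on_const)
      qed
      fix x assume "x \<in> space (lebesgue_on \<Omega>)"
      then have x: "x \<in> \<Omega>" by simp
      define R0 where "R0 = nat \<lceil>\<Sum>l\<in>cubes_at k x. \<Sum>i\<in>UNIV. \<bar>real_of_int (l $ i)\<bar>\<rceil>"
      have sub: "cubes_at k x \<subseteq> box R" if "R0 \<le> R" for R
      proof
        fix l assume l: "l \<in> cubes_at k x"
        have "\<bar>real_of_int (l $ i)\<bar> \<le> real R" for i
        proof -
          have "\<bar>real_of_int (l $ i)\<bar> \<le> (\<Sum>i\<in>UNIV. \<bar>real_of_int (l $ i)\<bar>)"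
            by (intro member_le_sum) auto
          also have "\<dots> \<le> (\<Sum>l\<in>cubes_at k x. \<Sum>i\<in>UNIV. \<bar>real_of_int (l $ i)\<bar>)"
            using l card_cubes_at(1)
            by (intro member_le_sum[where f = "\<lambda>l. \<Sum>i\<in>UNIV. \<bar>real_of_int (l $ i)\<bar>"]) (auto intro: sum_nonneg)
          also have "\<dots> \<le> real R0"
            unfolding R0_def by (rule real_nat_ceiling_ge)
          finally show ?thesis using that by linarith
        qed
        then show "l \<in> box R" by (simp add: box_def)
      qed
      have "(\<Sum>l\<in>box R. of_real (mu k l) * a k l x) = g k x" if "R0 \<le> R" for R
        unfolding g_eq[OF x] using sub[OF that] fin_box a_off by (intro sum.mono_neutral_right) auto
      then show "(\<lambda>R. \<Sum>l\<in>box R. of_real (mu k l) * a k l x) \<longlonglongrightarrow> g k x"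
        by (intro tendsto_eventually) (auto simp: eventually_sequentially)
    qed
    \<comment> \<open>The sample points near \<open>x\<close> see coefficients of neighbouring cubes, collected in \<open>lam'\<close>.\<close>
    define lam' where "lam' j m = (\<Sum>m'\<in>near_cubes j j m. lam j m')" for j m
    have lam'0: "0 \<le> lam' j m" for j m
      unfolding lam'_def by (intro sum_nonneg lam0)
    have "coef_qnorm s p q lam' \<le> ennreal (Cm * 1) * coef_qnorm s p q lam"
      unfolding coef_qnorm_def[of s p q lam']
    proof (rule Cm(2)[where lam = lam, OF lam0])
      fix k l
      have "cmod (complex_of_real (lam' k l)) = (\<Sum>m\<in>near_cubes k k l. lam k m) / 2 ^ (k - k)"
        using lam'0[of k l] by (simp add: lam'_def del: of_real_sum)
      also have "\<dots> \<le> (\<Sum>j\<le>k. (\<Sum>m\<in>near_cubes j k l. lam j m) / 2 ^ (k - j))"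
        using lam0 by (intro member_le_sum[where f = "\<lambda>j. (\<Sum>m\<in>near_cubes j k l. lam j m) / 2 ^ (k - j)"])
          (auto intro!: sum_nonneg divide_nonneg_nonneg)
      finally show "cmod (complex_of_real (lam' k l)) \<le> 1 * (\<Sum>j\<le>k. (\<Sum>m\<in>near_cubes j k l. lam j m) / 2 ^ (k - j))"
        by simp
    qed simp
    also have "\<dots> < \<infinity>"
      using fin by (simp add: ennreal_mult_less_top)
    finally have fin': "coef_qnorm s p q lam' < \<infinity>" .
    have approx: "cmod (F J x - T J x) \<le> 8 * n * (\<Sum>j<J. cover_sum (lam' j) j x / 2 ^ (J - j))" if x: "x \<in> \<Omega>" for J x
    proof -
      let ?B = "grid_cubes (2 ^ J / 2) x"
      let ?q = "\<lambda>v. \<eta> (2 ^ J / 2) v x"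
      define S where "S = 8 * n * (\<Sum>j<J. cover_sum (lam' j) j x / 2 ^ (J - j))"
      have pt: "cmod (F J x - F J (X (2 ^ J / 2) v)) \<le> S" if v: "v \<in> ?B" for v
      proof -
        define y where "y = X (2 ^ J / 2) v"
        have vG: "v \<in> G J"
          using x v by (auto simp: G_def)
        have y: "y \<in> \<Omega>"
          using Xv(1)[OF vG] by (simp add: y_def)
        have xy: "\<bar>2 ^ J * x $ i - 2 ^ J * y $ i\<bar> \<le> 4" for i
        proof -
          have "\<bar>2 ^ J * y $ i - 2 * real_of_int (v $ i)\<bar> \<le> 2"
            using Xv(2)[OF vG] by (simp add: y_def)
          moreover have "\<bar>real_of_int (v $ i) - 2 ^ J / 2 * x $ i\<bar> \<le> 1"
            using v by (simp add: grid_cubes_def)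
          ultimately show ?thesis by linarith
        qed
        then have xy': "\<bar>x $ i - y $ i\<bar> \<le> 4 / 2 ^ J" for i
        proof -
          have "2 ^ J * \<bar>x $ i - y $ i\<bar> \<le> 4"
            using xy[of i] by (simp add: abs_mult flip: right_diff_distrib)
          then show ?thesis by (simp add: field_simps)
        qed
        have dist: "norm (x - y) \<le> 4 * n / 2 ^ J"
          using norm_le_card_mult[of "x - y" "4 / 2 ^ J"] xy' by (simp add: n_def mult.commute)
        have cov: "cover_sum (lam j) j z \<le> cover_sum (lam' j) j x"
          if j: "j < J" and z: "\<And>i. \<bar>x $ i - z $ i\<bar> \<le> 4 / 2 ^ J" for j z
        proof -
          obtain m where m: "m \<in> cubes_at j x"
            by (rule cubes_at_nonempty)
          have "\<bar>2 ^ j * z $ i - real_of_int (m $ i)\<bar> \<le> 4" for i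
          proof -
            have "2 ^ j * \<bar>x $ i - z $ i\<bar> \<le> 2 ^ j * (4 / 2 ^ J)"
              by (intro mult_left_mono z) auto
            also have "\<dots> \<le> 2 ^ j * (4 / 2 ^ Suc j)"
              using j by (intro mult_left_mono divide_left_mono power_increasing) auto
            finally have "2 ^ j * \<bar>x $ i - z $ i\<bar> \<le> 2"
              by simp
            then have "\<bar>2 ^ j * x $ i - 2 ^ j * z $ i\<bar> \<le> 2"
              by (simp add: abs_mult flip: right_diff_distrib)
            moreover have "\<bar>real_of_int (m $ i) - 2 ^ j * x $ i\<bar> \<le> 1"
              using m by (simp add: cubes_at_def dcube_scaled)
            ultimately show ?thesis by linarith
          qed
          then have "cover_sum (lam j) j z \<le> lam' j m"
            unfolding lam'_def by (intro near) auto
          also have "\<dots> \<le> cover_sum (lam' j) j x"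
            unfolding cover_sum_def using m lam'0 card_cubes_at(1) by (intro member_le_sum) auto
          finally show ?thesis .
        qed
        have "cmod (F J x - F J y) \<le> (\<Sum>j<J. cmod (u j x - u j y))"
          unfolding F_def sum_subtractf[symmetric] by (rule norm_sum)
        also have "\<dots> \<le> (\<Sum>j<J. 8 * n * (cover_sum (lam' j) j x / 2 ^ (J - j)))"
        proof (intro sum_mono)
          fix j assume "j \<in> {..<J}"
          then have j: "j < J" by simp
          have "cmod (u j x - u j y) \<le> 2 ^ j * norm (x - y) * (cover_sum (lam j) j x + cover_sum (lam j) j y)"
            by (rule ul[OF x y])
          also have "\<dots> \<le> 2 ^ j * (4 * n / 2 ^ J) * (cover_sum (lam' j) j x + cover_sum (lam' j) j x)"
            using dist cov[OF j, of x] cov[OF j, of y] xy' lam0 n1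
            by (intro mult_mono add_mono mult_left_mono add_nonneg_nonneg cover_sum_nonneg) auto
          also have "\<dots> = 8 * n * (cover_sum (lam' j) j x / 2 ^ (J - j))"
            using j by (simp add: power_diff field_simps)
          finally show "cmod (u j x - u j y) \<le> 8 * n * (cover_sum (lam' j) j x / 2 ^ (J - j))" .
        qed
        finally show ?thesis
          by (simp add: S_def y_def sum_distrib_left)
      qed
      have "F J x = (\<Sum>v\<in>?B. of_real (?q v)) * F J x"
        by (simp only: of_real_sum[symmetric] \<eta>_sum) simp
      then have "F J x - T J x = (\<Sum>v\<in>?B. of_real (?q v) * (F J x - F J (X (2 ^ J / 2) v)))"
        by (simp add: T_def quasi_interpolant_def \<eta>_def X_def right_diff_distrib sum_subtractf sum_distrib_right)
      then have "cmod (F J x - T J x) \<le> (\<Sum>v\<in>?B. ?q v * cmod (F J x - F J (X (2 ^ J / 2) v)))"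
        using \<eta>_nonneg by (simp add: norm_mult order_trans[OF norm_sum])
      also have "\<dots> \<le> (\<Sum>v\<in>?B. ?q v * S)"
        by (intro sum_mono mult_left_mono pt \<eta>_nonneg)
      also have "\<dots> = S"
        by (simp add: sum_distrib_right[symmetric] \<eta>_sum)
      finally show ?thesis by (simp add: S_def)
    qed
    have AE\<Omega>: "AE x in lebesgue_on \<Omega>. x \<in> \<Omega>"
      by (rule AE_I2) simp
    have "AE x in lebesgue_on \<Omega>. (\<lambda>j. u j x) sums f x"
      using rep by (simp add: lip_rep_def)
    then have g_sums: "AE x in lebesgue_on \<Omega>. (\<lambda>k. g k x) sums f x"
      using cover_sum_AE_summable[where lam = lam', OF assms(1-3) \<Omega> lam'0 fin'] AE\<Omega>
    proof eventually_elim
      case (elim x)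
      have "(\<lambda>J. 8 * n * (\<Sum>j<J. cover_sum (lam' j) j x / 2 ^ (J - j))) \<longlonglongrightarrow> 8 * n * 0"
        using elim(2) lam'0 by (intro tendsto_mult tendsto_const geometric_convolution_tendsto_0 cover_sum_nonneg)
      then have lim: "(\<lambda>J. 8 * n * (\<Sum>j<J. cover_sum (lam' j) j x / 2 ^ (J - j))) \<longlonglongrightarrow> 0"
        by simp
      have "(\<lambda>J. F J x - T J x) \<longlonglongrightarrow> 0"
        by (rule Lim_null_comparison[OF always_eventually lim]) (use approx[OF elim(3)] in blast)
      moreover have "(\<lambda>J. F J x) \<longlonglongrightarrow> f x"
        using elim(1) by (simp add: sums_def F_def)
      ultimately have "(\<lambda>J. F J x - (F J x - T J x)) \<longlonglongrightarrow> f x - 0"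
        by (intro tendsto_diff)
      moreover have "F J x - (F J x - T J x) = (\<Sum>k<J. g k x)" for J
      proof -
        have "T 0 x = 0"
          by (simp add: T_def quasi_interpolant_def F_def)
        then show ?thesis
          using sum_lessThan_telescope[of "\<lambda>k. T k x" J] by (simp add: g_def)
      qed
      ultimately show ?case
        by (simp add: sums_def)
    qed
    have "(\<lambda>J. Lp_qnorm p (lebesgue_on \<Omega>) (\<lambda>x. ennreal (cmod (f x - (\<Sum>k<J. g k x))))) \<longlonglongrightarrow> 0"
      by (rule Lp_convergence_of_dominated_sums[where lam = mu and g = g, OF assms(1-3) \<Omega> mu0 fin2 g_meas g_bound g_sums])
    moreover have "Lp_qnorm p (lebesgue_on \<Omega>) (\<lambda>x. ennreal (cmod (f x - (\<Sum>k<J. g k x))))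
        = Lp_qnorm p (lebesgue_on \<Omega>) (\<lambda>x. ennreal (cmod (f x -
            (\<Sum>k<J. \<Sum>\<^sub>\<infinity>l\<in>cube_indices \<Omega> k. complex_of_real (mu k l) * a k l x))))" for J
      using sum_I g_eq by (intro Lp_qnorm_cong) (simp add: I_def)
    ultimately have "atomic_rep d K p \<Omega> f (\<lambda>k l. complex_of_real (mu k l)) a"
      using atom by (simp add: atomic_rep_def)
    moreover have "b_qnorm s p q \<Omega> (\<lambda>k l. complex_of_real (mu k l)) \<le> ennreal (Cm * c0 + 1) * coef_qnorm s p q lam"
      by (rule order_trans[OF b1]) (intro mult_right_mono ennreal_leI, auto)
    ultimately show "\<exists>mu a. atomic_rep d K p \<Omega> f mu a \<and> b_qnorm s p q \<Omega> mu \<le> ennreal (Cm * c0 + 1) * coef_qnorm s p q lam"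
      by blast
  qed
qed

section \<open>The Besov quasi-norm\<close>

lemma besov_qnorm_le_lip_qnorm:
  assumes "0 < p" "0 < q" "0 < s" "s < 1" "1 \<le> d"
  obtains C :: real where "0 < C"
    "\<And>(\<Omega> :: (real^'n::finite) set) f. \<Omega> \<in> sets lebesgue \<Longrightarrow>
       besov_qnorm d K s p q \<Omega> f \<le> ennreal C * lip_qnorm s p q \<Omega> f"
proof -
  obtain C :: real where C: "0 < C"
    "\<And>(\<Omega> :: (real^'n) set) f lam u. \<Omega> \<in> sets lebesgue \<Longrightarrow> lip_rep \<Omega> f lam u \<Longrightarrow> coef_qnorm s p q lam < \<infinity> \<Longrightarrow>
      (\<exists>mu a. atomic_rep d K p \<Omega> f mu a \<and> b_qnorm s p q \<Omega> mu \<le> ennreal C * coef_qnorm s p q lam)"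
    by (rule lip_rep_imp_atomic_rep[OF assms, where K = K and 'n = 'n]) (rule that)
  show ?thesis
  proof (rule that[OF C(1)])
    fix \<Omega> :: "(real^'n) set" and f :: "real^'n \<Rightarrow> complex"
    assume \<Omega>: "\<Omega> \<in> sets lebesgue"
    show "besov_qnorm d K s p q \<Omega> f \<le> ennreal C * lip_qnorm s p q \<Omega> f"
      unfolding lip_qnorm_def
    proof (rule ennreal_le_mult_Inf[OF C(1)])
      fix t assume "t \<in> {coef_qnorm s p q lam |lam u. lip_rep \<Omega> f lam u}"
      then obtain lam u where rep: "lip_rep \<Omega> f lam u" and t: "t = coef_qnorm s p q lam"
        by auto
      show "besov_qnorm d K s p q \<Omega> f \<le> ennreal C * t"
      proof (cases "t < \<infinity>")
        case True
        then obtain mu a where a: "atomic_rep d K p \<Omega> f mu a" "b_qnorm s p q \<Omega> mu \<le> ennreal C * t"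
          using C(2)[OF \<Omega> rep] t by auto
        have "besov_qnorm d K s p q \<Omega> f \<le> b_qnorm s p q \<Omega> mu"
          unfolding besov_qnorm_def using a(1) by (intro Inf_lower) auto
        then show ?thesis using a(2) by (rule order_trans)
      next
        case False
        then have "t = \<infinity>" by (simp add: less_top[symmetric])
        then show ?thesis using C(1) by (simp add: ennreal_mult_top)
      qed
    qed
  qed
qed

text \<open>
  For \<open>p = \<infinity>\<close> the quasi-norm of a non-measurable function is \<open>\<infinity>\<close>. Hence the two remainders have to be
  measurable simultaneously, which is the completeness of Lebesgue measure.
\<close>

lemma besov_qnorm_cong_AE:
  fixes f g :: "real^'n::finite \<Rightarrow> complex"
  assumes "\<Omega> \<in> sets lebesgue" "AE x in lebesgue_on \<Omega>. f x = g x"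
  shows "besov_qnorm d K s p q \<Omega> f = besov_qnorm d K s p q \<Omega> g"
proof -
  have "Lp_qnorm p (lebesgue_on \<Omega>) (\<lambda>x. ennreal (cmod (f x - P x)))
      = Lp_qnorm p (lebesgue_on \<Omega>) (\<lambda>x. ennreal (cmod (g x - P x)))" for P
  proof (rule Lp_qnorm_cong_AE)
    show "AE x in lebesgue_on \<Omega>. ennreal (cmod (f x - P x)) = ennreal (cmod (g x - P x))"
      using assms(2) by eventually_elim simp
    have *: "(\<lambda>x. ennreal (cmod (g x - P x))) \<in> borel_measurable (lebesgue_on \<Omega>)"
      if m: "(\<lambda>x. ennreal (cmod (f x - P x))) \<in> borel_measurable (lebesgue_on \<Omega>)"
        and ae: "AE x in lebesgue_on \<Omega>. f x = g x" for f g :: "real^'n \<Rightarrow> complex"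
    proof -
      have "(\<lambda>x. enn2real (ennreal (cmod (f x - P x)))) \<in> borel_measurable (lebesgue_on \<Omega>)"
        using m by measurable
      then have "(\<lambda>x. cmod (f x - P x)) \<in> borel_measurable (lebesgue_on \<Omega>)"
        by simp
      then have "(\<lambda>x. cmod (g x - P x)) \<in> borel_measurable (lebesgue_on \<Omega>)"
        by (rule measurable_lebesgue_on_AE[OF assms(1)]) (use ae in \<open>eventually_elim, simp\<close>)
      then show ?thesis
        by measurable
    qed
    have "AE x in lebesgue_on \<Omega>. g x = f x"
      using assms(2) by eventually_elim simp
    then show "(\<lambda>x. ennreal (cmod (f x - P x))) \<in> borel_measurable (lebesgue_on \<Omega>) \<longleftrightarrow>
        (\<lambda>x. ennreal (cmod (g x - P x))) \<in> borel_measurable (lebesgue_on \<Omega>)"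
      using *[of f g] *[of g f] assms(2) by blast
  qed
  then have "atomic_rep d K p \<Omega> f = atomic_rep d K p \<Omega> g"
    by (simp add: fun_eq_iff atomic_rep_def)
  then show ?thesis
    by (simp add: besov_qnorm_def)
qed

text \<open>
  The integral of an arbitrary function is a supremum over simple minorants, and these can be
  rescaled.
\<close>

lemma nn_integral_scale_le:
  assumes "0 < r"
  shows "(\<integral>\<^sup>+ x. ennreal r * f x \<partial>M) \<le> ennreal r * (\<integral>\<^sup>+ x. f x \<partial>M)"
proof -
  have "(SUP g \<in> {g. simple_function M g \<and> g \<le> (\<lambda>x. ennreal r * f x)}. integral\<^sup>S M g) \<le> ennreal r * (\<integral>\<^sup>+ x. f x \<partial>M)"
  proof (rule SUP_least)
    fix g assume "g \<in> {g. simple_function M g \<and> g \<le> (\<lambda>x. ennreal r * f x)}"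
    then have g: "simple_function M g" "\<And>x. g x \<le> ennreal r * f x"
      by (auto simp: le_fun_def)
    have inv: "ennreal r * (ennreal (1 / r) * y) = y" "ennreal (1 / r) * (ennreal r * y) = y" for y
    proof -
      have "ennreal r * ennreal (1 / r) = 1" "ennreal (1 / r) * ennreal r = 1"
        using assms by (simp_all flip: ennreal_mult)
      then show "ennreal r * (ennreal (1 / r) * y) = y" "ennreal (1 / r) * (ennreal r * y) = y"
        by (simp_all flip: mult.assoc)
    qed
    have [measurable]: "g \<in> borel_measurable M"
      using g(1) by (rule borel_measurable_simple_function)
    have "integral\<^sup>S M g = (\<integral>\<^sup>+ x. ennreal r * (ennreal (1 / r) * g x) \<partial>M)"
      using g(1) by (simp add: inv nn_integral_eq_simple_integral)
    also have "\<dots> = ennreal r * (\<integral>\<^sup>+ x. ennreal (1 / r) * g x \<partial>M)"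
      by (intro nn_integral_cmult) measurable
    also have "\<dots> \<le> ennreal r * (\<integral>\<^sup>+ x. f x \<partial>M)"
    proof (intro mult_left_mono nn_integral_mono)
      fix x
      have "ennreal (1 / r) * g x \<le> ennreal (1 / r) * (ennreal r * f x)"
        by (intro mult_left_mono g(2)) simp
      then show "ennreal (1 / r) * g x \<le> f x"
        by (simp only: inv)
    qed simp
    finally show "integral\<^sup>S M g \<le> ennreal r * (\<integral>\<^sup>+ x. f x \<partial>M)" .
  qed
  then show ?thesis
    by (simp only: nn_integral_def)
qed

lemma Lp_qnorm_scale_le:
  assumes "0 < p" "0 < r"
  shows "Lp_qnorm p M (\<lambda>x. ennreal r * g x) \<le> ennreal r * Lp_qnorm p M g"
  using assms(1)
proof (cases rule: exponent_cases)
  case 1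
  show ?thesis
  proof (cases "g \<in> borel_measurable M")
    case True
    then show ?thesis by (rule Lp_qnorm_cmult[OF assms(1)])
  next
    case False
    then show ?thesis
      using 1 assms(2) by (simp add: Lp_qnorm_def esssup_non_measurable ennreal_mult_top)
  qed
next
  case 2
  define P where "P = enn2real p"
  have P: "0 < P" using 2 by (simp add: P_def)
  have "(\<integral>\<^sup>+ x. enn_powr (ennreal r * g x) P \<partial>M) \<le> ennreal (r powr P) * (\<integral>\<^sup>+ x. enn_powr (g x) P \<partial>M)"
    using P assms(2) nn_integral_scale_le[of "r powr P" M "\<lambda>x. enn_powr (g x) P"]
    by (simp add: enn_powr_mult enn_powr_ennreal)
  then have "enn_powr (\<integral>\<^sup>+ x. enn_powr (ennreal r * g x) P \<partial>M) (1 / P)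
      \<le> enn_powr (ennreal (r powr P) * (\<integral>\<^sup>+ x. enn_powr (g x) P \<partial>M)) (1 / P)"
    using P by (intro enn_powr_mono) auto
  also have "\<dots> = ennreal r * enn_powr (\<integral>\<^sup>+ x. enn_powr (g x) P \<partial>M) (1 / P)"
    using P assms(2) by (simp add: enn_powr_mult enn_powr_ennreal powr_powr)
  finally show ?thesis
    using 2 by (simp add: Lp_qnorm_def P_def)
qed

lemma besov_qnorm_scale_le:
  fixes f :: "real^'n::finite \<Rightarrow> complex"
  assumes "0 < p" "0 < q" "c \<noteq> 0"
  shows "besov_qnorm d K s p q \<Omega> (\<lambda>x. c * f x) \<le> ennreal (cmod c) * besov_qnorm d K s p q \<Omega> f"
  unfolding besov_qnorm_def[of d K s p q \<Omega> f]
proof (rule ennreal_le_mult_Inf)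
  show c: "0 < cmod c" using assms(3) by simp
  fix t assume "t \<in> {b_qnorm s p q \<Omega> lam |lam a. atomic_rep d K p \<Omega> f lam a}"
  then obtain lam a where rep: "atomic_rep d K p \<Omega> f lam a" and t: "t = b_qnorm s p q \<Omega> lam"
    by auto
  define L where "L J = Lp_qnorm p (lebesgue_on \<Omega>)
        (\<lambda>x. ennreal (cmod (f x - (\<Sum>j<J. \<Sum>\<^sub>\<infinity>m\<in>cube_indices \<Omega> j. lam j m * a j m x))))" for J
  define L' where "L' J = Lp_qnorm p (lebesgue_on \<Omega>)
        (\<lambda>x. ennreal (cmod (c * f x - (\<Sum>j<J. \<Sum>\<^sub>\<infinity>m\<in>cube_indices \<Omega> j. c * lam j m * a j m x))))" for J
  have "L' J \<le> ennreal (cmod c) * L J" for J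
  proof -
    have "c * f x - (\<Sum>j<J. \<Sum>\<^sub>\<infinity>m\<in>cube_indices \<Omega> j. c * lam j m * a j m x)
        = c * (f x - (\<Sum>j<J. \<Sum>\<^sub>\<infinity>m\<in>cube_indices \<Omega> j. lam j m * a j m x))" for x
      by (simp add: right_diff_distrib sum_distrib_left mult.assoc infsum_cmult_right')
    then have "L' J = Lp_qnorm p (lebesgue_on \<Omega>)
        (\<lambda>x. ennreal (cmod c) * ennreal (cmod (f x - (\<Sum>j<J. \<Sum>\<^sub>\<infinity>m\<in>cube_indices \<Omega> j. lam j m * a j m x))))"
      by (simp add: L'_def norm_mult ennreal_mult)
    then show ?thesis
      unfolding L_def using Lp_qnorm_scale_le[OF assms(1) c] by simp
  qed
  moreover have "(\<lambda>J. ennreal (cmod c) * L J) \<longlonglongrightarrow> ennreal (cmod c) * 0"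
    using rep by (intro ennreal_tendsto_cmult) (auto simp: atomic_rep_def L_def)
  ultimately have "L' \<longlonglongrightarrow> 0"
    by (intro tendsto_sandwich[of "\<lambda>_. 0" L' sequentially "\<lambda>J. ennreal (cmod c) * L J"]) auto
  then have "atomic_rep d K p \<Omega> (\<lambda>x. c * f x) (\<lambda>j m. c * lam j m) a"
    using rep by (simp add: atomic_rep_def L'_def[abs_def])
  then have "besov_qnorm d K s p q \<Omega> (\<lambda>x. c * f x) \<le> b_qnorm s p q \<Omega> (\<lambda>j m. c * lam j m)"
    unfolding besov_qnorm_def by (intro Inf_lower) auto
  also have "\<dots> \<le> ennreal (cmod c) * b_qnorm s p q \<Omega> lam"
  proof (rule b_qnorm_level_mono[OF assms(1,2)])
    fix j
    show "Lp_qnorm p (count_space (cube_indices \<Omega> j)) (\<lambda>m. ennreal (cmod (c * lam j m)))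
        \<le> ennreal (cmod c) * Lp_qnorm p (count_space (cube_indices \<Omega> j)) (\<lambda>m. ennreal (cmod (lam j m)))"
      using Lp_qnorm_cmult[OF assms(1), of "\<lambda>m. ennreal (cmod (lam j m))" "count_space (cube_indices \<Omega> j)" "ennreal (cmod c)"]
      by (simp add: norm_mult ennreal_mult)
  qed
  finally show "besov_qnorm d K s p q \<Omega> (\<lambda>x. c * f x) \<le> ennreal (cmod c) * t"
    by (simp add: t)
qed

lemma lip_qnorm_zero:
  assumes "0 < p" "0 < q"
  shows "lip_qnorm s p q \<Omega> (\<lambda>x :: real^'n::finite. 0) = 0"
proof -
  have "lip_rep \<Omega> (\<lambda>x :: real^'n. 0) (\<lambda>j m. 0) (\<lambda>j x. 0)"
    by (simp add: lip_rep_def cover_sum_def)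
  then have "lip_qnorm s p q \<Omega> (\<lambda>x :: real^'n. 0) \<le> coef_qnorm s p q (\<lambda>j (m::int^'n). 0)"
    by (rule lip_qnorm_le)
  also have "\<dots> = 0"
    using assms by (simp add: coef_qnorm_def b_qnorm_def Lp_qnorm_zero)
  finally show ?thesis by simp
qed

lemma besov_qnorm_cmult:
  fixes f :: "real^'n::finite \<Rightarrow> complex"
  assumes "0 < p" "0 < q" "0 < s" "s < 1" "1 \<le> d" "\<Omega> \<in> sets lebesgue"
  shows "besov_qnorm d K s p q \<Omega> (\<lambda>x. c * f x) = ennreal (cmod c) * besov_qnorm d K s p q \<Omega> f"
proof (cases "c = 0")
  case True
  obtain C :: real where C: "0 < C"
    "\<And>(\<Omega> :: (real^'n) set) f. \<Omega> \<in> sets lebesgue \<Longrightarrow>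
       besov_qnorm d K s p q \<Omega> f \<le> ennreal C * lip_qnorm s p q \<Omega> f"
    using besov_qnorm_le_lip_qnorm[OF assms(1-5), where 'n = 'n] by blast
  have "besov_qnorm d K s p q \<Omega> (\<lambda>x. 0) \<le> ennreal C * lip_qnorm s p q \<Omega> (\<lambda>x. 0)"
    by (rule C(2)[OF assms(6)])
  then show ?thesis
    using True by (simp add: lip_qnorm_zero[OF assms(1,2)])
next
  case False
  let ?N = "besov_qnorm d K s p q \<Omega>"
  have "ennreal (cmod c) * ?N f = ennreal (cmod c) * ?N (\<lambda>x. 1 / c * (c * f x))"
    using False by simp
  also have "\<dots> \<le> ennreal (cmod c) * (ennreal (cmod (1 / c)) * ?N (\<lambda>x. c * f x))"
    using False by (intro mult_left_mono besov_qnorm_scale_le[OF assms(1,2)]) auto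
  also have "\<dots> = ?N (\<lambda>x. c * f x)"
  proof -
    have "ennreal (cmod c) * ennreal (cmod (1 / c)) = 1"
      using False by (simp add: norm_divide flip: ennreal_mult)
    then show ?thesis
      by (simp flip: mult.assoc)
  qed
  finally show ?thesis
    using besov_qnorm_scale_le[OF assms(1,2) False] by (intro antisym)
qed

lemma lip_qnorm_cong:
  assumes "\<And>x. x \<in> \<Omega> \<Longrightarrow> f x = g x"
  shows "lip_qnorm s p q \<Omega> f = lip_qnorm s p q \<Omega> g"
proof -
  have "(AE x in lebesgue_on \<Omega>. (\<lambda>j. u j x) sums f x) \<longleftrightarrow> (AE x in lebesgue_on \<Omega>. (\<lambda>j. u j x) sums g x)" for u
    by (intro AE_cong) (simp add: assms)
  then show ?thesis
    by (simp add: lip_qnorm_def lip_rep_def)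
qed

lemma lip_qnorm_finite_imp_measurable:
  fixes f :: "real^'n::finite \<Rightarrow> complex"
  assumes "\<Omega> \<in> sets lebesgue" "lip_qnorm s p q \<Omega> f < \<infinity>"
  shows "f \<in> borel_measurable (lebesgue_on \<Omega>)"
proof -
  obtain lam u where "lip_rep \<Omega> f lam u"
    using assms(2) unfolding lip_qnorm_def Inf_less_iff by blast
  then show ?thesis
    by (rule lip_rep_measurable(2)[OF assms(1)])
qed

lemma lip_qnorm_sum:
  fixes N :: nat
  assumes "0 < p" "0 < q"
  obtains C :: real where "0 < C"
    "\<And>(\<Omega> :: (real^'n::finite) set) f. lip_qnorm s p q \<Omega> (\<lambda>x. \<Sum>j\<le>N. f j x) \<le> ennreal C * (\<Sum>j\<le>N. lip_qnorm s p q \<Omega> (f j))"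
proof -
  obtain C :: real where C: "0 < C"
    "\<And>(\<Omega> :: (real^'n) set) f g. lip_qnorm s p q \<Omega> (\<lambda>x. f x + g x) \<le> ennreal C * (lip_qnorm s p q \<Omega> f + lip_qnorm s p q \<Omega> g)"
    by (rule lip_qnorm_add[OF assms, where s = s and 'n = 'n]) (rule that)
  have "\<exists>C>0. \<forall>(\<Omega> :: (real^'n) set) f. lip_qnorm s p q \<Omega> (\<lambda>x. \<Sum>j\<le>N. f j x) \<le> ennreal C * (\<Sum>j\<le>N. lip_qnorm s p q \<Omega> (f j))"
  proof (induction N)
    case 0
    show ?case by (intro exI[of _ 1]) auto
  next
    case (Suc N)
    then obtain C' :: real where C': "0 < C'" "\<And>(\<Omega> :: (real^'n) set) f.
        lip_qnorm s p q \<Omega> (\<lambda>x. \<Sum>j\<le>N. f j x) \<le> ennreal C' * (\<Sum>j\<le>N. lip_qnorm s p q \<Omega> (f j))"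
      by blast
    have "lip_qnorm s p q \<Omega> (\<lambda>x. \<Sum>j\<le>Suc N. f j x) \<le> ennreal (C * (C' + 1)) * (\<Sum>j\<le>Suc N. lip_qnorm s p q \<Omega> (f j))"
      for \<Omega> :: "(real^'n) set" and f
    proof -
      have "lip_qnorm s p q \<Omega> (\<lambda>x. \<Sum>j\<le>Suc N. f j x)
          \<le> ennreal C * (lip_qnorm s p q \<Omega> (\<lambda>x. \<Sum>j\<le>N. f j x) + lip_qnorm s p q \<Omega> (f (Suc N)))"
        using C(2)[of \<Omega> "\<lambda>x. \<Sum>j\<le>N. f j x" "f (Suc N)"] by simp
      also have "\<dots> \<le> ennreal C * (ennreal (C' + 1) * (\<Sum>j\<le>N. lip_qnorm s p q \<Omega> (f j)) + ennreal (C' + 1) * lip_qnorm s p q \<Omega> (f (Suc N)))"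
      proof (intro mult_left_mono add_mono)
        show "lip_qnorm s p q \<Omega> (\<lambda>x. \<Sum>j\<le>N. f j x) \<le> ennreal (C' + 1) * (\<Sum>j\<le>N. lip_qnorm s p q \<Omega> (f j))"
          by (rule order_trans[OF C'(2)]) (intro mult_right_mono ennreal_leI, auto)
        have "1 * lip_qnorm s p q \<Omega> (f (Suc N)) \<le> ennreal (C' + 1) * lip_qnorm s p q \<Omega> (f (Suc N))"
          using C'(1) by (intro mult_right_mono) auto
        then show "lip_qnorm s p q \<Omega> (f (Suc N)) \<le> ennreal (C' + 1) * lip_qnorm s p q \<Omega> (f (Suc N))"
          by simp
      qed simp
      also have "\<dots> = ennreal (C * (C' + 1)) * (\<Sum>j\<le>Suc N. lip_qnorm s p q \<Omega> (f j))"
      proof -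
        have "ennreal (C * (C' + 1)) = ennreal C * ennreal (C' + 1)"
          using C(1) C'(1) by (intro ennreal_mult) auto
        then show ?thesis
          by (simp only: sum.atMost_Suc distrib_left mult.assoc)
      qed
      finally show ?thesis .
    qed
    moreover have "0 < C * (C' + 1)"
      using C(1) C'(1) by simp
    ultimately show ?case by blast
  qed
  then show ?thesis
    using that by blast
qed

text \<open>
  The triangle inequality is transferred from the intermediate quasi-norm, where pieces and
  coefficients can simply be added.
\<close>

lemma besov_qnorm_add:
  assumes "0 < p" "0 < q" "0 < s" "s < 1" "1 \<le> d" "1 \<le> K"
  obtains C :: real where "0 < C"
    "\<And>(\<Omega> :: (real^'n::finite) set) f g. \<Omega> \<in> sets lebesgue \<Longrightarrow>
       f \<in> borel_measurable (lebesgue_on \<Omega>) \<Longrightarrow> g \<in> borel_measurable (lebesgue_on \<Omega>) \<Longrightarrow>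
       besov_qnorm d K s p q \<Omega> (\<lambda>x. f x + g x) \<le> ennreal C * (besov_qnorm d K s p q \<Omega> f + besov_qnorm d K s p q \<Omega> g)"
proof -
  obtain C1 :: real where C1: "0 < C1"
    "\<And>(\<Omega> :: (real^'n) set) f. \<Omega> \<in> sets lebesgue \<Longrightarrow> f \<in> borel_measurable (lebesgue_on \<Omega>) \<Longrightarrow>
       lip_qnorm s p q \<Omega> f \<le> ennreal C1 * besov_qnorm d K s p q \<Omega> f"
    using lip_qnorm_le_besov_qnorm[OF assms(1-3) _ assms(6), where 'n = 'n and d = d] assms(5) by auto
  obtain C2 :: real where C2: "0 < C2"
    "\<And>(\<Omega> :: (real^'n) set) f. \<Omega> \<in> sets lebesgue \<Longrightarrow>
       besov_qnorm d K s p q \<Omega> f \<le> ennreal C2 * lip_qnorm s p q \<Omega> f"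
    using besov_qnorm_le_lip_qnorm[OF assms(1-5), where 'n = 'n] by blast
  obtain C :: real where C: "0 < C"
    "\<And>(\<Omega> :: (real^'n) set) f g. lip_qnorm s p q \<Omega> (\<lambda>x. f x + g x) \<le> ennreal C * (lip_qnorm s p q \<Omega> f + lip_qnorm s p q \<Omega> g)"
    by (rule lip_qnorm_add[OF assms(1,2), where s = s and 'n = 'n]) (rule that)
  show ?thesis
  proof (rule that[of "C2 * (C * C1)"])
    show "0 < C2 * (C * C1)" using C1 C2 C by simp
    fix \<Omega> :: "(real^'n) set" and f g :: "real^'n \<Rightarrow> complex"
    assume \<Omega>: "\<Omega> \<in> sets lebesgue" and f: "f \<in> borel_measurable (lebesgue_on \<Omega>)" and g: "g \<in> borel_measurable (lebesgue_on \<Omega>)"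
    let ?N = "besov_qnorm d K s p q \<Omega>"
    have "?N (\<lambda>x. f x + g x) \<le> ennreal C2 * lip_qnorm s p q \<Omega> (\<lambda>x. f x + g x)"
      by (rule C2(2)[OF \<Omega>])
    also have "\<dots> \<le> ennreal C2 * (ennreal C * (lip_qnorm s p q \<Omega> f + lip_qnorm s p q \<Omega> g))"
      by (intro mult_left_mono C(2)) simp
    also have "\<dots> \<le> ennreal C2 * (ennreal C * (ennreal C1 * ?N f + ennreal C1 * ?N g))"
      by (intro mult_left_mono add_mono C1(2) \<Omega> f g) simp_all
    also have "\<dots> = ennreal (C2 * (C * C1)) * (?N f + ?N g)"
      using C1 C2 C by (simp add: ennreal_mult distrib_left mult.assoc)
    finally show "?N (\<lambda>x. f x + g x) \<le> ennreal (C2 * (C * C1)) * (?N f + ?N g)" .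
  qed
qed

section \<open>Charts and cutoff functions\<close>

lemma lipschitz_diffeo_lipschitz:
  fixes \<psi> :: "real^'n::finite \<Rightarrow> real^'n"
  assumes "lipschitz_diffeo \<psi>"
  obtains L where "0 \<le> L" "\<And>x y. norm (\<psi> x - \<psi> y) \<le> L * norm (x - y)"
proof -
  have "\<forall>i. \<exists>L. L-lipschitz_on UNIV (\<lambda>x. \<psi> x $ i)"
    using assms by (simp add: lipschitz_diffeo_def)
  then obtain L where L: "\<And>i. (L i)-lipschitz_on UNIV (\<lambda>x. \<psi> x $ i)"
    by metis
  have "norm (\<psi> x - \<psi> y) \<le> (\<Sum>i\<in>UNIV. L i) * norm (x - y)" for x y
  proof -
    have "norm (\<psi> x - \<psi> y) \<le> (\<Sum>i\<in>UNIV. \<bar>(\<psi> x - \<psi> y) $ i\<bar>)"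
      by (rule norm_le_l1_cart)
    also have "\<dots> \<le> (\<Sum>i\<in>UNIV. L i * norm (x - y))"
      using lipschitz_onD[OF L, of x y] by (intro sum_mono) (simp add: dist_norm)
    finally show ?thesis by (simp add: sum_distrib_right)
  qed
  moreover have "0 \<le> (\<Sum>i\<in>UNIV. L i)"
    using lipschitz_on_nonneg[OF L] by (intro sum_nonneg) auto
  ultimately show ?thesis
    using that by blast
qed

text \<open>
  The definition of a Lipschitz diffeomorphism bounds the distance of images from below at small
  distances only. On a bounded set compactness and injectivity give the bound for all distances.
\<close>

lemma lipschitz_diffeo_bilipschitz_on_bounded:
  fixes \<psi> :: "real^'n::finite \<Rightarrow> real^'n"
  assumes "lipschitz_diffeo \<psi>" "bounded S"
  obtains L where "0 < L" "\<And>x y. x \<in> S \<Longrightarrow> y \<in> S \<Longrightarrow> norm (\<psi> x - \<psi> y) \<le> L * norm (x - y)"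
    "\<And>x y. x \<in> S \<Longrightarrow> y \<in> S \<Longrightarrow> norm (x - y) \<le> L * norm (\<psi> x - \<psi> y)"
proof -
  obtain L1 where L1: "0 \<le> L1" "\<And>x y. norm (\<psi> x - \<psi> y) \<le> L1 * norm (x - y)"
    by (rule lipschitz_diffeo_lipschitz[OF assms(1)]) (rule that)
  obtain c where c: "0 < c" "\<And>x y. norm (x - y) \<le> 1 \<Longrightarrow> c * norm (x - y) \<le> norm (\<psi> x - \<psi> y)"
    using assms(1) unfolding lipschitz_diffeo_def by blast
  have inj: "\<psi> x = \<psi> y \<Longrightarrow> x = y" for x y
    using assms(1) by (auto simp: lipschitz_diffeo_def bij_def inj_def)
  have cont: "continuous_on UNIV \<psi>"
    using L1 by (intro lipschitz_on_continuous_on[of L1] lipschitz_onI) (auto simp: dist_norm)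
  define P where "P = (closure S \<times> closure S) \<inter> {z. 1 \<le> norm (fst z - snd z)}"
  have "compact P"
    unfolding P_def using assms(2)
    by (intro compact_Int_closed compact_Times closed_Collect_le continuous_intros) (simp_all add: compact_closure)
  have "\<exists>L2\<ge>0. \<forall>x\<in>S. \<forall>y\<in>S. 1 \<le> norm (x - y) \<longrightarrow> norm (x - y) \<le> L2 * norm (\<psi> x - \<psi> y)"
  proof (cases "P = {}")
    case True
    have "\<not> (1 \<le> norm (x - y))" if "x \<in> S" "y \<in> S" for x y
    proof
      assume "1 \<le> norm (x - y)"
      then have "(x, y) \<in> P"
        using that closure_subset[of S] by (auto simp: P_def)
      then show False using True by blast
    qed
    then show ?thesis by (intro exI[of _ 0]) auto
  next
    case False
    have "continuous_on P (\<lambda>z. norm (\<psi> (fst z) - \<psi> (snd z)))"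
      by (intro continuous_intros continuous_on_compose2[OF cont]) auto
    then obtain z where z: "z \<in> P" "\<And>z'. z' \<in> P \<Longrightarrow> norm (\<psi> (fst z) - \<psi> (snd z)) \<le> norm (\<psi> (fst z') - \<psi> (snd z'))"
      using continuous_attains_inf[OF \<open>compact P\<close> False] by blast
    define m where "m = norm (\<psi> (fst z) - \<psi> (snd z))"
    have m: "0 < m"
    proof -
      have "fst z \<noteq> snd z"
        using z(1) by (auto simp: P_def)
      then show ?thesis
        using inj by (auto simp: m_def)
    qed
    obtain b where b: "\<And>x. x \<in> S \<Longrightarrow> norm x \<le> b"
      using assms(2) by (auto simp: bounded_iff)
    have "norm (x - y) \<le> 2 * \<bar>b\<bar> / m * norm (\<psi> x - \<psi> y)" if "x \<in> S" "y \<in> S" "1 \<le> norm (x - y)" for x y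
    proof -
      have "(x, y) \<in> P"
        using that closure_subset[of S] by (auto simp: P_def)
      then have "m \<le> norm (\<psi> x - \<psi> y)"
        using z(2)[of "(x, y)"] by (simp add: m_def)
      then have "2 * \<bar>b\<bar> / m * m \<le> 2 * \<bar>b\<bar> / m * norm (\<psi> x - \<psi> y)"
        using m by (intro mult_left_mono) auto
      moreover have "norm (x - y) \<le> 2 * \<bar>b\<bar>"
        using b[OF that(1)] b[OF that(2)] norm_triangle_ineq4[of x y] by linarith
      ultimately show ?thesis using m by simp
    qed
    moreover have "0 \<le> 2 * \<bar>b\<bar> / m" using m by simp
    ultimately show ?thesis by blast
  qed
  then obtain L2 where L2: "0 \<le> L2" "\<And>x y. x \<in> S \<Longrightarrow> y \<in> S \<Longrightarrow> 1 \<le> norm (x - y) \<Longrightarrow> norm (x - y) \<le> L2 * norm (\<psi> x - \<psi> y)"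
    by blast
  define L where "L = L1 + 1 / c + L2"
  have L: "0 < L" "L1 \<le> L" "1 / c \<le> L" "L2 \<le> L"
    using c(1) L1(1) L2(1) by (auto simp: L_def add_nonneg_pos add_pos_nonneg)
  show ?thesis
  proof (rule that[OF L(1)])
    fix x y assume xy: "x \<in> S" "y \<in> S"
    show "norm (\<psi> x - \<psi> y) \<le> L * norm (x - y)"
      using L1(2)[of x y] mult_right_mono[OF L(2), of "norm (x - y)"] by simp
    show "norm (x - y) \<le> L * norm (\<psi> x - \<psi> y)"
    proof (cases "norm (x - y) \<le> 1")
      case True
      then have "norm (x - y) \<le> 1 / c * norm (\<psi> x - \<psi> y)"
        using c by (simp add: field_simps)
      also have "\<dots> \<le> L * norm (\<psi> x - \<psi> y)"
        by (intro mult_right_mono L) simp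
      finally show ?thesis .
    next
      case False
      then have "norm (x - y) \<le> L2 * norm (\<psi> x - \<psi> y)"
        using L2(2) xy by simp
      also have "\<dots> \<le> L * norm (\<psi> x - \<psi> y)"
        by (intro mult_right_mono L) simp
      finally show ?thesis .
    qed
  qed
qed

text \<open>
  The function and its partial derivatives are continuous and vanish outside a compact set.
\<close>

lemma smooth_compact_support_lipschitz:
  fixes \<phi> :: "real^'n::finite \<Rightarrow> real"
  assumes "smooth \<phi>" "bounded (supp \<phi>)"
  obtains D where "0 \<le> D" "\<And>x. \<bar>\<phi> x\<bar> \<le> D" "\<And>x y. \<bar>\<phi> x - \<phi> y\<bar> \<le> D * norm (x - y)"
proof -
  have C: "class_C 1 \<phi>"
    using assms(1) by (simp add: smooth_def)
  have cp: "compact (supp \<phi>)"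
    using assms(2) by (simp add: supp_def compact_eq_bounded_closed)
  have z: "\<phi> x = 0" if "x \<notin> supp \<phi>" for x
    using that closure_subset[of "{x. \<phi> x \<noteq> 0}"] by (auto simp: supp_def)
  have it: "iter_partial [] \<phi> = \<phi>" "iter_partial [i] \<phi> = partial_deriv i \<phi>" for i
    by (simp_all add: iter_partial_def)
  have contp: "continuous_on UNIV (partial_deriv i \<phi>)" for i
  proof -
    have "\<forall>\<alpha>. length \<alpha> \<le> 1 \<longrightarrow> continuous_on UNIV (iter_partial \<alpha> \<phi>)"
      using C by (simp add: class_C_def)
    from this[rule_format, of "[i]"] show ?thesis by (simp add: it)
  qed
  have cont: "continuous_on UNIV \<phi>"
  proof -
    have "\<forall>\<alpha>. length \<alpha> \<le> 1 \<longrightarrow> continuous_on UNIV (iter_partial \<alpha> \<phi>)"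
      using C by (simp add: class_C_def)
    from this[rule_format, of "[]"] show ?thesis by (simp add: it)
  qed
  have diff: "(\<lambda>t. \<phi> (x + t *\<^sub>R axis i 1)) differentiable at 0" for x i
  proof -
    have "\<forall>\<alpha> i x. length \<alpha> < 1 \<longrightarrow> (\<lambda>t. iter_partial \<alpha> \<phi> (x + t *\<^sub>R axis i 1)) differentiable (at 0)"
      using C by (simp add: class_C_def)
    from this[rule_format, of "[]" x i] show ?thesis by (simp add: it)
  qed
  have pz: "partial_deriv i \<phi> x = 0" if x: "x \<notin> supp \<phi>" for i x
  proof -
    let ?U = "(\<lambda>t. x + t *\<^sub>R axis i 1) -` (- supp \<phi>)"
    have op: "open ?U"
      by (intro open_vimage continuous_intros) (simp add: supp_def open_Compl)
    have "((\<lambda>t::real. 0::real) has_vector_derivative 0) (at 0)"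
      by simp
    then have "((\<lambda>t. \<phi> (x + t *\<^sub>R axis i 1)) has_vector_derivative 0) (at 0)"
      by (rule has_vector_derivative_transform_within_open[OF _ op]) (use x z in auto)
    then show ?thesis
      unfolding partial_deriv_def by (rule vector_derivative_at)
  qed
  have bd: "\<exists>b. \<forall>x. \<bar>g x\<bar> \<le> b" if "continuous_on UNIV g" "\<And>x. x \<notin> supp \<phi> \<Longrightarrow> g x = 0" for g :: "real^'n \<Rightarrow> real"
  proof -
    have "compact (g ` supp \<phi>)"
      using that(1) cp by (intro compact_continuous_image) (auto intro: continuous_on_subset)
    then obtain b where b: "\<forall>y\<in>g ` supp \<phi>. norm y \<le> b"
      using compact_imp_bounded bounded_iff by blast
    have "\<bar>g x\<bar> \<le> max b 0" for x
    proof (cases "x \<in> supp \<phi>")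
      case True
      then have "norm (g x) \<le> b" using b by blast
      then show ?thesis by simp
    qed (simp add: that(2))
    then show ?thesis by blast
  qed
  obtain b0 where b0: "\<And>x. \<bar>\<phi> x\<bar> \<le> b0"
    using bd[OF cont z] by blast
  have "\<forall>i. \<exists>b. \<forall>x. \<bar>partial_deriv i \<phi> x\<bar> \<le> b"
    using bd[OF contp pz] by blast
  then obtain b where b: "\<And>i x. \<bar>partial_deriv i \<phi> x\<bar> \<le> b i"
    by metis
  define b1 where "b1 = (\<Sum>i\<in>UNIV. \<bar>b i\<bar>)"
  have b1: "norm (partial_deriv i \<phi> x) \<le> b1" for i x
  proof -
    have "\<bar>partial_deriv i \<phi> x\<bar> \<le> \<bar>b i\<bar>"
      using b[of i x] by linarith
    also have "\<dots> \<le> b1"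
      unfolding b1_def by (intro member_le_sum) auto
    finally show ?thesis by simp
  qed
  have b10: "0 \<le> b1"
    unfolding b1_def by (intro sum_nonneg) simp
  have b00: "0 \<le> b0"
    using b0[of 0] by linarith
  show ?thesis
  proof (rule that[of "b0 + real CARD('n) * b1"])
    show "0 \<le> b0 + real CARD('n) * b1" using b00 b10 by simp
    fix x y
    show "\<bar>\<phi> x\<bar> \<le> b0 + real CARD('n) * b1"
      using b0[of x] b10 by (simp add: add_increasing2)
    have "norm (\<phi> x - \<phi> y) \<le> real CARD('n) * b1 * norm (x - y)"
      by (rule bounded_partials_imp_lipschitz[OF diff b1])
    also have "\<dots> \<le> (b0 + real CARD('n) * b1) * norm (x - y)"
      using b00 by (intro mult_right_mono) auto
    finally show "\<bar>\<phi> x - \<phi> y\<bar> \<le> (b0 + real CARD('n) * b1) * norm (x - y)"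
      by simp
  qed
qed

text \<open>
  The image of the domain under a chart need not be all of the half-space part of the image of the ball:
  other components of that part may come from outside \<open>\<Omega>\<close>. They stay away from the image of the
  support of the cutoff function, however. A segment in the open half-space that leaves \<open>\<psi>(U \<inter> \<Omega>)\<close>
  does so at the image of a point that lies outside \<open>U\<close>, since boundary points of \<open>\<Omega>\<close> in \<open>U\<close> are
  mapped to the plane. Hence the zero extension of the cutoff function is Lipschitz on the half-space.
\<close>

lemma chart_separation:
  fixes \<psi> :: "real^'n::finite \<Rightarrow> real^'n"
  assumes "lipschitz_diffeo \<psi>" "open \<Omega>" "open U" "bounded U" "compact S" "S \<subseteq> U"
    and H: "\<psi> ` (U \<inter> \<Omega>) \<subseteq> half_space l" "\<psi> ` (U \<inter> frontier \<Omega>) \<subseteq> boundary_plane l"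
  obtains \<delta> where "0 < \<delta>"
    "\<And>x y. x \<in> S \<Longrightarrow> x \<in> \<Omega> \<Longrightarrow> y \<in> half_space l \<Longrightarrow> y \<notin> \<psi> ` (U \<inter> \<Omega>) \<Longrightarrow> \<delta> \<le> norm (\<psi> x - y)"
proof -
  have "\<exists>\<rho>>0. \<forall>x\<in>S. \<forall>z\<in>- U. \<rho> \<le> dist x z"
    using assms(3,5,6) by (intro separate_compact_closed) (auto simp: closed_Compl)
  then obtain \<rho> where \<rho>: "0 < \<rho>" "\<And>x z. x \<in> S \<Longrightarrow> z \<in> - U \<Longrightarrow> \<rho> \<le> dist x z"
    by blast
  obtain L where L: "0 < L" "\<And>x y. x \<in> closure U \<Longrightarrow> y \<in> closure U \<Longrightarrow> norm (x - y) \<le> L * norm (\<psi> x - \<psi> y)"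
    by (rule lipschitz_diffeo_bilipschitz_on_bounded[OF assms(1), of "closure U"]) (use assms(4) in auto)
  obtain L1 where L1: "0 \<le> L1" "\<And>x y. norm (\<psi> x - \<psi> y) \<le> L1 * norm (x - y)"
    by (rule lipschitz_diffeo_lipschitz[OF assms(1)]) (rule that)
  have cont: "continuous_on A \<psi>" for A
    using L1 by (intro lipschitz_on_continuous_on[of L1] lipschitz_onI) (auto simp: dist_norm)
  have inj: "inj_on \<psi> A" for A
    using assms(1) by (auto simp: lipschitz_diffeo_def bij_def intro: inj_on_subset)
  define E where "E = \<psi> ` (U \<inter> \<Omega>)"
  have opE: "open E"
    unfolding E_def using assms(2,3) by (intro invariance_of_domain cont inj) auto
  have clE: "closure E \<subseteq> \<psi> ` closure (U \<inter> \<Omega>)"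
  proof (rule closure_minimal)
    show "E \<subseteq> \<psi> ` closure (U \<inter> \<Omega>)"
      unfolding E_def by (intro image_mono closure_subset)
    have "bounded (U \<inter> \<Omega>)"
      using assms(4) by (rule bounded_subset) auto
    then have "compact (closure (U \<inter> \<Omega>))"
      by (simp add: compact_closure)
    then show "closed (\<psi> ` closure (U \<inter> \<Omega>))"
      by (intro compact_imp_closed compact_continuous_image cont)
  qed
  \<comment> \<open>The preimages of points closer than \<open>\<rho> / L\<close> are closer than \<open>\<rho>\<close> and cannot leave \<open>U\<close>.\<close>
  show ?thesis
  proof (rule that[of "\<rho> / (2 * L)"])
    show "0 < \<rho> / (2 * L)" using \<rho>(1) L(1) by simp
    fix x y assume x: "x \<in> S" "x \<in> \<Omega>" and y: "y \<in> half_space l" "y \<notin> \<psi> ` (U \<inter> \<Omega>)"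
    show "\<rho> / (2 * L) \<le> norm (\<psi> x - y)"
    proof (rule ccontr)
      assume "\<not> \<rho> / (2 * L) \<le> norm (\<psi> x - y)"
      then have small: "norm (\<psi> x - y) < \<rho> / (2 * L)" by simp
      have xE: "\<psi> x \<in> E"
        using x assms(6) by (auto simp: E_def)
      have "closed_segment (\<psi> x) y \<inter> frontier E \<noteq> {}"
        using xE y(2) by (intro connected_Int_frontier connected_segment) (auto simp: E_def)
      then obtain z where z: "z \<in> closed_segment (\<psi> x) y" "z \<in> frontier E"
        by blast
      have "convex (half_space l)"
        unfolding half_space_def using convex_halfspace_gt[of 0 "axis l 1 :: real^'n"]
        by (simp add: inner_axis' )
      then have zH: "z \<in> half_space l"
        using z(1) y(1) xE H(1) closed_segment_subset[of "\<psi> x" "half_space l" y] by (auto simp: E_def)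
      obtain w where w: "w \<in> closure (U \<inter> \<Omega>)" "z = \<psi> w"
        using z(2) clE by (auto simp: frontier_def)
      have wU: "w \<in> closure U" "w \<in> closure \<Omega>"
        using w(1) closure_mono[of "U \<inter> \<Omega>" U] closure_mono[of "U \<inter> \<Omega>" \<Omega>] by auto
      have "norm (\<psi> x - \<psi> w) \<le> norm (\<psi> x - y)"
        using dist_in_closed_segment[OF z(1)] w(2) by (simp add: dist_norm norm_minus_commute)
      then have le: "L * norm (\<psi> x - \<psi> w) \<le> L * norm (\<psi> x - y)"
        using L(1) by (intro mult_left_mono) auto
      have "x \<in> closure U"
        using x(1) assms(6) closure_subset[of U] by blast
      then have "norm (x - w) \<le> L * norm (\<psi> x - \<psi> w)"
        using wU(1) by (rule L(2))
      moreover have "L * norm (\<psi> x - y) < \<rho> / 2"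
        using small L(1) by (simp add: field_simps)
      ultimately have "norm (x - w) < \<rho>"
        using le \<rho>(1) by linarith
      then have "w \<in> U"
        using \<rho>(2)[OF x(1), of w] by (force simp: dist_norm)
      moreover have "w \<in> \<Omega>"
      proof (rule ccontr)
        assume "w \<notin> \<Omega>"
        then have "w \<in> frontier \<Omega>"
          using wU(2) assms(2) by (simp add: frontier_def interior_open)
        then have "\<psi> w \<in> boundary_plane l"
          using H(2) \<open>w \<in> U\<close> by blast
        then show False
          using zH w(2) by (simp add: boundary_plane_def half_space_def)
      qed
      ultimately have "z \<in> E"
        using w(2) by (simp add: E_def)
      then show False
        using z(2) opE by (simp add: frontier_def interior_open)
    qed
  qed
qed

section \<open>Localization\<close>

lemma open_imp_lebesgue_sets: "open S \<Longrightarrow> S \<in> sets lebesgue"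
  by (simp add: borel_open sets_completionI_sets)

lemma open_half_space: "open (half_space l)"
  unfolding half_space_def by (intro open_Collect_less continuous_intros)

lemma half_space_lebesgue_sets: "half_space l \<in> sets lebesgue"
  by (rule open_imp_lebesgue_sets[OF open_half_space])

lemma outside_supp: "x \<notin> supp f \<Longrightarrow> f x = 0"
  using closure_subset[of "{x. f x \<noteq> 0}"] by (auto simp: supp_def)

lemma lip_qnorm_inner_part_le:
  fixes \<phi> :: "real^'n::finite \<Rightarrow> real"
  assumes "0 < p" "0 < q" "open \<Omega>" "bounded \<Omega>" "smooth \<phi>" "supp \<phi> \<subseteq> \<Omega>"
  obtains C :: real where "0 < C"
    "\<And>f. lip_qnorm s p q UNIV (inner_part \<Omega> \<phi> f) \<le> ennreal C * lip_qnorm s p q \<Omega> f"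
proof -
  obtain D where D: "0 \<le> D" "\<And>x. \<bar>\<phi> x\<bar> \<le> D" "\<And>x y. \<bar>\<phi> x - \<phi> y\<bar> \<le> D * norm (x - y)"
    by (rule smooth_compact_support_lipschitz[OF assms(5)]) (use assms(4,6) bounded_subset in auto)
  obtain C :: real where C: "0 < C"
    "\<And>g. lip_qnorm s p q UNIV (\<lambda>x. if x \<in> \<Omega> then of_real (\<phi> x) * g (id x) else 0) \<le> ennreal C * lip_qnorm s p q \<Omega> g"
  proof (rule lip_qnorm_transform[of p q 1 D UNIV \<Omega> \<Omega> id \<phi> s])
    show "\<phi> x = 0" if "x \<notin> \<Omega>" for x
      using that assms(6) by (intro outside_supp) auto
  qed (use assms D open_imp_lebesgue_sets in auto)
  have "inner_part \<Omega> \<phi> f = (\<lambda>x. if x \<in> \<Omega> then of_real (\<phi> x) * f (id x) else 0)" for f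
    by (auto simp: inner_part_def fun_eq_iff)
  then show ?thesis
    using C by (intro that) auto
qed

lemma lip_qnorm_le_inner_part:
  fixes \<phi> :: "real^'n::finite \<Rightarrow> real"
  assumes "0 < p" "0 < q" "open \<Omega>"
  obtains C :: real where "0 < C"
    "\<And>f. lip_qnorm s p q \<Omega> (\<lambda>x. of_real (\<phi> x) * f x) \<le> ennreal C * lip_qnorm s p q UNIV (inner_part \<Omega> \<phi> f)"
proof -
  obtain C :: real where C: "0 < C"
    "\<And>g :: real^'n \<Rightarrow> complex. lip_qnorm s p q \<Omega> (\<lambda>x. if x \<in> \<Omega> then of_real 1 * g (id x) else 0) \<le> ennreal C * lip_qnorm s p q UNIV g"
    by (rule lip_qnorm_transform[of p q 1 1 \<Omega> UNIV \<Omega> id "\<lambda>_. 1" s]) (use assms open_imp_lebesgue_sets in auto)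
  show ?thesis
  proof (rule that[OF C(1)])
    fix f :: "real^'n \<Rightarrow> complex"
    have "lip_qnorm s p q \<Omega> (\<lambda>x. of_real (\<phi> x) * f x)
        = lip_qnorm s p q \<Omega> (\<lambda>x. if x \<in> \<Omega> then of_real 1 * inner_part \<Omega> \<phi> f (id x) else 0)"
      by (intro lip_qnorm_cong) (simp add: inner_part_def)
    then show "lip_qnorm s p q \<Omega> (\<lambda>x. of_real (\<phi> x) * f x) \<le> ennreal C * lip_qnorm s p q UNIV (inner_part \<Omega> \<phi> f)"
      using C(2)[of "inner_part \<Omega> \<phi> f"] by simp
  qed
qed

text \<open>
  The boundary part is the composition of \<open>f\<close> with the inverse chart on the image of
  \<open>U \<inter> \<Omega>\<close>, times the zero extension \<open>M\<close> of the transported cutoff function. Between two points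
  of the image \<open>M\<close> is Lipschitz like the cutoff function and the chart; between the image and the rest of the
  half-space \<open>chart_separation\<close> provides the Lipschitz bound.
\<close>

lemma lip_qnorm_boundary_part_le:
  fixes \<phi> :: "real^'n::finite \<Rightarrow> real" and \<psi> :: "real^'n \<Rightarrow> real^'n"
  assumes "0 < p" "0 < q" "open \<Omega>" "open U" "bounded U" "smooth \<phi>" "supp \<phi> \<subseteq> U" "lipschitz_diffeo \<psi>"
    and H: "\<psi> ` (U \<inter> \<Omega>) \<subseteq> half_space l" "\<psi> ` (U \<inter> frontier \<Omega>) \<subseteq> boundary_plane l"
  obtains C :: real where "0 < C"
    "\<And>f. lip_qnorm s p q (half_space l) (boundary_part \<Omega> U \<psi> \<phi> f) \<le> ennreal C * lip_qnorm s p q \<Omega> f"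
proof -
  have bs: "bounded (supp \<phi>)"
    using assms(5,7) by (rule bounded_subset)
  obtain D where D: "0 \<le> D" "\<And>x. \<bar>\<phi> x\<bar> \<le> D" "\<And>x y. \<bar>\<phi> x - \<phi> y\<bar> \<le> D * norm (x - y)"
    by (rule smooth_compact_support_lipschitz[OF assms(6) bs]) (rule that)
  obtain L where L: "0 < L" "\<And>x y. x \<in> U \<Longrightarrow> y \<in> U \<Longrightarrow> norm (\<psi> x - \<psi> y) \<le> L * norm (x - y)"
    "\<And>x y. x \<in> U \<Longrightarrow> y \<in> U \<Longrightarrow> norm (x - y) \<le> L * norm (\<psi> x - \<psi> y)"
    by (rule lipschitz_diffeo_bilipschitz_on_bounded[OF assms(8,5)]) (rule that)
  have cs: "compact (supp \<phi>)"
    using bs by (simp add: supp_def compact_eq_bounded_closed)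
  obtain \<delta> where \<delta>: "0 < \<delta>"
    "\<And>x y. x \<in> supp \<phi> \<Longrightarrow> x \<in> \<Omega> \<Longrightarrow> y \<in> half_space l \<Longrightarrow> y \<notin> \<psi> ` (U \<inter> \<Omega>) \<Longrightarrow> \<delta> \<le> norm (\<psi> x - y)"
    by (rule chart_separation[OF assms(8,3,4,5) cs assms(7) H]) (rule that)
  have inv: "inv \<psi> (\<psi> x) = x" for x
    using assms(8) by (simp add: lipschitz_diffeo_def bij_def)
  define E where "E = \<psi> ` (U \<inter> \<Omega>)"
  define M where "M y = (if y \<in> E then \<phi> (inv \<psi> y) else 0)" for y
  define D' where "D' = D + D * L + D / \<delta>"
  have D': "0 \<le> D'" "D \<le> D'" "D * L \<le> D'" "D / \<delta> \<le> D'"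
    using D(1) L(1) \<delta>(1) by (auto simp: D'_def)
  have half: "\<bar>M y - M y'\<bar> \<le> D' * norm (y - y')" if y: "y \<in> E" and y': "y' \<in> half_space l" for y y'
  proof -
    obtain x where x: "x \<in> U" "x \<in> \<Omega>" "y = \<psi> x"
      using y by (auto simp: E_def)
    have My: "M y = \<phi> x"
      using y by (simp add: M_def x(3) inv)
    show ?thesis
    proof (cases "y' \<in> E")
      case True
      then obtain x' where x': "x' \<in> U" "x' \<in> \<Omega>" "y' = \<psi> x'"
        by (auto simp: E_def)
      have "M y' = \<phi> x'"
        using True by (simp add: M_def x'(3) inv)
      then have "\<bar>M y - M y'\<bar> \<le> D * norm (x - x')"
        using D(3)[of x x'] by (simp add: My)
      also have "\<dots> \<le> D * (L * norm (y - y'))"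
        using L(3)[OF x(1) x'(1)] D(1) by (intro mult_left_mono) (auto simp: x(3) x'(3))
      also have "\<dots> = D * L * norm (y - y')"
        by simp
      also have "\<dots> \<le> D' * norm (y - y')"
        by (intro mult_right_mono D') simp
      finally show ?thesis .
    next
      case False
      then have My': "M y' = 0" by (simp add: M_def)
      show ?thesis
      proof (cases "x \<in> supp \<phi>")
        case True
        have "\<delta> \<le> norm (y - y')"
          using \<delta>(2)[OF True x(2) y'] False by (simp add: x(3) E_def)
        then have "D / \<delta> * \<delta> \<le> D / \<delta> * norm (y - y')"
          using D(1) \<delta>(1) by (intro mult_left_mono) auto
        then have "D \<le> D / \<delta> * norm (y - y')"
          using \<delta>(1) by simp
        also have "\<dots> \<le> D' * norm (y - y')"
          by (intro mult_right_mono D') simp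
        finally show ?thesis
          using D(2)[of x] by (simp add: My My')
      next
        case False
        then have "\<phi> x = 0" by (rule outside_supp)
        then show ?thesis
          using D'(1) by (simp add: My My')
      qed
    qed
  qed
  obtain C :: real where C: "0 < C"
    "\<And>g :: real^'n \<Rightarrow> complex. lip_qnorm s p q (half_space l) (\<lambda>y. if y \<in> E then of_real (M y) * g (inv \<psi> y) else 0)
       \<le> ennreal C * lip_qnorm s p q \<Omega> g"
  proof (rule lip_qnorm_transform[of p q L D' "half_space l" \<Omega> E "inv \<psi>" M s])
    show "E \<subseteq> half_space l" using H(1) by (simp add: E_def)
    show "inv \<psi> y \<in> \<Omega>" if "y \<in> E" for y
      using that by (auto simp: E_def inv)
    show "norm (inv \<psi> y - inv \<psi> y') \<le> L * norm (y - y')" if "y \<in> E" "y' \<in> E" for y y'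
      using that L(3) by (auto simp: E_def inv)
    show "norm (y - y') \<le> L * norm (inv \<psi> y - inv \<psi> y')" if "y \<in> E" "y' \<in> E" for y y'
      using that L(2) by (auto simp: E_def inv)
    show "\<bar>M y\<bar> \<le> D'" for y
      using D(2)[of "inv \<psi> y"] D' by (auto simp: M_def)
    show "\<bar>M y - M y'\<bar> \<le> D' * norm (y - y')" if "y \<in> half_space l" "y' \<in> half_space l" for y y'
    proof -
      consider "y \<in> E" | "y' \<in> E" | "y \<notin> E" "y' \<notin> E" by blast
      then show ?thesis
      proof cases
        case 1
        then show ?thesis using half that by blast
      next
        case 2
        then show ?thesis using half[OF 2 that(1)] by (simp add: abs_minus_commute norm_minus_commute)
      next
        case 3
        then show ?thesis using D'(1) by (simp add: M_def)
      qed
    qed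
    show "M y = 0" if "y \<notin> E" for y
      using that by (simp add: M_def)
  qed (use assms L D' open_imp_lebesgue_sets half_space_lebesgue_sets[of l] in auto)
  have "boundary_part \<Omega> U \<psi> \<phi> f = (\<lambda>y. if y \<in> E then of_real (M y) * f (inv \<psi> y) else 0)" for f
    by (auto simp: boundary_part_def E_def M_def fun_eq_iff)
  then show ?thesis
    using C by (intro that) auto
qed

text \<open>
  Pulling the boundary part back yields \<open>\<phi> f\<close> on \<open>U \<inter> \<Omega>\<close> only. Multiplying with a Lipschitz cutoff
  function, equal to \<open>1\<close> on the support of \<open>\<phi>\<close> and to \<open>0\<close> outside \<open>U\<close>, controls the pieces of
  the representation near the boundary of \<open>U\<close>.
\<close>

lemma lip_qnorm_le_boundary_part:
  fixes \<phi> :: "real^'n::finite \<Rightarrow> real" and \<psi> :: "real^'n \<Rightarrow> real^'n"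
  assumes "0 < p" "0 < q" "open \<Omega>" "open U" "bounded U" "supp \<phi> \<subseteq> U" "lipschitz_diffeo \<psi>"
    and H: "\<psi> ` (U \<inter> \<Omega>) \<subseteq> half_space l"
  obtains C :: real where "0 < C"
    "\<And>f. lip_qnorm s p q \<Omega> (\<lambda>x. of_real (\<phi> x) * f x)
       \<le> ennreal C * lip_qnorm s p q (half_space l) (boundary_part \<Omega> U \<psi> \<phi> f)"
proof -
  have bs: "bounded (supp \<phi>)"
    using assms(5,6) by (rule bounded_subset)
  have cs: "compact (supp \<phi>)"
    using bs by (simp add: supp_def compact_eq_bounded_closed)
  obtain L where L: "0 < L" "\<And>x y. x \<in> U \<Longrightarrow> y \<in> U \<Longrightarrow> norm (\<psi> x - \<psi> y) \<le> L * norm (x - y)"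
    "\<And>x y. x \<in> U \<Longrightarrow> y \<in> U \<Longrightarrow> norm (x - y) \<le> L * norm (\<psi> x - \<psi> y)"
    by (rule lipschitz_diffeo_bilipschitz_on_bounded[OF assms(7,5)]) (rule that)
  have "\<exists>\<rho>>0. \<forall>x\<in>supp \<phi>. \<forall>z\<in>- U. \<rho> \<le> dist x z"
    using assms(4,6) cs by (intro separate_compact_closed) (auto simp: closed_Compl)
  then obtain \<rho> where \<rho>: "0 < \<rho>" "\<And>x z. x \<in> supp \<phi> \<Longrightarrow> z \<in> - U \<Longrightarrow> \<rho> \<le> dist x z"
    by blast
  have ne: "- U \<noteq> {}"
    using assms(5) not_bounded_UNIV by (metis Compl_empty_eq double_compl)
  have inv: "inv \<psi> (\<psi> x) = x" for x
    using assms(7) by (simp add: lipschitz_diffeo_def bij_def)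
  define \<kappa> where "\<kappa> x = min 1 (infdist x (- U) / \<rho>)" for x
  have \<kappa>0: "\<kappa> x = 0" if "x \<notin> U" for x
    using that by (simp add: \<kappa>_def)
  have \<kappa>1: "\<kappa> x = 1" if "x \<in> supp \<phi>" for x
  proof -
    have "\<rho> \<le> infdist x (- U)"
      unfolding infdist_notempty[OF ne] using \<rho>(2)[OF that] ne by (intro cINF_greatest)
    then show ?thesis
      using \<rho>(1) by (simp add: \<kappa>_def)
  qed
  have \<kappa>b: "\<bar>\<kappa> x\<bar> \<le> 1" for x
    using \<rho>(1) infdist_nonneg[of x "- U"] by (auto simp: \<kappa>_def min_def)
  have \<kappa>l: "\<bar>\<kappa> x - \<kappa> y\<bar> \<le> 1 / \<rho> * norm (x - y)" for x y
  proof -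
    have "\<bar>\<kappa> x - \<kappa> y\<bar> \<le> \<bar>infdist x (- U) / \<rho> - infdist y (- U) / \<rho>\<bar>"
      unfolding \<kappa>_def by linarith
    also have "\<dots> = \<bar>infdist x (- U) - infdist y (- U)\<bar> / \<rho>"
      using \<rho>(1) by (simp add: diff_divide_distrib[symmetric] abs_divide)
    also have "\<dots> \<le> dist x y / \<rho>"
      using \<rho>(1) by (intro divide_right_mono infdist_triangle_abs) auto
    finally show ?thesis
      by (simp add: dist_norm)
  qed
  define D where "D = 1 + 1 / \<rho>"
  have D: "0 \<le> D" "1 \<le> D" "1 / \<rho> \<le> D"
    using \<rho>(1) by (auto simp: D_def)
  obtain C :: real where C: "0 < C"
    "\<And>g :: real^'n \<Rightarrow> complex. lip_qnorm s p q \<Omega> (\<lambda>x. if x \<in> U \<inter> \<Omega> then of_real (\<kappa> x) * g (\<psi> x) else 0)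
       \<le> ennreal C * lip_qnorm s p q (half_space l) g"
  proof (rule lip_qnorm_transform[of p q L D \<Omega> "half_space l" "U \<inter> \<Omega>" \<psi> \<kappa> s])
    show "\<bar>\<kappa> x\<bar> \<le> D" for x
      using \<kappa>b[of x] D by linarith
    show "\<bar>\<kappa> x - \<kappa> y\<bar> \<le> D * norm (x - y)" for x y
      using mult_right_mono[OF D(3), of "norm (x - y)"] \<kappa>l[of x y] by simp
  qed (use assms L D H \<kappa>0 open_imp_lebesgue_sets half_space_lebesgue_sets[of l] in auto)
  show ?thesis
  proof (rule that[OF C(1)])
    fix f :: "real^'n \<Rightarrow> complex"
    let ?g = "boundary_part \<Omega> U \<psi> \<phi> f"
    have "lip_qnorm s p q \<Omega> (\<lambda>x. of_real (\<phi> x) * f x)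
        = lip_qnorm s p q \<Omega> (\<lambda>x. if x \<in> U \<inter> \<Omega> then of_real (\<kappa> x) * ?g (\<psi> x) else 0)"
    proof (rule lip_qnorm_cong)
      fix x assume x: "x \<in> \<Omega>"
      show "of_real (\<phi> x) * f x = (if x \<in> U \<inter> \<Omega> then of_real (\<kappa> x) * ?g (\<psi> x) else 0)"
      proof (cases "x \<in> U")
        case True
        then have "?g (\<psi> x) = of_real (\<phi> x) * f x"
          using x by (simp add: boundary_part_def inv)
        moreover have "of_real (\<kappa> x) * (of_real (\<phi> x) * f x) = of_real (\<phi> x) * f x"
          using \<kappa>1[of x] outside_supp[of x \<phi>] by (cases "x \<in> supp \<phi>") auto
        ultimately show ?thesis
          using True x by simp
      next
        case False
        then have "\<phi> x = 0"
          using assms(6) by (intro outside_supp) auto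
        then show ?thesis
          using False by simp
      qed
    qed
    then show "lip_qnorm s p q \<Omega> (\<lambda>x. of_real (\<phi> x) * f x) \<le> ennreal C * lip_qnorm s p q (half_space l) ?g"
      using C(2)[of ?g] by simp
  qed
qed

lemma boundary_part_cong_AE:
  fixes \<psi> :: "real^'n::finite \<Rightarrow> real^'n"
  assumes "lipschitz_diffeo \<psi>" "bounded U" "\<Omega> \<in> sets lebesgue" "H \<in> sets lebesgue"
    and "AE x in lebesgue_on \<Omega>. f x = g x"
  shows "AE y in lebesgue_on H. boundary_part \<Omega> U \<psi> \<phi> f y = boundary_part \<Omega> U \<psi> \<phi> g y"
proof -
  obtain L where L: "0 < L" "\<And>x y. x \<in> U \<Longrightarrow> y \<in> U \<Longrightarrow> norm (\<psi> x - \<psi> y) \<le> L * norm (x - y)"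
    by (rule lipschitz_diffeo_bilipschitz_on_bounded[OF assms(1,2)]) (rule that)
  have inv: "inv \<psi> (\<psi> x) = x" for x
    using assms(1) by (simp add: lipschitz_diffeo_def bij_def)
  have "negligible {x \<in> \<Omega>. f x \<noteq> g x}"
    using assms(5) by (simp add: AE_lebesgue_on_iff_negligible[OF assms(3)])
  then have "negligible {y \<in> \<psi> ` (U \<inter> \<Omega>). inv \<psi> y \<in> {x \<in> \<Omega>. f x \<noteq> g x}}"
    by (rule negligible_bilipschitz_preimage[where L = L]) (use L(2) in \<open>auto simp: inv\<close>)
  then have "negligible {y \<in> H. boundary_part \<Omega> U \<psi> \<phi> f y \<noteq> boundary_part \<Omega> U \<psi> \<phi> g y}"
    by (rule negligible_subset) (auto simp: boundary_part_def inv split: if_splits)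
  then show ?thesis
    by (simp add: AE_lebesgue_on_iff_negligible[OF assms(4)])
qed

theorem proposition3p12:
  fixes p q :: ennreal and s d :: real and K N :: nat
    and l :: "'n::finite" and \<Omega> :: "(real^'n) set"
    and B :: "nat \<Rightarrow> (real^'n) set"
    and \<psi> :: "nat \<Rightarrow> real^'n \<Rightarrow> real^'n"
    and \<phi> :: "nat \<Rightarrow> real^'n \<Rightarrow> real"
  assumes "0 < p" and "0 < q" and "0 < s" and "s < 1"
    and "d > 1" and "K \<ge> 1 + nat \<lfloor>s\<rfloor>"
    and "lipschitz_domain l \<Omega>"
    and "lipschitz_charts l \<Omega> N B \<psi>"
    and "resolution_of_unity \<Omega> N B \<phi>"
  shows "equivalent_quasi_norm_on (lebesgue_on \<Omega>) (besov_space d K s p q \<Omega>)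
           (besov_qnorm d K s p q \<Omega>)
           (\<lambda>f. besov_qnorm d K s p q UNIV (inner_part \<Omega> (\<phi> 0) f) +
                (\<Sum>j=1..N. besov_qnorm d K s p q (half_space l)
                   (boundary_part \<Omega> (B j) (\<psi> j) (\<phi> j) f)))"
proof -
  note pq = assms(1,2)
  have d: "1 \<le> d" "0 < d" and K: "1 \<le> K"
    using assms(5,6) by auto
  let ?H = "half_space l :: (real^'n) set"
  let ?V = "besov_space d K s p q \<Omega>"
  \<comment> \<open>The inner part is treated as the part with index \<open>0\<close>.\<close>
  define dom where "dom j = (if j = 0 then UNIV else ?H)" for j :: nat
  define P where "P j f = (if j = 0 then inner_part \<Omega> (\<phi> 0) f else boundary_part \<Omega> (B j) (\<psi> j) (\<phi> j) f)"
    for j and f :: "real^'n \<Rightarrow> complex"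
  define Nm where "Nm j f = besov_qnorm d K s p q (dom j) (P j f)" for j f
  let ?N = "besov_qnorm d K s p q \<Omega>"
  define N' where "N' f = (\<Sum>j\<le>N. Nm j f)" for f
  have N'_eq: "besov_qnorm d K s p q UNIV (inner_part \<Omega> (\<phi> 0) f) +
      (\<Sum>j=1..N. besov_qnorm d K s p q ?H (boundary_part \<Omega> (B j) (\<psi> j) (\<phi> j) f)) = N' f" for f
  proof -
    have "{..N} = insert 0 {1..N}" by auto
    then show ?thesis
      by (simp add: N'_def Nm_def dom_def P_def)
  qed

  have op: "open \<Omega>" and bd: "bounded \<Omega>"
    using assms(7) by (auto simp: lipschitz_domain_def is_domain_def)
  have \<Omega>: "\<Omega> \<in> sets lebesgue"
    using op by (rule open_imp_lebesgue_sets)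
  have dom: "dom j \<in> sets lebesgue" for j
    unfolding dom_def using half_space_lebesgue_sets[of l] by simp
  have sm: "smooth (\<phi> j)" "supp (\<phi> j) \<subseteq> B j" if "j \<le> N" for j
    using assms(9) that by (auto simp: resolution_of_unity_def)
  have s0: "supp (\<phi> 0) \<subseteq> \<Omega>"
  proof -
    have "closure (B 0) \<subseteq> \<Omega>"
      using assms(9) by (simp add: resolution_of_unity_def)
    then show ?thesis
      using sm(2)[of 0] closure_subset[of "B 0"] by blast
  qed
  have chart: "open (B j)" "bounded (B j)" "lipschitz_diffeo (\<psi> j)"
    "\<psi> j ` (B j \<inter> \<Omega>) \<subseteq> ?H" "\<psi> j ` (B j \<inter> frontier \<Omega>) \<subseteq> boundary_plane l" if "j \<le> N" "j \<noteq> 0" for j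
  proof -
    have "j \<in> {1..N}" using that by simp
    then have c: "(\<exists>c r. r > 0 \<and> B j = ball c r)" "lipschitz_diffeo (\<psi> j)"
      "\<psi> j ` (B j \<inter> \<Omega>) \<subseteq> ?H" "\<psi> j ` (B j \<inter> frontier \<Omega>) \<subseteq> boundary_plane l"
      using assms(8) by (auto simp: lipschitz_charts_def)
    then show "open (B j)" "bounded (B j)" "lipschitz_diffeo (\<psi> j)"
      "\<psi> j ` (B j \<inter> \<Omega>) \<subseteq> ?H" "\<psi> j ` (B j \<inter> frontier \<Omega>) \<subseteq> boundary_plane l"
      by auto
  qed

  obtain C1 :: real where C1: "0 < C1"
    "\<And>(\<Omega> :: (real^'n) set) f. \<Omega> \<in> sets lebesgue \<Longrightarrow> f \<in> borel_measurable (lebesgue_on \<Omega>) \<Longrightarrow>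
       lip_qnorm s p q \<Omega> f \<le> ennreal C1 * besov_qnorm d K s p q \<Omega> f"
    by (rule lip_qnorm_le_besov_qnorm[OF assms(1-3) d(2) K, where 'n = 'n]) (rule that)
  obtain C2 :: real where C2: "0 < C2"
    "\<And>(\<Omega> :: (real^'n) set) f. \<Omega> \<in> sets lebesgue \<Longrightarrow>
       besov_qnorm d K s p q \<Omega> f \<le> ennreal C2 * lip_qnorm s p q \<Omega> f"
    by (rule besov_qnorm_le_lip_qnorm[OF assms(1-4) d(1), where 'n = 'n and K = K]) (rule that)
  obtain Cs :: real where Cs: "0 < Cs"
    "\<And>(\<Omega> :: (real^'n) set) f. lip_qnorm s p q \<Omega> (\<lambda>x. \<Sum>j\<le>N. f j x) \<le> ennreal Cs * (\<Sum>j\<le>N. lip_qnorm s p q \<Omega> (f j))"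
    by (rule lip_qnorm_sum[OF pq, where 'n = 'n and N = N and s = s]) (rule that)
  obtain Ca :: real where Ca: "0 < Ca"
    "\<And>(\<Omega> :: (real^'n) set) f g. \<Omega> \<in> sets lebesgue \<Longrightarrow>
       f \<in> borel_measurable (lebesgue_on \<Omega>) \<Longrightarrow> g \<in> borel_measurable (lebesgue_on \<Omega>) \<Longrightarrow>
       besov_qnorm d K s p q \<Omega> (\<lambda>x. f x + g x) \<le> ennreal Ca * (besov_qnorm d K s p q \<Omega> f + besov_qnorm d K s p q \<Omega> g)"
    by (rule besov_qnorm_add[OF assms(1-4) d(1) K, where 'n = 'n]) (rule that)

  have "\<forall>j\<in>{..N}. \<exists>C>0. \<forall>f. lip_qnorm s p q (dom j) (P j f) \<le> ennreal C * lip_qnorm s p q \<Omega> f"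
  proof
    fix j assume "j \<in> {..N}"
    then have j: "j \<le> N" by simp
    show "\<exists>C>0. \<forall>f. lip_qnorm s p q (dom j) (P j f) \<le> ennreal C * lip_qnorm s p q \<Omega> f"
    proof (cases "j = 0")
      case True
      obtain C :: real where "0 < C"
        "\<And>f. lip_qnorm s p q UNIV (inner_part \<Omega> (\<phi> 0) f) \<le> ennreal C * lip_qnorm s p q \<Omega> f"
        by (rule lip_qnorm_inner_part_le[OF pq op bd sm(1) s0]) (use that in auto)
      then show ?thesis
        using True by (auto simp: dom_def P_def)
    next
      case False
      obtain C :: real where "0 < C"
        "\<And>f. lip_qnorm s p q ?H (boundary_part \<Omega> (B j) (\<psi> j) (\<phi> j) f) \<le> ennreal C * lip_qnorm s p q \<Omega> f"
        by (rule lip_qnorm_boundary_part_le[OF pq op chart(1,2)[OF j False] sm[OF j] chart(3-5)[OF j False]]) (rule that)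
      then show ?thesis
        using False by (auto simp: dom_def P_def)
    qed
  qed
  then obtain Cu where Cu: "\<And>j. j \<le> N \<Longrightarrow> 0 < Cu j"
    "\<And>j f. j \<le> N \<Longrightarrow> lip_qnorm s p q (dom j) (P j f) \<le> ennreal (Cu j) * lip_qnorm s p q \<Omega> f"
    by (metis atMost_iff)
  have "\<forall>j\<in>{..N}. \<exists>C>0. \<forall>f. lip_qnorm s p q \<Omega> (\<lambda>x. of_real (\<phi> j x) * f x) \<le> ennreal C * lip_qnorm s p q (dom j) (P j f)"
  proof
    fix j assume "j \<in> {..N}"
    then have j: "j \<le> N" by simp
    show "\<exists>C>0. \<forall>f. lip_qnorm s p q \<Omega> (\<lambda>x. of_real (\<phi> j x) * f x) \<le> ennreal C * lip_qnorm s p q (dom j) (P j f)"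
    proof (cases "j = 0")
      case True
      obtain C :: real where "0 < C"
        "\<And>f. lip_qnorm s p q \<Omega> (\<lambda>x. of_real (\<phi> 0 x) * f x) \<le> ennreal C * lip_qnorm s p q UNIV (inner_part \<Omega> (\<phi> 0) f)"
        by (rule lip_qnorm_le_inner_part[OF pq op]) (rule that)
      then show ?thesis
        using True by (auto simp: dom_def P_def)
    next
      case False
      obtain C :: real where "0 < C"
        "\<And>f. lip_qnorm s p q \<Omega> (\<lambda>x. of_real (\<phi> j x) * f x)
           \<le> ennreal C * lip_qnorm s p q ?H (boundary_part \<Omega> (B j) (\<psi> j) (\<phi> j) f)"
        by (rule lip_qnorm_le_boundary_part[OF pq op chart(1,2)[OF j False] sm(2)[OF j] chart(3,4)[OF j False]]) (rule that)
      then show ?thesis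
        using False by (auto simp: dom_def P_def)
    qed
  qed
  then obtain Cl where Cl: "\<And>j. j \<le> N \<Longrightarrow> 0 < Cl j"
    "\<And>j f. j \<le> N \<Longrightarrow> lip_qnorm s p q \<Omega> (\<lambda>x. of_real (\<phi> j x) * f x) \<le> ennreal (Cl j) * lip_qnorm s p q (dom j) (P j f)"
    by (metis atMost_iff)

  have V: "f \<in> borel_measurable (lebesgue_on \<Omega>)" "?N f < \<infinity>" "lip_qnorm s p q \<Omega> f < \<infinity>" if f: "f \<in> ?V" for f
  proof -
    show m: "f \<in> borel_measurable (lebesgue_on \<Omega>)"
      using f by (simp add: besov_space_def Lp_space_def)
    obtain lam a where "atomic_rep d K p \<Omega> f lam a" "b_qnorm s p q \<Omega> lam < \<infinity>"
      using f by (auto simp: besov_space_def)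
    then show N: "?N f < \<infinity>"
      unfolding besov_qnorm_def Inf_less_iff by blast
    show "lip_qnorm s p q \<Omega> f < \<infinity>"
      using N by (intro le_less_trans[OF C1(2)[OF \<Omega> m]]) (simp add: ennreal_mult_less_top)
  qed
  \<comment> \<open>The parts of \<open>f\<close> have Lipschitz representations, which makes them measurable.\<close>
  have P_meas: "P j f \<in> borel_measurable (lebesgue_on (dom j))" if "f \<in> ?V" "j \<le> N" for j f
    using V(3)[OF that(1)]
    by (intro lip_qnorm_finite_imp_measurable[OF dom, where s = s and p = p and q = q] le_less_trans[OF Cu(2)[OF that(2)]])
      (simp add: ennreal_mult_less_top)

  have upper: "N' f \<le> ennreal (\<Sum>j\<le>N. C2 * (Cu j * C1)) * ?N f" if f: "f \<in> ?V" for f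
  proof -
    have "Nm j f \<le> ennreal (C2 * (Cu j * C1)) * ?N f" if j: "j \<le> N" for j
    proof -
      have "Nm j f \<le> ennreal C2 * lip_qnorm s p q (dom j) (P j f)"
        unfolding Nm_def by (rule C2(2)[OF dom])
      also have "\<dots> \<le> ennreal C2 * (ennreal (Cu j) * (ennreal C1 * ?N f))"
        using C1(2)[OF \<Omega> V(1)[OF f]]
        by (intro mult_left_mono order_trans[OF Cu(2)[OF j]]) auto
      also have "\<dots> = ennreal (C2 * (Cu j * C1)) * ?N f"
        using C1(1) C2(1) Cu(1)[OF j] by (simp add: ennreal_mult mult.assoc)
      finally show ?thesis .
    qed
    then have "N' f \<le> (\<Sum>j\<le>N. ennreal (C2 * (Cu j * C1)) * ?N f)"
      unfolding N'_def by (intro sum_mono) simp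
    also have "\<dots> = ennreal (\<Sum>j\<le>N. C2 * (Cu j * C1)) * ?N f"
    proof -
      have "(\<Sum>j\<le>N. ennreal (C2 * (Cu j * C1))) = ennreal (\<Sum>j\<le>N. C2 * (Cu j * C1))"
        using C1(1) C2(1) Cu(1) by (intro sum_ennreal mult_nonneg_nonneg) (auto simp: less_imp_le)
      then show ?thesis
        by (simp only: sum_distrib_right[symmetric])
    qed
    finally show ?thesis .
  qed
  have lower: "?N f \<le> ennreal (C2 * (Cs * (\<Sum>j\<le>N. Cl j * C1))) * N' f" if f: "f \<in> ?V" for f
  proof -
    have one: "(\<Sum>j\<le>N. \<phi> j x) = 1" if "x \<in> \<Omega>" for x
      using assms(9) that closure_subset[of \<Omega>] by (auto simp: resolution_of_unity_def)
    have "f x = (\<Sum>j\<le>N. of_real (\<phi> j x) * f x)" if "x \<in> \<Omega>" for x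
      using one[OF that] by (simp flip: sum_distrib_right of_real_sum)
    then have "lip_qnorm s p q \<Omega> f = lip_qnorm s p q \<Omega> (\<lambda>x. \<Sum>j\<le>N. of_real (\<phi> j x) * f x)"
      by (rule lip_qnorm_cong)
    also have "\<dots> \<le> ennreal Cs * (\<Sum>j\<le>N. lip_qnorm s p q \<Omega> (\<lambda>x. of_real (\<phi> j x) * f x))"
      by (rule Cs(2))
    also have "\<dots> \<le> ennreal Cs * (\<Sum>j\<le>N. ennreal (\<Sum>j\<le>N. Cl j * C1) * Nm j f)"
    proof (intro mult_left_mono sum_mono)
      fix j assume "j \<in> {..N}"
      then have j: "j \<le> N" by simp
      have "lip_qnorm s p q \<Omega> (\<lambda>x. of_real (\<phi> j x) * f x) \<le> ennreal (Cl j) * (ennreal C1 * Nm j f)"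
        unfolding Nm_def using C1(2)[OF dom P_meas[OF f j]]
        by (intro order_trans[OF Cl(2)[OF j]] mult_left_mono) auto
      also have "\<dots> = ennreal (Cl j * C1) * Nm j f"
        using C1(1) Cl(1)[OF j] by (simp add: ennreal_mult mult.assoc)
      also have "\<dots> \<le> ennreal (\<Sum>j\<le>N. Cl j * C1) * Nm j f"
        using j C1(1) Cl(1) by (intro mult_right_mono ennreal_leI member_le_sum) (auto simp: less_imp_le)
      finally show "lip_qnorm s p q \<Omega> (\<lambda>x. of_real (\<phi> j x) * f x) \<le> ennreal (\<Sum>j\<le>N. Cl j * C1) * Nm j f" .
    qed simp
    also have "\<dots> = ennreal Cs * (ennreal (\<Sum>j\<le>N. Cl j * C1) * N' f)"
      by (simp add: N'_def sum_distrib_left)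
    finally have "?N f \<le> ennreal C2 * (ennreal Cs * (ennreal (\<Sum>j\<le>N. Cl j * C1) * N' f))"
      by (intro order_trans[OF C2(2)[OF \<Omega>]] mult_left_mono) auto
    moreover have "0 \<le> (\<Sum>j\<le>N. Cl j * C1)"
      using C1(1) Cl(1) by (intro sum_nonneg mult_nonneg_nonneg) (auto simp: less_imp_le)
    ultimately show ?thesis
      using C2(1) Cs(1) by (simp add: ennreal_mult mult.assoc)
  qed
  define CU where "CU = (\<Sum>j\<le>N. C2 * (Cu j * C1))"
  define CL where "CL = C2 * (Cs * (\<Sum>j\<le>N. Cl j * C1))"
  have CU: "0 < CU" and CL: "0 < CL"
    unfolding CU_def CL_def using C1(1) C2(1) Cs(1) Cu(1) Cl(1)
    by (intro sum_pos mult_pos_pos; auto)+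

  have AE0: "?N f = 0 \<longleftrightarrow> (AE x in lebesgue_on \<Omega>. f x = 0)" if f: "f \<in> ?V" for f
  proof
    assume "?N f = 0"
    then have "lip_qnorm s p q \<Omega> f = 0"
      using C1(2)[OF \<Omega> V(1)[OF f]] by simp
    then show "AE x in lebesgue_on \<Omega>. f x = 0"
      by (rule lip_qnorm_eq_0_AE[OF assms(1-3) \<Omega>])
  next
    assume "AE x in lebesgue_on \<Omega>. f x = 0"
    then have "?N f = ?N (\<lambda>x. 0)"
      by (rule besov_qnorm_cong_AE[OF \<Omega>])
    also have "\<dots> \<le> ennreal C2 * lip_qnorm s p q \<Omega> (\<lambda>x. 0)"
      by (rule C2(2)[OF \<Omega>])
    finally show "?N f = 0"
      by (simp add: lip_qnorm_zero[OF pq])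
  qed
  have P_add: "P j (\<lambda>x. f x + g x) = (\<lambda>y. P j f y + P j g y)" for j f g
    by (auto simp: P_def inner_part_def boundary_part_def fun_eq_iff distrib_left)
  have P_cmult: "P j (\<lambda>x. c * f x) = (\<lambda>y. c * P j f y)" for j f c
    by (auto simp: P_def inner_part_def boundary_part_def fun_eq_iff mult.left_commute)

  have "quasi_norm_on (lebesgue_on \<Omega>) ?V N'"
    unfolding quasi_norm_on_def
  proof (intro conjI ballI allI impI)
    fix f assume f: "f \<in> ?V"
    show "N' f < \<infinity>"
      using V(2)[OF f] by (intro le_less_trans[OF upper[OF f]]) (simp add: ennreal_mult_less_top)
    show "N' f = 0 \<longleftrightarrow> (AE x in lebesgue_on \<Omega>. f x = 0)"
      using upper[OF f] lower[OF f] AE0[OF f] by auto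
  next
    fix f g assume fg: "f \<in> ?V" "g \<in> ?V" and ae: "AE x in lebesgue_on \<Omega>. f x = g x"
    have "Nm j f = Nm j g" if j: "j \<le> N" for j
      unfolding Nm_def
    proof (rule besov_qnorm_cong_AE[OF dom])
      show "AE y in lebesgue_on (dom j). P j f y = P j g y"
      proof (cases "j = 0")
        case True
        have "negligible {x \<in> \<Omega>. f x \<noteq> g x}"
          using ae by (simp add: AE_lebesgue_on_iff_negligible[OF \<Omega>])
        then have "negligible {x \<in> UNIV. inner_part \<Omega> (\<phi> 0) f x \<noteq> inner_part \<Omega> (\<phi> 0) g x}"
          by (rule negligible_subset) (auto simp: inner_part_def split: if_splits)
        then show ?thesis
          using True dom[of 0] by (simp add: dom_def P_def AE_lebesgue_on_iff_negligible del: lebesgue_on_UNIV_eq)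
      next
        case False
        then show ?thesis
          using boundary_part_cong_AE[OF chart(3,2)[OF j False] \<Omega> dom[of j] ae, where \<phi> = "\<phi> j"]
          by (simp add: P_def)
      qed
    qed
    then show "N' f = N' g"
      unfolding N'_def by (intro sum.cong) auto
  next
    fix f c assume f: "f \<in> ?V"
    have "Nm j (\<lambda>x. c * f x) = ennreal (cmod c) * Nm j f" for j
      unfolding Nm_def P_cmult by (rule besov_qnorm_cmult[OF assms(1-4) d(1) dom])
    then show "N' (\<lambda>x. c * f x) = ennreal (cmod c) * N' f"
      by (simp add: N'_def sum_distrib_left)
  next
    show "\<exists>C::real. \<forall>f\<in>?V. \<forall>g\<in>?V. N' (\<lambda>x. f x + g x) \<le> ennreal C * (N' f + N' g)"
    proof (intro exI[of _ Ca] ballI)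
      fix f g assume fg: "f \<in> ?V" "g \<in> ?V"
      have "N' (\<lambda>x. f x + g x) \<le> (\<Sum>j\<le>N. ennreal Ca * (Nm j f + Nm j g))"
        unfolding N'_def Nm_def P_add using P_meas fg by (intro sum_mono Ca(2) dom) auto
      also have "\<dots> = ennreal Ca * (N' f + N' g)"
        by (simp add: N'_def sum.distrib flip: sum_distrib_left)
      finally show "N' (\<lambda>x. f x + g x) \<le> ennreal Ca * (N' f + N' g)" .
    qed
  qed
  moreover have "ennreal (1 / CL) * ?N f \<le> N' f" if f: "f \<in> ?V" for f
  proof -
    have "ennreal (1 / CL) * ?N f \<le> ennreal (1 / CL) * (ennreal CL * N' f)"
      using lower[OF f] by (intro mult_left_mono) (auto simp: CL_def)
    also have "\<dots> = N' f"
    proof -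
      have "ennreal (1 / CL) * ennreal CL = 1"
        using CL by (simp flip: ennreal_mult)
      then show ?thesis
        by (simp flip: mult.assoc)
    qed
    finally show ?thesis .
  qed
  ultimately have "equivalent_quasi_norm_on (lebesgue_on \<Omega>) ?V ?N N'"
    unfolding equivalent_quasi_norm_on_def using upper CU CL
    by (intro conjI exI[of _ "1 / CL"] exI[of _ CU]) (auto simp: CU_def)
  then show ?thesis
    unfolding N'_eq .
qed

end
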